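(* Let $k$ be a field and let $\mathcal{C}\to\mathcal{B}=\mathcal{C}/G$ be a Galois covering of $k$-categories with group $G$, where $\mathcal{C}$ is connected and $\mathcal{B}$ is hom-finite, basic and totally split. Then there is a canonical vector space monomorphism $$\operatorname{Hom}(G,k)\hookrightarrow H^1(\mathcal{B},\mathcal{B}),$$ where $\operatorname{Hom}(G,k)$ is the $k$-vector space of group homomorphisms from $G$ to the additive group $k^+$ of $k$.
   Context: $k$-categories and bimodules. A $k$-category is a small category whose morphism sets are $k$-vector spaces and whose composition is $k$-bilinear. $\mathcal{C}_0$ is the set of objects and ${}_y\mathcal{C}_x$ is the space of morphisms from $x$ to $y$, so composition is ${}_z\mathcal{C}_y\otimes_k{}_y\mathcal{C}_x\to{}_z\mathcal{C}_x$. A $\mathcal{C}$-bimodule $\mathcal{M}$ is a family of vector spaces $\{{}_y\mathcal{M}_x\}_{x,y\in\mathcal{C}_0}$ with $k$-bilinear left and right actions ${}_z\mathcal{C}_y\otimes{}_y\mathcal{M}_x\to{}_z\mathcal{M}_x$ and ${}_y\mathcal{M}_x\otimes{}_x\mathcal{C}_u\to{}_y\mathcal{M}_u$ that are associative, unital and commute with each other. The category $\mathcal{C}$ itself, with ${}_y\mathcal{C}_x$ and actions by composition, is the standard bimodule. Hochschild-Mitchell cohomology. $H^*(\mathcal{C},\mathcal{M})$ is the cohomology of the cochain complex with $C^0(\mathcal{C},\mathcal{M})=\prod_x{}_x\mathcal{M}_x$ and, for $n\ge1$, $C^n(\mathcal{C},\mathcal{M})=\prod_{(x_{n+1},\dots,x_1)}\operatorname{Hom}_k({}_{x_{n+1}}\mathcal{C}_{x_n}\otimes\cdots\otimes{}_{x_2}\mathcal{C}_{x_1},\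 {}_{x_{n+1}}\mathcal{M}_{x_1})$, with coboundary $df(c_{n+1}\otimes\cdots\otimes c_1)=(-1)^{n+1}c_{n+1}f(c_n\otimes\cdots\otimes c_1)+\sum_{i=1}^n(-1)^if(c_{n+1}\otimes\cdots\otimes c_{i+1}c_i\otimes\cdots\otimes c_1)+f(c_{n+1}\otimes\cdots\otimes c_2)c_1$ (in degree $0$: $(d(m_x)_x)(c)=-c\,m_x+m_y\,c$ for $c\in{}_y\mathcal{C}_x$). Galois coverings. A group $G$ acts freely on $\mathcal{C}$ if $G$ acts on $\mathcal{C}_0$ with $sx=x$ for some $x$ only when $s=1$, and acts on morphisms by $k$-linear maps $s:{}_y\mathcal{C}_x\to{}_{sy}\mathcal{C}_{sx}$ with $s(dc)=(sd)(sc)$ and $s(tc)=(st)c$. For a $kG$-module $X$, $X/G$ denotes the coinvariants $X/(\operatorname{Ker}\epsilon)X$, where $\epsilon:kG\to k$ is the augmentation. The quotient category $\mathcal{C}/G$ has as objects the $G$-orbits of objects of $\mathcal{C}$, and for orbits $u,v$, ${}_v(\mathcal{C}/G)_u=\bigl(\bigoplus_{x\in u,\,y\in v}{}_y\mathcal{C}_x\bigr)/G$. The composition of the class of $d\in{}_z\mathcal{C}_{y'}$ with the class of $c\in{}_y\mathcal{C}_x$ ($y,y'$ in the same orbit) is the class of $(sd)c$, where $s$ is the unique element of $G$ with $sy'=y$. A Galois covering with group $G$ is the projection functor $\mathcal{C}\to\mathcal{B}=\mathcal{C}/G$ for a free action of $G$ on $\mathcal{C}$. Conditions on $k$-categories.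 A $k$-category $\mathcal{B}$ is basic if no two different objects are isomorphic; hom-finite if every ${}_y\mathcal{B}_x$ is finite dimensional; split if every ${}_x\mathcal{B}_x$ is a local $k$-algebra; totally split if it is split and for each object $x$ there is a decomposition ${}_x\mathcal{B}_x=k\oplus M_x$, where $M_x$ is the maximal ideal of ${}_x\mathcal{B}_x$ (so the residue algebra is $k$). A $k$-category $\mathcal{C}$ is connected if the equivalence relation on objects generated by $x\sim y$ whenever ${}_y\mathcal{C}_x\ne0$ or ${}_x\mathcal{C}_y\ne0$ has exactly one class. *)

theory Defs
  imports "HOL-Algebra.AbelCoset" "HOL-Algebra.Module" "HOL-Algebra.Group_Action"
begin

section \<open>Vector spaces\<close>

text \<open>
  A vector space over a field \<open>K\<close> is a module over \<open>K\<close> in the sense of HOL-Algebra. The type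
  \<^typ>\<open>('k, 'v) module\<close> extends the type of rings; its fields \<open>mult\<close> and \<open>one\<close> play no role for
  modules and are left unspecified in the constructions below.
\<close>

definition klinear ::
  "'k ring \<Rightarrow> ('k, 'v) module \<Rightarrow> ('k, 'w) module \<Rightarrow> ('v \<Rightarrow> 'w) \<Rightarrow> bool" where
  "klinear K V W f \<longleftrightarrow>
     f \<in> carrier V \<rightarrow> carrier W \<and>
     (\<forall>v\<in>carrier V. \<forall>v'\<in>carrier V. f (v \<oplus>\<^bsub>V\<^esub> v') = f v \<oplus>\<^bsub>W\<^esub> f v') \<and>
     (\<forall>a\<in>carrier K. \<forall>v\<in>carrier V. f (a \<odot>\<^bsub>V\<^esub> v) = a \<odot>\<^bsub>W\<^esub> f v)"

definition kmonomorphism ::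
  "'k ring \<Rightarrow> ('k, 'v) module \<Rightarrow> ('k, 'w) module \<Rightarrow> ('v \<Rightarrow> 'w) \<Rightarrow> bool" where
  "kmonomorphism K V W f \<longleftrightarrow>
     module K V \<and> module K W \<and> klinear K V W f \<and> inj_on f (carrier V)"

definition kspan :: "'k ring \<Rightarrow> ('k, 'v) module \<Rightarrow> 'v set \<Rightarrow> 'v set" where
  "kspan K V S = \<Inter>{U. submodule U K V \<and> S \<subseteq> U}"

definition finite_dimensional :: "'k ring \<Rightarrow> ('k, 'v) module \<Rightarrow> bool" where
  "finite_dimensional K V \<longleftrightarrow> (\<exists>S. finite S \<and> S \<subseteq> carrier V \<and> kspan K V S = carrier V)"

definition quot_module :: "('k, 'v) module \<Rightarrow> 'v set \<Rightarrow> ('k, 'v set) module" where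
  "quot_module V U =
     \<lparr>carrier = a_rcosets\<^bsub>V\<^esub> U, mult = undefined, one = undefined,
      zero = U, add = set_add V,
      smult = (\<lambda>a A. \<Union>x\<in>A. U +>\<^bsub>V\<^esub> (a \<odot>\<^bsub>V\<^esub> x))\<rparr>"

definition dsum :: "'i set \<Rightarrow> ('i \<Rightarrow> ('k, 'v) module) \<Rightarrow> ('k, 'i \<Rightarrow> 'v) module" where
  "dsum I V =
     \<lparr>carrier = {f \<in> \<Pi>\<^sub>E i\<in>I. carrier (V i). finite {i \<in> I. f i \<noteq> \<zero>\<^bsub>V i\<^esub>}},
      mult = undefined, one = undefined,
      zero = (\<lambda>i\<in>I. \<zero>\<^bsub>V i\<^esub>),
      add = (\<lambda>f g. \<lambda>i\<in>I. f i \<oplus>\<^bsub>V i\<^esub> g i),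
      smult = (\<lambda>a f. \<lambda>i\<in>I. a \<odot>\<^bsub>V i\<^esub> f i)\<rparr>"

definition dsum_inj :: "'i set \<Rightarrow> ('i \<Rightarrow> ('k, 'v) module) \<Rightarrow> 'i \<Rightarrow> 'v \<Rightarrow> 'i \<Rightarrow> 'v" where
  "dsum_inj I V j v = (\<lambda>i\<in>I. if i = j then v else \<zero>\<^bsub>V i\<^esub>)"

definition dsum_supp :: "'i set \<Rightarrow> ('i \<Rightarrow> ('k, 'v) module) \<Rightarrow> ('i \<Rightarrow> 'v) \<Rightarrow> 'i set" where
  "dsum_supp I V f = {i \<in> I. f i \<noteq> \<zero>\<^bsub>V i\<^esub>}"

text \<open>Group homomorphisms are extensional functions, so that equality is equality on \<open>G\<close>.\<close>

definition Hom_module :: "'g monoid \<Rightarrow> 'k ring \<Rightarrow> ('k, 'g \<Rightarrow> 'k) module" where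
  "Hom_module G K =
     \<lparr>carrier = hom G (add_monoid K) \<inter> extensional (carrier G),
      mult = undefined, one = undefined,
      zero = (\<lambda>s\<in>carrier G. \<zero>\<^bsub>K\<^esub>),
      add = (\<lambda>\<chi> \<psi>. \<lambda>s\<in>carrier G. \<chi> s \<oplus>\<^bsub>K\<^esub> \<psi> s),
      smult = (\<lambda>a \<chi>. \<lambda>s\<in>carrier G. a \<otimes>\<^bsub>K\<^esub> \<chi> s)\<rparr>"

section \<open>Categories over a field and bimodules\<close>

text \<open>
  Targets come first: \<open>Mor C y x\<close> is the space of morphisms from \<open>x\<close> to \<open>y\<close>, and
  \<open>Comp C z y x d c\<close> is the composite of \<open>c : x \<rightarrow> y\<close> followed by \<open>d : y \<rightarrow> z\<close>.
\<close>

record ('o, 'm, 'k) kcat =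
  Obj :: "'o set"
  Mor :: "'o \<Rightarrow> 'o \<Rightarrow> ('k, 'm) module"
  Idn :: "'o \<Rightarrow> 'm"
  Comp :: "'o \<Rightarrow> 'o \<Rightarrow> 'o \<Rightarrow> 'm \<Rightarrow> 'm \<Rightarrow> 'm"

locale k_category = field K for K :: "'k ring" (structure) +
  fixes C :: "('o, 'm, 'k) kcat"
  assumes Mor_module: "\<lbrakk>x \<in> Obj C; y \<in> Obj C\<rbrakk> \<Longrightarrow> module K (Mor C y x)"
    and Idn_closed: "x \<in> Obj C \<Longrightarrow> Idn C x \<in> carrier (Mor C x x)"
    and Comp_linear_left:
      "\<lbrakk>x \<in> Obj C; y \<in> Obj C; z \<in> Obj C; c \<in> carrier (Mor C y x)\<rbrakk>
        \<Longrightarrow> klinear K (Mor C z y) (Mor C z x) (\<lambda>d. Comp C z y x d c)"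
    and Comp_linear_right:
      "\<lbrakk>x \<in> Obj C; y \<in> Obj C; z \<in> Obj C; d \<in> carrier (Mor C z y)\<rbrakk>
        \<Longrightarrow> klinear K (Mor C y x) (Mor C z x) (Comp C z y x d)"
    and Comp_assoc:
      "\<lbrakk>x \<in> Obj C; y \<in> Obj C; z \<in> Obj C; w \<in> Obj C;
        c \<in> carrier (Mor C y x); d \<in> carrier (Mor C z y); e \<in> carrier (Mor C w z)\<rbrakk>
        \<Longrightarrow> Comp C w z x e (Comp C z y x d c) = Comp C w y x (Comp C w z y e d) c"
    and Comp_Idn_left:
      "\<lbrakk>x \<in> Obj C; y \<in> Obj C; c \<in> carrier (Mor C y x)\<rbrakk>
        \<Longrightarrow> Comp C y y x (Idn C y) c = c"
    and Comp_Idn_right: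
      "\<lbrakk>x \<in> Obj C; y \<in> Obj C; c \<in> carrier (Mor C y x)\<rbrakk>
        \<Longrightarrow> Comp C y x x c (Idn C x) = c"

text \<open>
  \<open>LAct M z y x c m\<close> is \<open>c m\<close> for \<open>c : y \<rightarrow> z\<close> and \<open>m\<close> in \<open>Bim M y x\<close>;
  \<open>RAct M y x u m c\<close> is \<open>m c\<close> for \<open>m\<close> in \<open>Bim M y x\<close> and \<open>c : u \<rightarrow> x\<close>.
\<close>

record ('o, 'm, 'k, 'b) kbimod =
  Bim :: "'o \<Rightarrow> 'o \<Rightarrow> ('k, 'b) module"
  LAct :: "'o \<Rightarrow> 'o \<Rightarrow> 'o \<Rightarrow> 'm \<Rightarrow> 'b \<Rightarrow> 'b"
  RAct :: "'o \<Rightarrow> 'o \<Rightarrow> 'o \<Rightarrow> 'b \<Rightarrow> 'm \<Rightarrow> 'b"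

locale k_bimodule = k_category K C
  for K :: "'k ring" (structure) and C :: "('o, 'm, 'k) kcat" +
  fixes M :: "('o, 'm, 'k, 'b) kbimod"
  assumes Bim_module: "\<lbrakk>x \<in> Obj C; y \<in> Obj C\<rbrakk> \<Longrightarrow> module K (Bim M y x)"
    and LAct_linear_left:
      "\<lbrakk>x \<in> Obj C; y \<in> Obj C; z \<in> Obj C; m \<in> carrier (Bim M y x)\<rbrakk>
        \<Longrightarrow> klinear K (Mor C z y) (Bim M z x) (\<lambda>c. LAct M z y x c m)"
    and LAct_linear_right:
      "\<lbrakk>x \<in> Obj C; y \<in> Obj C; z \<in> Obj C; c \<in> carrier (Mor C z y)\<rbrakk>
        \<Longrightarrow> klinear K (Bim M y x) (Bim M z x) (LAct M z y x c)"
    and RAct_linear_left: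
      "\<lbrakk>u \<in> Obj C; x \<in> Obj C; y \<in> Obj C; c \<in> carrier (Mor C x u)\<rbrakk>
        \<Longrightarrow> klinear K (Bim M y x) (Bim M y u) (\<lambda>m. RAct M y x u m c)"
    and RAct_linear_right:
      "\<lbrakk>u \<in> Obj C; x \<in> Obj C; y \<in> Obj C; m \<in> carrier (Bim M y x)\<rbrakk>
        \<Longrightarrow> klinear K (Mor C x u) (Bim M y u) (RAct M y x u m)"
    and LAct_assoc:
      "\<lbrakk>x \<in> Obj C; y \<in> Obj C; z \<in> Obj C; w \<in> Obj C;
        m \<in> carrier (Bim M y x); c \<in> carrier (Mor C z y); d \<in> carrier (Mor C w z)\<rbrakk>
        \<Longrightarrow> LAct M w z x d (LAct M z y x c m) = LAct M w y x (Comp C w z y d c) m"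
    and RAct_assoc:
      "\<lbrakk>x \<in> Obj C; y \<in> Obj C; u \<in> Obj C; v \<in> Obj C;
        m \<in> carrier (Bim M y x); c \<in> carrier (Mor C x u); d \<in> carrier (Mor C u v)\<rbrakk>
        \<Longrightarrow> RAct M y u v (RAct M y x u m c) d = RAct M y x v m (Comp C x u v c d)"
    and LAct_RAct:
      "\<lbrakk>u \<in> Obj C; x \<in> Obj C; y \<in> Obj C; z \<in> Obj C;
        d \<in> carrier (Mor C z y); m \<in> carrier (Bim M y x); c \<in> carrier (Mor C x u)\<rbrakk>
        \<Longrightarrow> RAct M z x u (LAct M z y x d m) c = LAct M z y u d (RAct M y x u m c)"
    and LAct_Idn:
      "\<lbrakk>x \<in> Obj C; y \<in> Obj C; m \<in> carrier (Bim M y x)\<rbrakk>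
        \<Longrightarrow> LAct M y y x (Idn C y) m = m"
    and RAct_Idn:
      "\<lbrakk>x \<in> Obj C; y \<in> Obj C; m \<in> carrier (Bim M y x)\<rbrakk>
        \<Longrightarrow> RAct M y x x m (Idn C x) = m"

definition standard_bimodule :: "('o, 'm, 'k) kcat \<Rightarrow> ('o, 'm, 'k, 'm) kbimod" where
  "standard_bimodule C = \<lparr>Bim = Mor C, LAct = Comp C, RAct = Comp C\<rparr>"

lemma (in k_category) standard_bimodule: "k_bimodule K C (standard_bimodule C)"
  by (intro k_bimodule.intro k_category_axioms k_bimodule_axioms.intro)
    (simp_all add: standard_bimodule_def Mor_module Comp_linear_left Comp_linear_right
      Comp_assoc Comp_Idn_left Comp_Idn_right)

section \<open>Hochschild-Mitchell cohomology\<close>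

text \<open>
  A pair \<open>(xs, cs)\<close> in \<open>chains C n\<close> is \<open>xs = [x\<^sub>n\<^sub>+\<^sub>1, \<dots>, x\<^sub>1]\<close> and \<open>cs = [c\<^sub>n, \<dots>, c\<^sub>1]\<close> with
  \<open>c\<^sub>i : x\<^sub>i \<rightarrow> x\<^sub>i\<^sub>+\<^sub>1\<close>. Linear maps on a tensor product are rendered as multilinear maps. For
  \<open>n = 0\<close> a cochain is a family of elements of the spaces \<open>Bim M x x\<close>, indexed by \<open>([x], [])\<close>.
\<close>

definition chains :: "('o, 'm, 'k) kcat \<Rightarrow> nat \<Rightarrow> ('o list \<times> 'm list) set" where
  "chains C n =
     {(xs, cs). length xs = Suc n \<and> length cs = n \<and> set xs \<subseteq> Obj C \<and>
        (\<forall>i<n. cs ! i \<in> carrier (Mor C (xs ! i) (xs ! Suc i)))}"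

definition multilinear_on_chains ::
  "'k ring \<Rightarrow> ('o, 'm, 'k) kcat \<Rightarrow> ('o, 'm, 'k, 'b) kbimod \<Rightarrow> nat \<Rightarrow>
   ('o list \<times> 'm list \<Rightarrow> 'b) \<Rightarrow> bool" where
  "multilinear_on_chains K C M n f \<longleftrightarrow>
     (\<forall>(xs, cs)\<in>chains C n. \<forall>i<n.
        klinear K (Mor C (xs ! i) (xs ! Suc i)) (Bim M (hd xs) (last xs))
          (\<lambda>c. f (xs, cs[i := c])))"

definition cochains ::
  "'k ring \<Rightarrow> ('o, 'm, 'k) kcat \<Rightarrow> ('o, 'm, 'k, 'b) kbimod \<Rightarrow> nat \<Rightarrow>
   ('k, 'o list \<times> 'm list \<Rightarrow> 'b) module" where
  "cochains K C M n =
     \<lparr>carrier = {f \<in> \<Pi>\<^sub>E (xs, cs)\<in>chains C n. carrier (Bim M (hd xs) (last xs)).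
                   multilinear_on_chains K C M n f},
      mult = undefined, one = undefined,
      zero = (\<lambda>(xs, cs)\<in>chains C n. \<zero>\<^bsub>Bim M (hd xs) (last xs)\<^esub>),
      add = (\<lambda>f g. \<lambda>(xs, cs)\<in>chains C n.
               f (xs, cs) \<oplus>\<^bsub>Bim M (hd xs) (last xs)\<^esub> g (xs, cs)),
      smult = (\<lambda>a f. \<lambda>(xs, cs)\<in>chains C n.
                 a \<odot>\<^bsub>Bim M (hd xs) (last xs)\<^esub> f (xs, cs))\<rparr>"

text \<open>
  On \<open>xs = [x\<^sub>n\<^sub>+\<^sub>2, \<dots>, x\<^sub>1]\<close> and \<open>cs = [c\<^sub>n\<^sub>+\<^sub>1, \<dots>, c\<^sub>1]\<close> one has \<open>x\<^sub>i = xs ! (n + 2 - i)\<close> and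
  \<open>c\<^sub>i = cs ! (n + 1 - i)\<close>. The face \<open>merge C n i\<close> replaces \<open>c\<^sub>i\<^sub>+\<^sub>1, c\<^sub>i\<close> by their composite and
  drops \<open>x\<^sub>i\<^sub>+\<^sub>1\<close>. For \<open>n = 0\<close> the formula reads \<open>- c f(x) + f(y) c\<close> for \<open>c : x \<rightarrow> y\<close>.
\<close>

definition merge ::
  "('o, 'm, 'k) kcat \<Rightarrow> nat \<Rightarrow> nat \<Rightarrow> 'o list \<times> 'm list \<Rightarrow> 'o list \<times> 'm list" where
  "merge C n i = (\<lambda>(xs, cs).
     (take (n + 1 - i) xs @ drop (n + 2 - i) xs,
      take (n - i) cs @
      [Comp C (xs ! (n - i)) (xs ! (n + 1 - i)) (xs ! (n + 2 - i))
         (cs ! (n - i)) (cs ! (n + 1 - i))] @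
      drop (n + 2 - i) cs))"

definition coboundary ::
  "'k ring \<Rightarrow> ('o, 'm, 'k) kcat \<Rightarrow> ('o, 'm, 'k, 'b) kbimod \<Rightarrow> nat \<Rightarrow>
   ('o list \<times> 'm list \<Rightarrow> 'b) \<Rightarrow> 'o list \<times> 'm list \<Rightarrow> 'b" where
  "coboundary K C M n f = (\<lambda>(xs, cs)\<in>chains C (Suc n).
     let V = Bim M (hd xs) (last xs); sgn = (\<lambda>i::nat. (\<ominus>\<^bsub>K\<^esub> \<one>\<^bsub>K\<^esub>) [^]\<^bsub>K\<^esub> i) in
       (sgn (n + 1) \<odot>\<^bsub>V\<^esub> LAct M (xs ! 0) (xs ! 1) (last xs) (hd cs) (f (tl xs, tl cs)))
       \<oplus>\<^bsub>V\<^esub> (\<Oplus>\<^bsub>V\<^esub> i \<in> {1..n}. sgn i \<odot>\<^bsub>V\<^esub> f (merge C n i (xs, cs)))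
       \<oplus>\<^bsub>V\<^esub> RAct M (hd xs) (xs ! n) (xs ! (n + 1)) (f (butlast xs, butlast cs)) (last cs))"

definition cocycles ::
  "'k ring \<Rightarrow> ('o, 'm, 'k) kcat \<Rightarrow> ('o, 'm, 'k, 'b) kbimod \<Rightarrow> nat \<Rightarrow>
   ('k, 'o list \<times> 'm list \<Rightarrow> 'b) module" where
  "cocycles K C M n =
     (cochains K C M n)\<lparr>carrier :=
        {f \<in> carrier (cochains K C M n).
           coboundary K C M n f = \<zero>\<^bsub>cochains K C M (Suc n)\<^esub>}\<rparr>"

definition coboundaries ::
  "'k ring \<Rightarrow> ('o, 'm, 'k) kcat \<Rightarrow> ('o, 'm, 'k, 'b) kbimod \<Rightarrow> nat \<Rightarrow>
   ('o list \<times> 'm list \<Rightarrow> 'b) set" where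
  "coboundaries K C M n =
     (case n of 0 \<Rightarrow> {\<zero>\<^bsub>cochains K C M 0\<^esub>}
      | Suc m \<Rightarrow> coboundary K C M m ` carrier (cochains K C M m))"

definition HH ::
  "'k ring \<Rightarrow> ('o, 'm, 'k) kcat \<Rightarrow> ('o, 'm, 'k, 'b) kbimod \<Rightarrow> nat \<Rightarrow>
   ('k, ('o list \<times> 'm list \<Rightarrow> 'b) set) module" where
  "HH K C M n = quot_module (cocycles K C M n) (coboundaries K C M n)"

definition cohomology_class ::
  "'k ring \<Rightarrow> ('o, 'm, 'k) kcat \<Rightarrow> ('o, 'm, 'k, 'b) kbimod \<Rightarrow> nat \<Rightarrow>
   ('o list \<times> 'm list \<Rightarrow> 'b) \<Rightarrow> ('o list \<times> 'm list \<Rightarrow> 'b) set" where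
  "cohomology_class K C M n f = coboundaries K C M n +>\<^bsub>cocycles K C M n\<^esub> f"

section \<open>Galois coverings\<close>

text \<open>
  The group acts on objects by \<open>\<phi> s\<close> and on morphisms by
  \<open>\<alpha> s y x : Mor C y x \<rightarrow> Mor C (\<phi> s y) (\<phi> s x)\<close>.
\<close>

locale free_action = k_category K C + group_action G "Obj C" \<phi>
  for K :: "'k ring" and C :: "('o, 'm, 'k) kcat"
    and G :: "'g monoid" and \<phi> :: "'g \<Rightarrow> 'o \<Rightarrow> 'o" +
  fixes \<alpha> :: "'g \<Rightarrow> 'o \<Rightarrow> 'o \<Rightarrow> 'm \<Rightarrow> 'm"
  assumes free: "\<lbrakk>s \<in> carrier G; x \<in> Obj C; \<phi> s x = x\<rbrakk> \<Longrightarrow> s = \<one>\<^bsub>G\<^esub>"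
    and act_linear:
      "\<lbrakk>s \<in> carrier G; x \<in> Obj C; y \<in> Obj C\<rbrakk>
        \<Longrightarrow> klinear K (Mor C y x) (Mor C (\<phi> s y) (\<phi> s x)) (\<alpha> s y x)"
    and act_Comp:
      "\<lbrakk>s \<in> carrier G; x \<in> Obj C; y \<in> Obj C; z \<in> Obj C;
        c \<in> carrier (Mor C y x); d \<in> carrier (Mor C z y)\<rbrakk>
        \<Longrightarrow> \<alpha> s z x (Comp C z y x d c) =
            Comp C (\<phi> s z) (\<phi> s y) (\<phi> s x) (\<alpha> s z y d) (\<alpha> s y x c)"
    and act_one:
      "\<lbrakk>x \<in> Obj C; y \<in> Obj C; c \<in> carrier (Mor C y x)\<rbrakk> \<Longrightarrow> \<alpha> \<one>\<^bsub>G\<^esub> y x c = c"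
    and act_mult:
      "\<lbrakk>s \<in> carrier G; t \<in> carrier G; x \<in> Obj C; y \<in> Obj C; c \<in> carrier (Mor C y x)\<rbrakk>
        \<Longrightarrow> \<alpha> s (\<phi> t y) (\<phi> t x) (\<alpha> t y x c) = \<alpha> (s \<otimes>\<^bsub>G\<^esub> t) y x c"

text \<open>
  Elements of the group algebra \<open>KG\<close> are finitely supported functions on \<open>G\<close>. For a \<open>KG\<close>-module
  \<open>V\<close>, with action \<open>act\<close>, the submodule \<open>aug_submodule K G V act\<close> is \<open>(Ker \<epsilon>) V\<close>.
\<close>

definition augmentation_kernel :: "'k ring \<Rightarrow> 'g monoid \<Rightarrow> ('g \<Rightarrow> 'k) set" where
  "augmentation_kernel K G =
     {a \<in> carrier G \<rightarrow>\<^sub>E carrier K.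
        finite {s \<in> carrier G. a s \<noteq> \<zero>\<^bsub>K\<^esub>} \<and>
        (\<Oplus>\<^bsub>K\<^esub> s \<in> {s \<in> carrier G. a s \<noteq> \<zero>\<^bsub>K\<^esub>}. a s) = \<zero>\<^bsub>K\<^esub>}"

definition aug_submodule ::
  "'k ring \<Rightarrow> 'g monoid \<Rightarrow> ('k, 'v) module \<Rightarrow> ('g \<Rightarrow> 'v \<Rightarrow> 'v) \<Rightarrow> 'v set" where
  "aug_submodule K G V act =
     kspan K V {(\<Oplus>\<^bsub>V\<^esub> s \<in> {s \<in> carrier G. a s \<noteq> \<zero>\<^bsub>K\<^esub>}. a s \<odot>\<^bsub>V\<^esub> act s x) | a x.
                  a \<in> augmentation_kernel K G \<and> x \<in> carrier V}"

text \<open>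
  For orbits \<open>u\<close> and \<open>v\<close>, \<open>orbit_sum C v u\<close> is the direct sum of the spaces \<open>Mor C y x\<close> over
  \<open>y \<in> v\<close> and \<open>x \<in> u\<close>; the component of \<open>s f\<close> at \<open>(y, x)\<close> is \<open>s\<close> applied to the component of
  \<open>f\<close> at \<open>(s\<inverse> y, s\<inverse> x)\<close>.
\<close>

definition orbit_sum ::
  "('o, 'm, 'k) kcat \<Rightarrow> 'o set \<Rightarrow> 'o set \<Rightarrow> ('k, 'o \<times> 'o \<Rightarrow> 'm) module" where
  "orbit_sum C v u = dsum (v \<times> u) (\<lambda>(y, x). Mor C y x)"

definition orbit_sum_act ::
  "'g monoid \<Rightarrow> ('g \<Rightarrow> 'o \<Rightarrow> 'o) \<Rightarrow> ('g \<Rightarrow> 'o \<Rightarrow> 'o \<Rightarrow> 'm \<Rightarrow> 'm) \<Rightarrow> 'o set \<Rightarrow> 'o set \<Rightarrow>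
   'g \<Rightarrow> ('o \<times> 'o \<Rightarrow> 'm) \<Rightarrow> 'o \<times> 'o \<Rightarrow> 'm" where
  "orbit_sum_act G \<phi> \<alpha> v u s f = (\<lambda>(y, x)\<in>v \<times> u.
     let y' = \<phi> (inv\<^bsub>G\<^esub> s) y; x' = \<phi> (inv\<^bsub>G\<^esub> s) x in \<alpha> s y' x' (f (y', x')))"

definition orbit_ker ::
  "'k ring \<Rightarrow> ('o, 'm, 'k) kcat \<Rightarrow> 'g monoid \<Rightarrow> ('g \<Rightarrow> 'o \<Rightarrow> 'o) \<Rightarrow>
   ('g \<Rightarrow> 'o \<Rightarrow> 'o \<Rightarrow> 'm \<Rightarrow> 'm) \<Rightarrow> 'o set \<Rightarrow> 'o set \<Rightarrow> ('o \<times> 'o \<Rightarrow> 'm) set" where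
  "orbit_ker K C G \<phi> \<alpha> v u =
     aug_submodule K G (orbit_sum C v u) (orbit_sum_act G \<phi> \<alpha> v u)"

definition orbit_class ::
  "'k ring \<Rightarrow> ('o, 'm, 'k) kcat \<Rightarrow> 'g monoid \<Rightarrow> ('g \<Rightarrow> 'o \<Rightarrow> 'o) \<Rightarrow>
   ('g \<Rightarrow> 'o \<Rightarrow> 'o \<Rightarrow> 'm \<Rightarrow> 'm) \<Rightarrow> 'o set \<Rightarrow> 'o set \<Rightarrow>
   ('o \<times> 'o \<Rightarrow> 'm) \<Rightarrow> ('o \<times> 'o \<Rightarrow> 'm) set" where
  "orbit_class K C G \<phi> \<alpha> v u f = orbit_ker K C G \<phi> \<alpha> v u +>\<^bsub>orbit_sum C v u\<^esub> f"

text \<open>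
  The bilinear extension to direct sums of \<open>(d, c) \<mapsto> (s d) c\<close> for \<open>d : y' \<rightarrow> z\<close> and
  \<open>c : x \<rightarrow> y\<close>, where \<open>s\<close> is the unique group element with \<open>s y' = y\<close>; the composite lies in the
  summand of index \<open>(s z, x)\<close>.
\<close>

definition orbit_comp ::
  "('o, 'm, 'k) kcat \<Rightarrow> 'g monoid \<Rightarrow> ('g \<Rightarrow> 'o \<Rightarrow> 'o) \<Rightarrow>
   ('g \<Rightarrow> 'o \<Rightarrow> 'o \<Rightarrow> 'm \<Rightarrow> 'm) \<Rightarrow> 'o set \<Rightarrow> 'o set \<Rightarrow> 'o set \<Rightarrow>
   ('o \<times> 'o \<Rightarrow> 'm) \<Rightarrow> ('o \<times> 'o \<Rightarrow> 'm) \<Rightarrow> 'o \<times> 'o \<Rightarrow> 'm" where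
  "orbit_comp C G \<phi> \<alpha> w v u g f =
     finsum (orbit_sum C w u)
       (\<lambda>((z, y'), (y, x)).
          let s = (THE s. s \<in> carrier G \<and> \<phi> s y' = y) in
            dsum_inj (w \<times> u) (\<lambda>(z, x). Mor C z x) (\<phi> s z, x)
              (Comp C (\<phi> s z) y x (\<alpha> s z y' (g (z, y'))) (f (y, x))))
       (dsum_supp (w \<times> v) (\<lambda>(z, y'). Mor C z y') g \<times>
        dsum_supp (v \<times> u) (\<lambda>(y, x). Mor C y x) f)"

text \<open>
  The unions in the definition of \<open>Idn\<close> and \<open>Comp\<close> are unions of copies of one coset, as in
  the library's quotient constructions.
\<close>

definition quotient_category ::
  "'k ring \<Rightarrow> ('o, 'm, 'k) kcat \<Rightarrow> 'g monoid \<Rightarrow> ('g \<Rightarrow> 'o \<Rightarrow> 'o) \<Rightarrow>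
   ('g \<Rightarrow> 'o \<Rightarrow> 'o \<Rightarrow> 'm \<Rightarrow> 'm) \<Rightarrow> ('o set, ('o \<times> 'o \<Rightarrow> 'm) set, 'k) kcat" where
  "quotient_category K C G \<phi> \<alpha> =
     \<lparr>Obj = orbits G (Obj C) \<phi>,
      Mor = (\<lambda>v u. quot_module (orbit_sum C v u) (orbit_ker K C G \<phi> \<alpha> v u)),
      Idn = (\<lambda>u. \<Union>x\<in>u. orbit_class K C G \<phi> \<alpha> u u
               (dsum_inj (u \<times> u) (\<lambda>(y, x). Mor C y x) (x, x) (Idn C x))),
      Comp = (\<lambda>w v u D E. \<Union>g\<in>D. \<Union>f\<in>E.
                orbit_class K C G \<phi> \<alpha> w u (orbit_comp C G \<phi> \<alpha> w v u g f))\<rparr>"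

section \<open>Conditions on categories\<close>

definition isomorphic_objects :: "('o, 'm, 'k) kcat \<Rightarrow> 'o \<Rightarrow> 'o \<Rightarrow> bool" where
  "isomorphic_objects B x y \<longleftrightarrow>
     (\<exists>c\<in>carrier (Mor B y x). \<exists>d\<in>carrier (Mor B x y).
        Comp B x y x d c = Idn B x \<and> Comp B y x y c d = Idn B y)"

definition basic_category :: "('o, 'm, 'k) kcat \<Rightarrow> bool" where
  "basic_category B \<longleftrightarrow>
     (\<forall>x\<in>Obj B. \<forall>y\<in>Obj B. isomorphic_objects B x y \<longrightarrow> x = y)"

definition hom_finite :: "'k ring \<Rightarrow> ('o, 'm, 'k) kcat \<Rightarrow> bool" where
  "hom_finite K B \<longleftrightarrow> (\<forall>x\<in>Obj B. \<forall>y\<in>Obj B. finite_dimensional K (Mor B y x))"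

definition End_ring :: "('o, 'm, 'k) kcat \<Rightarrow> 'o \<Rightarrow> 'm ring" where
  "End_ring B x =
     \<lparr>carrier = carrier (Mor B x x), mult = Comp B x x x, one = Idn B x,
      zero = \<zero>\<^bsub>Mor B x x\<^esub>, add = (\<lambda>b c. b \<oplus>\<^bsub>Mor B x x\<^esub> c)\<rparr>"

text \<open>
  Endomorphism algebras need not be commutative: a ring is local if it has a unique maximal left
  ideal, which is then also two-sided and the unique maximal right ideal.
\<close>

definition left_ideal :: "'a set \<Rightarrow> 'a ring \<Rightarrow> bool" where
  "left_ideal I R \<longleftrightarrow>
     additive_subgroup I R \<and> (\<forall>r\<in>carrier R. \<forall>a\<in>I. r \<otimes>\<^bsub>R\<^esub> a \<in> I)"

definition maximal_left_ideal :: "'a set \<Rightarrow> 'a ring \<Rightarrow> bool" where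
  "maximal_left_ideal I R \<longleftrightarrow>
     left_ideal I R \<and> I \<noteq> carrier R \<and>
     (\<forall>J. left_ideal J R \<and> I \<subseteq> J \<longrightarrow> J = I \<or> J = carrier R)"

definition is_local_ring :: "'a ring \<Rightarrow> bool" where
  "is_local_ring R \<longleftrightarrow> (\<exists>!I. maximal_left_ideal I R)"

definition split_category :: "('o, 'm, 'k) kcat \<Rightarrow> bool" where
  "split_category B \<longleftrightarrow> (\<forall>x\<in>Obj B. is_local_ring (End_ring B x))"

definition totally_split :: "'k ring \<Rightarrow> ('o, 'm, 'k) kcat \<Rightarrow> bool" where
  "totally_split K B \<longleftrightarrow>
     split_category B \<and>
     (\<forall>x\<in>Obj B. \<forall>I. maximal_left_ideal I (End_ring B x) \<longrightarrow>
        (let V = Mor B x x; k1 = {a \<odot>\<^bsub>V\<^esub> Idn B x | a. a \<in> carrier K} in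
           carrier V = set_add V k1 I \<and> k1 \<inter> I = {\<zero>\<^bsub>V\<^esub>}))"

definition linked :: "('o, 'm, 'k) kcat \<Rightarrow> 'o \<Rightarrow> 'o \<Rightarrow> bool" where
  "linked C x y \<longleftrightarrow>
     x \<in> Obj C \<and> y \<in> Obj C \<and>
     (carrier (Mor C y x) \<noteq> {\<zero>\<^bsub>Mor C y x\<^esub>} \<or> carrier (Mor C x y) \<noteq> {\<zero>\<^bsub>Mor C x y\<^esub>})"

definition connected_category :: "('o, 'm, 'k) kcat \<Rightarrow> bool" where
  "connected_category C \<longleftrightarrow>
     card (Obj C // {(x, y). x \<in> Obj C \<and> y \<in> Obj C \<and> equivclp (linked C) x y}) = 1"

section \<open>The canonical map\<close>

text \<open>
  Let \<open>\<chi> : G \<rightarrow> K\<close> be a homomorphism. Since \<open>G\<close> acts freely on objects, there are functions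
  \<open>h\<close> from objects to \<open>K\<close> with \<open>h (s x) = \<chi> s + h x\<close>. Then \<open>c \<mapsto> (h y - h x) c\<close> for
  \<open>c : x \<rightarrow> y\<close> is a \<open>G\<close>-invariant derivation of \<open>C\<close>, namely the coboundary of the family
  \<open>(h x 1\<^sub>x)\<^sub>x\<close>, and it induces a derivation of \<open>C/G\<close>. If representatives of the orbits are chosen
  and \<open>h\<close> vanishes on them, then the class of a morphism from a representative \<open>x\<close> to a translate
  \<open>s y\<close> of a representative \<open>y\<close> is multiplied by \<open>\<chi> s\<close>.
\<close>

definition potential ::
  "'k ring \<Rightarrow> ('o, 'm, 'k) kcat \<Rightarrow> 'g monoid \<Rightarrow> ('g \<Rightarrow> 'o \<Rightarrow> 'o) \<Rightarrow>
   ('g \<Rightarrow> 'k) \<Rightarrow> ('o \<Rightarrow> 'k) \<Rightarrow> bool" where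
  "potential K C G \<phi> \<chi> h \<longleftrightarrow>
     h \<in> Obj C \<rightarrow> carrier K \<and>
     (\<forall>s\<in>carrier G. \<forall>x\<in>Obj C. h (\<phi> s x) = \<chi> s \<oplus>\<^bsub>K\<^esub> h x)"

definition potential_cochain ::
  "'k ring \<Rightarrow> ('o, 'm, 'k) kcat \<Rightarrow> 'g monoid \<Rightarrow> ('g \<Rightarrow> 'o \<Rightarrow> 'o) \<Rightarrow>
   ('g \<Rightarrow> 'o \<Rightarrow> 'o \<Rightarrow> 'm \<Rightarrow> 'm) \<Rightarrow> ('o \<Rightarrow> 'k) \<Rightarrow>
   'o set list \<times> ('o \<times> 'o \<Rightarrow> 'm) set list \<Rightarrow> ('o \<times> 'o \<Rightarrow> 'm) set" where
  "potential_cochain K C G \<phi> \<alpha> h =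
     (\<lambda>(us, bs)\<in>chains (quotient_category K C G \<phi> \<alpha>) 1.
        let v = us ! 0; u = us ! 1 in
          \<Union>f\<in>bs ! 0. orbit_class K C G \<phi> \<alpha> v u
            (\<lambda>(y, x)\<in>v \<times> u. (h y \<ominus>\<^bsub>K\<^esub> h x) \<odot>\<^bsub>Mor C y x\<^esub> f (y, x)))"

end

theory Submission
  imports Defs
begin

text \<open>
  Given a homomorphism \<open>\<chi> : G \<rightarrow> k\<close>, freeness of the action on objects provides a
  function \<open>h\<close> on the objects of \<open>C\<close> with \<open>h (s x) = \<chi> s + h x\<close> (\<open>potential_exists\<close>). Multiplying
  each \<open>c : x \<rightarrow> y\<close> by \<open>h y - h x\<close> is a derivation of \<open>C\<close>, because these differences add up along
  composites; it commutes with \<open>G\<close>, because \<open>\<chi>\<close> cancels from the differences; hence it descends to a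
  derivation of the quotient (\<open>potential_cochain_cocycle\<close>). Two functions \<open>h\<close> for the same \<open>\<chi>\<close> differ
  by a function that is constant on orbits, which changes the derivation by an inner one
  (\<open>potential_cochain_independent\<close>). So the cohomology class depends on \<open>\<chi>\<close> alone, and linearly.

  For injectivity, suppose that the derivation given by \<open>h\<close> is inner, \<open>b \<mapsto> m\<^sub>v b - b m\<^sub>u\<close>. The class of
  a nonzero \<open>c : x \<rightarrow> y\<close> is an eigenvector for \<open>h y - h x\<close>, and it is nonzero because a free action
  does not identify different morphisms from \<open>x\<close> to \<open>y\<close> (\<open>mor_class_inj\<close>). On the other hand, each
  \<open>m\<^sub>u\<close> is a scalar \<open>l\<^sub>u\<close> plus a nilpotent endomorphism (\<open>scalar_plus_nilpotent\<close>). Left and right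
  multiplication commute, so the inner derivation is the scalar \<open>l\<^sub>v - l\<^sub>u\<close> plus a nilpotent operator,
  and \<open>l\<^sub>v - l\<^sub>u\<close> is its only eigenvalue (\<open>inner_derivation_eigenvalue\<close>). Thus \<open>h y - h x = l\<^sub>v - l\<^sub>u\<close>:
  the function \<open>h - l\<close> agrees at the two ends of every nonzero morphism and is constant, since \<open>C\<close> is
  connected. As \<open>l\<close> depends on the orbit only, \<open>\<chi> s = h (s x) - h x = 0\<close>
  (\<open>cohomologous_potentials\<close>, stated for a difference of two homomorphisms).

  Morphism spaces of the quotient are coinvariants, on which an invariant linear map is well defined
  (\<open>invariant_kills_augmentation\<close>). Identities
  between multilinear maps need to be checked only on classes of morphisms of \<open>C\<close>. Since a class is
  not changed by translation, a sequence of classes can be represented by morphisms that are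
  composable in \<open>C\<close> (\<open>klinear_eq_on_classes_source\<close>, \<open>quot_Comp_mor_class\<close>), and there the identity
  is one in \<open>C\<close>. In this way the quotient is seen to be a category over \<open>k\<close>
  (\<open>quotient_is_k_category\<close>).
\<close>

section \<open>Linear maps\<close>

lemma klinearI:
  assumes "\<And>v. v \<in> carrier V \<Longrightarrow> f v \<in> carrier W"
    and "\<And>v v'. \<lbrakk>v \<in> carrier V; v' \<in> carrier V\<rbrakk> \<Longrightarrow> f (v \<oplus>\<^bsub>V\<^esub> v') = f v \<oplus>\<^bsub>W\<^esub> f v'"
    and "\<And>a v. \<lbrakk>a \<in> carrier K; v \<in> carrier V\<rbrakk> \<Longrightarrow> f (a \<odot>\<^bsub>V\<^esub> v) = a \<odot>\<^bsub>W\<^esub> f v"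
  shows "klinear K V W f"
  using assms by (auto simp: klinear_def)

lemma klinear_closed: "klinear K V W f \<Longrightarrow> v \<in> carrier V \<Longrightarrow> f v \<in> carrier W"
  by (auto simp: klinear_def)

lemma klinear_add:
  "\<lbrakk>klinear K V W f; v \<in> carrier V; v' \<in> carrier V\<rbrakk> \<Longrightarrow> f (v \<oplus>\<^bsub>V\<^esub> v') = f v \<oplus>\<^bsub>W\<^esub> f v'"
  by (auto simp: klinear_def)

lemma klinear_smult:
  "\<lbrakk>klinear K V W f; a \<in> carrier K; v \<in> carrier V\<rbrakk> \<Longrightarrow> f (a \<odot>\<^bsub>V\<^esub> v) = a \<odot>\<^bsub>W\<^esub> f v"
  by (auto simp: klinear_def)

lemma klinear_cong:
  assumes "module K V" "\<And>v. v \<in> carrier V \<Longrightarrow> f v = g v" "klinear K V W f"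
  shows "klinear K V W g"
proof -
  interpret V: module K V by fact
  show ?thesis
    using assms(3) by (intro klinearI)
      (simp_all add: assms(2)[symmetric] klinear_closed klinear_add klinear_smult)
qed

lemma klinear_zero:
  assumes "module K V" "module K W" "klinear K V W f"
  shows "f \<zero>\<^bsub>V\<^esub> = \<zero>\<^bsub>W\<^esub>"
proof -
  interpret V: module K V by fact
  interpret W: module K W by fact
  have "f (\<zero>\<^bsub>K\<^esub> \<odot>\<^bsub>V\<^esub> \<zero>\<^bsub>V\<^esub>) = \<zero>\<^bsub>K\<^esub> \<odot>\<^bsub>W\<^esub> f \<zero>\<^bsub>V\<^esub>"
    by (rule klinear_smult[OF assms(3)]) simp_all
  then show ?thesis using assms(3) by (simp add: klinear_closed)
qed

lemma klinear_a_inv: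
  assumes "module K V" "module K W" "klinear K V W f" "v \<in> carrier V"
  shows "f (\<ominus>\<^bsub>V\<^esub> v) = \<ominus>\<^bsub>W\<^esub> f v"
proof -
  interpret V: module K V by fact
  interpret W: module K W by fact
  have "f (\<ominus>\<^bsub>V\<^esub> v) \<oplus>\<^bsub>W\<^esub> f v = \<zero>\<^bsub>W\<^esub>"
    using assms klinear_add[OF assms(3), of "\<ominus>\<^bsub>V\<^esub> v" v] klinear_zero[OF assms(1-3)]
    by (simp add: V.l_neg)
  then show ?thesis using assms
    by (simp add: W.minus_equality[symmetric] klinear_closed)
qed

lemma klinear_compose:
  "\<lbrakk>klinear K V W f; klinear K W X g\<rbrakk> \<Longrightarrow> klinear K V X (\<lambda>v. g (f v))"
  by (rule klinearI) (simp_all add: klinear_closed klinear_add klinear_smult)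

lemma klinear_add_fun:
  assumes "module K W" "klinear K V W f" "klinear K V W g"
  shows "klinear K V W (\<lambda>v. f v \<oplus>\<^bsub>W\<^esub> g v)"
proof -
  interpret W: module K W by fact
  show ?thesis using assms(2,3)
    by (intro klinearI)
      (simp_all add: klinear_closed klinear_add klinear_smult W.add.m_ac W.smult_r_distr)
qed

lemma klinear_smult_fun:
  assumes "module K W" "klinear K V W f" "a \<in> carrier K"
  shows "klinear K V W (\<lambda>v. a \<odot>\<^bsub>W\<^esub> f v)"
proof -
  interpret W: module K W by fact
  show ?thesis using assms(2,3)
    by (intro klinearI)
      (simp_all add: klinear_closed klinear_add klinear_smult W.smult_r_distr
        W.smult_assoc1[symmetric] W.R.m_comm)
qed

lemma klinear_zero_fun:
  assumes "module K W"
  shows "klinear K V W (\<lambda>v. \<zero>\<^bsub>W\<^esub>)"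
proof -
  interpret W: module K W by fact
  show ?thesis by (intro klinearI) simp_all
qed

lemma klinear_finsum:
  assumes "module K V" "module K W" "klinear K V W f" "g \<in> A \<rightarrow> carrier V"
  shows "f (finsum V g A) = finsum W (\<lambda>i. f (g i)) A"
proof -
  interpret V: module K V by fact
  interpret W: module K W by fact
  show ?thesis
    using assms(4)
  proof (induction A rule: infinite_finite_induct)
    case (insert i A)
    moreover have "(\<lambda>i. f (g i)) \<in> A \<rightarrow> carrier W"
      using insert.prems klinear_closed[OF assms(3)] by auto
    ultimately show ?case
      by (simp add: klinear_add[OF assms(3)] klinear_closed[OF assms(3)])
  qed (simp_all add: klinear_zero[OF assms(1-3)])
qed

lemma (in module) finsum_smult_rdistr:
  assumes "f \<in> A \<rightarrow> carrier R" "x \<in> carrier M" "finite A"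
  shows "(\<Oplus>\<^bsub>M\<^esub>i\<in>A. f i \<odot>\<^bsub>M\<^esub> x) = (\<Oplus>\<^bsub>R\<^esub>i\<in>A. f i) \<odot>\<^bsub>M\<^esub> x"
  using assms(3,1)
proof (induction A rule: finite_induct)
  case (insert i A)
  moreover have "(\<lambda>i. f i \<odot>\<^bsub>M\<^esub> x) \<in> A \<rightarrow> carrier M"
    using insert.prems assms(2) by auto
  ultimately show ?case
    using assms(2) by (simp add: smult_l_distr)
qed (simp add: assms(2))

lemma (in module) submodule_zero: "submodule U R M \<Longrightarrow> \<zero>\<^bsub>M\<^esub> \<in> U"
  using subgroup.one_closed[OF submodule.axioms(1)] by fastforce

text \<open>Negation is multiplication by \<open>-1\<close>.\<close>

lemma (in module) submodule_criterion:
  assumes "H \<subseteq> carrier M" "\<zero>\<^bsub>M\<^esub> \<in> H"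
    and "\<And>x y. \<lbrakk>x \<in> H; y \<in> H\<rbrakk> \<Longrightarrow> x \<oplus>\<^bsub>M\<^esub> y \<in> H"
    and smult: "\<And>a x. \<lbrakk>a \<in> carrier R; x \<in> H\<rbrakk> \<Longrightarrow> a \<odot>\<^bsub>M\<^esub> x \<in> H"
  shows "submodule H R M"
proof (rule submoduleI)
  fix x assume x: "x \<in> H"
  then have "\<ominus>\<^bsub>M\<^esub> x = (\<ominus> \<one>) \<odot>\<^bsub>M\<^esub> x" using assms(1) by (auto simp: smult_l_minus)
  then show "\<ominus>\<^bsub>M\<^esub> x \<in> H" using smult[OF _ x] by simp
qed (use assms in auto)

lemma (in module) Inter_submodule:
  assumes "\<F> \<noteq> {}" "\<And>U. U \<in> \<F> \<Longrightarrow> submodule U R M"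
  shows "submodule (\<Inter>\<F>) R M"
proof (rule submoduleI)
  show "\<Inter>\<F> \<subseteq> carrier M" using assms submoduleE(1) by blast
qed (auto intro: submodule_zero submoduleE(3-5) assms(2))

lemma kspan_submodule:
  assumes "module K V" "S \<subseteq> carrier V"
  shows "submodule (kspan K V S) K V"
  unfolding kspan_def using module.carrier_is_submodule[OF assms(1)] assms(2)
  by (intro module.Inter_submodule[OF assms(1)]) auto

lemma kspan_superset: "S \<subseteq> kspan K V S"
  by (auto simp: kspan_def)

lemma kspan_minimal: "\<lbrakk>submodule U K V; S \<subseteq> U\<rbrakk> \<Longrightarrow> kspan K V S \<subseteq> U"
  by (auto simp: kspan_def)

lemma klinear_kernel_submodule:
  assumes "module K V" "module K W" "klinear K V W f"
  shows "submodule {v \<in> carrier V. f v = \<zero>\<^bsub>W\<^esub>} K V"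
proof -
  interpret V: module K V by fact
  interpret W: module K W by fact
  show ?thesis
    by (rule V.submodule_criterion)
      (auto simp: klinear_zero[OF assms] klinear_add[OF assms(3)]
        klinear_smult[OF assms(3)])
qed

lemma klinear_image_submodule:
  assumes "module K V" "module K W" "klinear K V W f"
  shows "submodule (f ` carrier V) K W"
proof -
  interpret V: module K V by fact
  interpret W: module K W by fact
  show ?thesis
  proof (rule W.submodule_criterion)
    show "\<zero>\<^bsub>W\<^esub> \<in> f ` carrier V"
      using klinear_zero[OF assms] by (metis V.zero_closed imageI)
    show "a \<oplus>\<^bsub>W\<^esub> b \<in> f ` carrier V" if "a \<in> f ` carrier V" "b \<in> f ` carrier V" for a b
      using that klinear_add[OF assms(3)] by (metis (no_types) V.a_closed image_iff)
    show "a \<odot>\<^bsub>W\<^esub> x \<in> f ` carrier V" if "a \<in> carrier K" "x \<in> f ` carrier V" for a x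
      using that klinear_smult[OF assms(3)] by (metis (no_types) V.smult_closed image_iff)
  qed (use klinear_closed[OF assms(3)] in auto)
qed

section \<open>Products, direct sums and quotients of modules\<close>

definition prod_module :: "'i set \<Rightarrow> ('i \<Rightarrow> ('k, 'v) module) \<Rightarrow> ('k, 'i \<Rightarrow> 'v) module" where
  "prod_module I V =
     \<lparr>carrier = \<Pi>\<^sub>E i\<in>I. carrier (V i), mult = undefined, one = undefined,
      zero = (\<lambda>i\<in>I. \<zero>\<^bsub>V i\<^esub>),
      add = (\<lambda>f g. \<lambda>i\<in>I. f i \<oplus>\<^bsub>V i\<^esub> g i),
      smult = (\<lambda>a f. \<lambda>i\<in>I. a \<odot>\<^bsub>V i\<^esub> f i)\<rparr>"

lemma prod_module_is_module:
  assumes "cring K" "\<And>i. i \<in> I \<Longrightarrow> module K (V i)"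
  shows "module K (prod_module I V)"
proof -
  have ag: "abelian_group (V i)" if "i \<in> I" for i
    using assms(2)[OF that] by (rule module.axioms)
  have 1: "abelian_group (prod_module I V)"
  proof (rule abelian_groupI)
    fix f g h assume "f \<in> carrier (prod_module I V)" "g \<in> carrier (prod_module I V)"
      "h \<in> carrier (prod_module I V)"
    then show "f \<oplus>\<^bsub>prod_module I V\<^esub> g \<oplus>\<^bsub>prod_module I V\<^esub> h
        = f \<oplus>\<^bsub>prod_module I V\<^esub> (g \<oplus>\<^bsub>prod_module I V\<^esub> h)"
      by (auto simp: prod_module_def PiE_iff intro!: restrict_ext
          abelian_monoid.a_assoc abelian_group.axioms(1) ag)
  next
    fix f g assume "f \<in> carrier (prod_module I V)" "g \<in> carrier (prod_module I V)"
    then show "f \<oplus>\<^bsub>prod_module I V\<^esub> g = g \<oplus>\<^bsub>prod_module I V\<^esub> f"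
      "f \<oplus>\<^bsub>prod_module I V\<^esub> g \<in> carrier (prod_module I V)"
      by (auto simp: prod_module_def PiE_iff intro!: restrict_ext abelian_monoid.a_closed
          abelian_monoid.a_comm abelian_group.axioms(1) ag)
  next
    fix f assume f: "f \<in> carrier (prod_module I V)"
    show "\<zero>\<^bsub>prod_module I V\<^esub> \<oplus>\<^bsub>prod_module I V\<^esub> f = f"
      using f by (auto simp: prod_module_def PiE_iff fun_eq_iff extensional_def
          abelian_monoid.l_zero abelian_group.axioms(1) ag)
    show "\<exists>g\<in>carrier (prod_module I V). g \<oplus>\<^bsub>prod_module I V\<^esub> f = \<zero>\<^bsub>prod_module I V\<^esub>"
      using f by (intro bexI[of _ "\<lambda>i\<in>I. \<ominus>\<^bsub>V i\<^esub> f i"])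
        (auto simp: prod_module_def PiE_iff abelian_group.l_neg abelian_group.a_inv_closed ag
          intro!: restrict_ext)
  qed (auto simp: prod_module_def abelian_monoid.zero_closed abelian_group.axioms(1) ag)
  show ?thesis
    by (rule moduleI[OF assms(1) 1])
      (auto simp: prod_module_def PiE_iff module.smult_closed[OF assms(2)]
        module.smult_l_distr[OF assms(2)] module.smult_r_distr[OF assms(2)]
        module.smult_assoc1[OF assms(2)] module.smult_one[OF assms(2)]
        abelian_monoid.a_closed abelian_group.axioms(1) ag fun_eq_iff extensional_def)
qed

lemma dsum_is_module:
  assumes "cring K" "\<And>i. i \<in> I \<Longrightarrow> module K (V i)"
  shows "module K (dsum I V)"
proof -
  let ?P = "prod_module I V"
  let ?U = "{f \<in> \<Pi>\<^sub>E i\<in>I. carrier (V i). finite {i \<in> I. f i \<noteq> \<zero>\<^bsub>V i\<^esub>}}"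
  interpret P: module K ?P by (rule prod_module_is_module[OF assms])
  have ag: "abelian_group (V i)" if "i \<in> I" for i
    using assms(2)[OF that] by (rule module.axioms)
  note zz = abelian_monoid.l_zero[OF abelian_group.axioms(1)[OF ag]]
    abelian_monoid.zero_closed[OF abelian_group.axioms(1)[OF ag]]
  have add: "f \<oplus>\<^bsub>?P\<^esub> g \<in> ?U" if "f \<in> ?U" "g \<in> ?U" for f g
  proof -
    have "{i \<in> I. (f \<oplus>\<^bsub>?P\<^esub> g) i \<noteq> \<zero>\<^bsub>V i\<^esub>}
        \<subseteq> {i \<in> I. f i \<noteq> \<zero>\<^bsub>V i\<^esub>} \<union> {i \<in> I. g i \<noteq> \<zero>\<^bsub>V i\<^esub>}"
      by (auto simp: prod_module_def zz)
    then have "finite {i \<in> I. (f \<oplus>\<^bsub>?P\<^esub> g) i \<noteq> \<zero>\<^bsub>V i\<^esub>}"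
      using that by (auto intro: finite_subset)
    then show ?thesis
      using that P.a_closed[of f g] by (simp add: prod_module_def)
  qed
  have smult: "a \<odot>\<^bsub>?P\<^esub> f \<in> ?U" if "a \<in> carrier K" "f \<in> ?U" for a f
  proof -
    have "{i \<in> I. (a \<odot>\<^bsub>?P\<^esub> f) i \<noteq> \<zero>\<^bsub>V i\<^esub>} \<subseteq> {i \<in> I. f i \<noteq> \<zero>\<^bsub>V i\<^esub>}"
      using that by (auto simp: prod_module_def module.smult_r_null[OF assms(2)])
    then have "finite {i \<in> I. (a \<odot>\<^bsub>?P\<^esub> f) i \<noteq> \<zero>\<^bsub>V i\<^esub>}"
      using that by (auto intro: finite_subset)
    then show ?thesis
      using that P.smult_closed[of a f] by (simp add: prod_module_def)
  qed
  have "submodule ?U K ?P"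
    by (rule P.submodule_criterion) (use add smult in \<open>auto simp: prod_module_def zz\<close>)
  then have "module K (?P\<lparr>carrier := ?U\<rparr>)"
    by (rule submodule.submodule_is_module) (rule P.module_axioms)
  also have "?P\<lparr>carrier := ?U\<rparr> = dsum I V"
    by (simp add: prod_module_def dsum_def)
  finally show ?thesis .
qed

locale module_family =
  fixes K :: "'k ring" and I :: "'i set" and V :: "'i \<Rightarrow> ('k, 'v) module"
  assumes coeff_cring: "cring K"
    and component_module: "i \<in> I \<Longrightarrow> module K (V i)"
begin

sublocale dsum: module K "dsum I V"
  by (rule dsum_is_module[OF coeff_cring component_module])

lemma component_abelian: "i \<in> I \<Longrightarrow> abelian_group (V i)"
  by (rule module.axioms[OF component_module])

lemma dsum_carrier:
  "f \<in> carrier (dsum I V) \<longleftrightarrow> f \<in> (\<Pi>\<^sub>E i\<in>I. carrier (V i)) \<and> finite (dsum_supp I V f)"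
  by (auto simp: dsum_def dsum_supp_def)

lemma dsum_apply_closed: "\<lbrakk>f \<in> carrier (dsum I V); i \<in> I\<rbrakk> \<Longrightarrow> f i \<in> carrier (V i)"
  by (auto simp: dsum_carrier)

lemma dsum_add_apply: "i \<in> I \<Longrightarrow> (f \<oplus>\<^bsub>dsum I V\<^esub> g) i = f i \<oplus>\<^bsub>V i\<^esub> g i"
  by (simp add: dsum_def)

lemma dsum_smult_apply: "i \<in> I \<Longrightarrow> (a \<odot>\<^bsub>dsum I V\<^esub> f) i = a \<odot>\<^bsub>V i\<^esub> f i"
  by (simp add: dsum_def)

lemma dsum_zero_apply: "i \<in> I \<Longrightarrow> \<zero>\<^bsub>dsum I V\<^esub> i = \<zero>\<^bsub>V i\<^esub>"
  by (simp add: dsum_def)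

lemma dsum_eqI:
  assumes "f \<in> carrier (dsum I V)" "g \<in> carrier (dsum I V)" "\<And>i. i \<in> I \<Longrightarrow> f i = g i"
  shows "f = g"
  using assms by (auto simp: dsum_carrier intro: PiE_ext)

lemma finite_dsum_supp: "f \<in> carrier (dsum I V) \<Longrightarrow> finite (dsum_supp I V f)"
  by (simp add: dsum_carrier)

lemma dsum_inj_linear:
  assumes "i \<in> I"
  shows "klinear K (V i) (dsum I V) (dsum_inj I V i)"
proof (rule klinearI)
  interpret Vi: module K "V i" by (rule component_module[OF assms])
  have zero: "\<zero>\<^bsub>V j\<^esub> \<oplus>\<^bsub>V j\<^esub> \<zero>\<^bsub>V j\<^esub> = \<zero>\<^bsub>V j\<^esub>" "\<zero>\<^bsub>V j\<^esub> \<in> carrier (V j)" if "j \<in> I" for j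
    using abelian_monoid.l_zero[OF abelian_group.axioms(1)[OF component_abelian[OF that]]]
      abelian_monoid.zero_closed[OF abelian_group.axioms(1)[OF component_abelian[OF that]]] by auto
  fix v v' a assume v: "v \<in> carrier (V i)"
  have "dsum_supp I V (dsum_inj I V i v) \<subseteq> {i}"
    by (auto simp: dsum_supp_def dsum_inj_def)
  then have "finite (dsum_supp I V (dsum_inj I V i v))"
    by (rule finite_subset) simp
  then show "dsum_inj I V i v \<in> carrier (dsum I V)"
    using v zero by (simp add: dsum_carrier) (auto simp: dsum_inj_def)
  show "dsum_inj I V i (v \<oplus>\<^bsub>V i\<^esub> v') = dsum_inj I V i v \<oplus>\<^bsub>dsum I V\<^esub> dsum_inj I V i v'"
    by (auto simp: dsum_inj_def dsum_def zero)
  assume "a \<in> carrier K"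
  then show "dsum_inj I V i (a \<odot>\<^bsub>V i\<^esub> v) = a \<odot>\<^bsub>dsum I V\<^esub> dsum_inj I V i v"
    by (auto simp: dsum_inj_def dsum_def module.smult_r_null[OF component_module])
qed

lemma dsum_inj_apply:
  "j \<in> I \<Longrightarrow> dsum_inj I V i v j = (if j = i then v else \<zero>\<^bsub>V j\<^esub>)"
  by (simp add: dsum_inj_def)

text \<open>Peeling one coordinate off the support leaves an element with a smaller support.\<close>

lemma dsum_induct [consumes 1, case_names zero add inj]:
  assumes "f \<in> carrier (dsum I V)"
    and zero: "P \<zero>\<^bsub>dsum I V\<^esub>"
    and add: "\<And>f g. \<lbrakk>f \<in> carrier (dsum I V); g \<in> carrier (dsum I V); P f; P g\<rbrakk>
      \<Longrightarrow> P (f \<oplus>\<^bsub>dsum I V\<^esub> g)"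
    and inj: "\<And>i v. \<lbrakk>i \<in> I; v \<in> carrier (V i)\<rbrakk> \<Longrightarrow> P (dsum_inj I V i v)"
  shows "P f"
  using assms(1)
proof (induction "card (dsum_supp I V f)" arbitrary: f)
  case 0
  then have "dsum_supp I V f = {}" by (simp add: finite_dsum_supp)
  then have "f = \<zero>\<^bsub>dsum I V\<^esub>"
    using 0 by (intro dsum_eqI) (auto simp: dsum_supp_def dsum_zero_apply)
  then show ?case using zero by simp
next
  case (Suc n)
  then obtain i where i: "i \<in> dsum_supp I V f"
    by (metis card.empty ex_in_conv nat.simps(3))
  then have iI: "i \<in> I" by (simp add: dsum_supp_def)
  define g where "g = f(i := \<zero>\<^bsub>V i\<^esub>)"
  interpret Vi: module K "V i" by (rule component_module[OF iI])
  have supp: "dsum_supp I V g = dsum_supp I V f - {i}"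
    by (auto simp: dsum_supp_def g_def)
  have g: "g \<in> carrier (dsum I V)"
    using Suc.prems iI by (simp add: dsum_carrier supp) (auto simp: g_def PiE_iff extensional_def)
  have "card (dsum_supp I V g) = n"
    using i Suc.hyps(2) by (simp add: supp)
  then have Pg: "P g" using Suc.hyps(1) g by blast
  have fi: "f i \<in> carrier (V i)" using Suc.prems iI by (rule dsum_apply_closed)
  have inj_i: "dsum_inj I V i (f i) \<in> carrier (dsum I V)"
    by (rule klinear_closed[OF dsum_inj_linear[OF iI] fi])
  have "f j = (dsum_inj I V i (f i) \<oplus>\<^bsub>dsum I V\<^esub> g) j" if "j \<in> I" for j
  proof -
    interpret Vj: module K "V j" by (rule component_module[OF that])
    show ?thesis
      using dsum_apply_closed[OF Suc.prems that] that
      by (auto simp: dsum_add_apply dsum_inj_apply g_def)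
  qed
  then have "f = dsum_inj I V i (f i) \<oplus>\<^bsub>dsum I V\<^esub> g"
    using Suc.prems g inj_i by (intro dsum_eqI) auto
  then show ?case using add[OF inj_i g inj[OF iI fi] Pg] by simp
qed

lemma klinear_eq_on_dsum:
  assumes "module K W" "klinear K (dsum I V) W S" "klinear K (dsum I V) W T"
    and "\<And>i v. \<lbrakk>i \<in> I; v \<in> carrier (V i)\<rbrakk> \<Longrightarrow> S (dsum_inj I V i v) = T (dsum_inj I V i v)"
    and "f \<in> carrier (dsum I V)"
  shows "S f = T f"
  using assms(5)
proof (induction f rule: dsum_induct)
  case zero
  show ?case
    by (simp add: klinear_zero[OF dsum.module_axioms assms(1,2)]
        klinear_zero[OF dsum.module_axioms assms(1,3)])
next
  case (add f g)
  then show ?case using assms(2,3) by (simp add: klinear_add)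
qed (rule assms(4))

lemma dsum_supp_add:
  assumes "f \<in> carrier (dsum I V)" "g \<in> carrier (dsum I V)"
  shows "dsum_supp I V (f \<oplus>\<^bsub>dsum I V\<^esub> g) \<subseteq> dsum_supp I V f \<union> dsum_supp I V g"
  by (auto simp: dsum_supp_def dsum_add_apply
      abelian_monoid.l_zero[OF abelian_group.axioms(1)[OF component_abelian]]
      abelian_monoid.zero_closed[OF abelian_group.axioms(1)[OF component_abelian]])

lemma dsum_supp_smult:
  assumes "a \<in> carrier K"
  shows "dsum_supp I V (a \<odot>\<^bsub>dsum I V\<^esub> f) \<subseteq> dsum_supp I V f"
  using assms by (auto simp: dsum_supp_def dsum_smult_apply module.smult_r_null[OF component_module])

text \<open>
  Reindexing along an injective \<open>\<sigma>\<close> and applying linear maps to the components: injectivity keeps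
  the supports finite.
\<close>

lemma dsum_reindex_map_linear:
  assumes \<sigma>: "\<sigma> \<in> I \<rightarrow> I" "inj_on \<sigma> I" and F: "\<And>i. i \<in> I \<Longrightarrow> klinear K (V (\<sigma> i)) (V i) (F i)"
  shows "klinear K (dsum I V) (dsum I V) (\<lambda>f. \<lambda>i\<in>I. F i (f (\<sigma> i)))"
proof (rule klinearI)
  let ?A = "\<lambda>f. \<lambda>i\<in>I. F i (f (\<sigma> i))"
  have comp: "f (\<sigma> i) \<in> carrier (V (\<sigma> i))" if "f \<in> carrier (dsum I V)" "i \<in> I" for f i
    using that \<sigma>(1) by (intro dsum_apply_closed) auto
  show closed: "?A f \<in> carrier (dsum I V)" if f: "f \<in> carrier (dsum I V)" for f
  proof -
    have "dsum_supp I V (?A f) \<subseteq> {i \<in> I. \<sigma> i \<in> dsum_supp I V f}"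
      using \<sigma>(1) klinear_zero[OF component_module component_module F]
      by (auto simp: dsum_supp_def Pi_iff)
    moreover have "finite {i \<in> I. \<sigma> i \<in> dsum_supp I V f}"
      using finite_vimage_IntI[OF finite_dsum_supp[OF f] \<sigma>(2)]
      by (rule rev_finite_subset) auto
    ultimately have "finite (dsum_supp I V (?A f))" by (rule finite_subset)
    then show ?thesis
      using klinear_closed[OF F comp[OF f]] by (simp add: dsum_carrier)
  qed
  fix f g a assume f: "f \<in> carrier (dsum I V)"
  show "?A (f \<oplus>\<^bsub>dsum I V\<^esub> g) = ?A f \<oplus>\<^bsub>dsum I V\<^esub> ?A g" if g: "g \<in> carrier (dsum I V)"
  proof (rule dsum_eqI)
    fix i assume i: "i \<in> I"
    then have "\<sigma> i \<in> I" using \<sigma>(1) by auto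
    then show "?A (f \<oplus>\<^bsub>dsum I V\<^esub> g) i = (?A f \<oplus>\<^bsub>dsum I V\<^esub> ?A g) i"
      using i by (simp add: dsum_add_apply klinear_add[OF F[OF i] comp[OF f i] comp[OF g i]])
  qed (use f g closed in auto)
  show "?A (a \<odot>\<^bsub>dsum I V\<^esub> f) = a \<odot>\<^bsub>dsum I V\<^esub> ?A f" if a: "a \<in> carrier K"
  proof (rule dsum_eqI)
    fix i assume i: "i \<in> I"
    then have "\<sigma> i \<in> I" using \<sigma>(1) by auto
    then show "?A (a \<odot>\<^bsub>dsum I V\<^esub> f) i = (a \<odot>\<^bsub>dsum I V\<^esub> ?A f) i"
      using i by (simp add: dsum_smult_apply klinear_smult[OF F[OF i] a comp[OF f i]])
  qed (use f a closed in auto)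
qed

lemma dsum_supp_inj: "dsum_supp I V (dsum_inj I V i v) \<subseteq> {i}"
  by (auto simp: dsum_supp_def dsum_inj_def)

end

definition dsum_lift ::
  "'i set \<Rightarrow> ('i \<Rightarrow> ('k, 'v) module) \<Rightarrow> ('k, 'w) module \<Rightarrow> ('i \<Rightarrow> 'v \<Rightarrow> 'w) \<Rightarrow> ('i \<Rightarrow> 'v) \<Rightarrow> 'w"
  where "dsum_lift I V W F f = (\<Oplus>\<^bsub>W\<^esub>i\<in>dsum_supp I V f. F i (f i))"

context module_family
begin

lemma dsum_lift_superset:
  assumes W: "module K W" and F: "\<And>i. i \<in> I \<Longrightarrow> klinear K (V i) W (F i)"
    and f: "f \<in> carrier (dsum I V)"
    and A: "finite A" "A \<subseteq> I" "dsum_supp I V f \<subseteq> A"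
  shows "dsum_lift I V W F f = (\<Oplus>\<^bsub>W\<^esub>i\<in>A. F i (f i))"
proof -
  interpret W: module K W by fact
  show ?thesis
    unfolding dsum_lift_def
  proof (rule W.add.finprod_mono_neutral_cong_left)
    fix i assume i: "i \<in> A - dsum_supp I V f"
    then have "f i = \<zero>\<^bsub>V i\<^esub>" "i \<in> I" using A by (auto simp: dsum_supp_def)
    then show "F i (f i) = \<zero>\<^bsub>W\<^esub>"
      using klinear_zero[OF component_module W F] by simp
  next
    show "(\<lambda>i. F i (f i)) \<in> A \<rightarrow> carrier W"
      using A by (auto intro!: klinear_closed[OF F] dsum_apply_closed[OF f])
  qed (use A in auto)
qed

lemma dsum_lift_linear:
  assumes W: "module K W" and F: "\<And>i. i \<in> I \<Longrightarrow> klinear K (V i) W (F i)"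
  shows "klinear K (dsum I V) W (dsum_lift I V W F)"
proof (rule klinearI)
  interpret W: module K W by fact
  have closed: "F i (f i) \<in> carrier W" if "f \<in> carrier (dsum I V)" "i \<in> I" for f i
    using that by (auto intro!: klinear_closed[OF F] dsum_apply_closed)
  have sub: "dsum_supp I V g \<subseteq> I" for g by (auto simp: dsum_supp_def)
  fix f g a assume f: "f \<in> carrier (dsum I V)"
  show "dsum_lift I V W F f \<in> carrier W"
    unfolding dsum_lift_def using closed[OF f] sub by (intro W.finsum_closed) auto
  show "dsum_lift I V W F (f \<oplus>\<^bsub>dsum I V\<^esub> g) = dsum_lift I V W F f \<oplus>\<^bsub>W\<^esub> dsum_lift I V W F g"
    if g: "g \<in> carrier (dsum I V)"
  proof -
    let ?A = "dsum_supp I V f \<union> dsum_supp I V g"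
    have A: "finite ?A" "?A \<subseteq> I"
      using f g sub by (auto simp: finite_dsum_supp)
    have cl: "(\<lambda>i. F i (f i)) \<in> ?A \<rightarrow> carrier W" "(\<lambda>i. F i (g i)) \<in> ?A \<rightarrow> carrier W"
      using closed f g A(2) by blast+
    have "dsum_lift I V W F (f \<oplus>\<^bsub>dsum I V\<^esub> g) = (\<Oplus>\<^bsub>W\<^esub>i\<in>?A. F i ((f \<oplus>\<^bsub>dsum I V\<^esub> g) i))"
      using f g by (intro dsum_lift_superset[OF W F _ A dsum_supp_add]) auto
    also have "\<dots> = (\<Oplus>\<^bsub>W\<^esub>i\<in>?A. F i (f i) \<oplus>\<^bsub>W\<^esub> F i (g i))"
    proof (rule W.finsum_cong')
      fix i assume "i \<in> ?A"
      then have "i \<in> I" using A by auto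
      then show "F i ((f \<oplus>\<^bsub>dsum I V\<^esub> g) i) = F i (f i) \<oplus>\<^bsub>W\<^esub> F i (g i)"
        using f g by (simp add: dsum_add_apply klinear_add[OF F] dsum_apply_closed)
    qed (use cl in \<open>auto simp: Pi_iff\<close>)
    also have "\<dots> = dsum_lift I V W F f \<oplus>\<^bsub>W\<^esub> dsum_lift I V W F g"
      using dsum_lift_superset[OF W F f A] dsum_lift_superset[OF W F g A]
      by (simp add: W.finsum_addf[OF cl])
    finally show ?thesis .
  qed
  show "dsum_lift I V W F (a \<odot>\<^bsub>dsum I V\<^esub> f) = a \<odot>\<^bsub>W\<^esub> dsum_lift I V W F f" if a: "a \<in> carrier K"
  proof -
    let ?A = "dsum_supp I V f"
    have A: "finite ?A" "?A \<subseteq> I"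
      using f sub by (auto simp: finite_dsum_supp)
    have cl: "(\<lambda>i. F i (f i)) \<in> ?A \<rightarrow> carrier W"
      using closed f A(2) by blast
    have "dsum_lift I V W F (a \<odot>\<^bsub>dsum I V\<^esub> f) = (\<Oplus>\<^bsub>W\<^esub>i\<in>?A. F i ((a \<odot>\<^bsub>dsum I V\<^esub> f) i))"
      using f a by (intro dsum_lift_superset[OF W F _ A dsum_supp_smult]) auto
    also have "\<dots> = (\<Oplus>\<^bsub>W\<^esub>i\<in>?A. a \<odot>\<^bsub>W\<^esub> F i (f i))"
    proof (rule W.finsum_cong')
      fix i assume "i \<in> ?A"
      then have "i \<in> I" using A by auto
      then show "F i ((a \<odot>\<^bsub>dsum I V\<^esub> f) i) = a \<odot>\<^bsub>W\<^esub> F i (f i)"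
        using f a by (simp add: dsum_smult_apply klinear_smult[OF F] dsum_apply_closed)
    qed (use cl a in \<open>auto simp: Pi_iff\<close>)
    also have "\<dots> = a \<odot>\<^bsub>W\<^esub> dsum_lift I V W F f"
      unfolding dsum_lift_def by (rule W.finsum_smult_ldistr[symmetric, OF A(1) a cl])
    finally show ?thesis .
  qed
qed

lemma dsum_lift_inj:
  assumes W: "module K W" and F: "\<And>i. i \<in> I \<Longrightarrow> klinear K (V i) W (F i)"
    and "i \<in> I" "v \<in> carrier (V i)"
  shows "dsum_lift I V W F (dsum_inj I V i v) = F i v"
proof -
  interpret W: module K W by fact
  have "dsum_lift I V W F (dsum_inj I V i v) = (\<Oplus>\<^bsub>W\<^esub>j\<in>{i}. F j (dsum_inj I V i v j))"
    using assms(3,4) dsum_supp_inj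
    by (intro dsum_lift_superset[OF W F]) (auto intro: klinear_closed[OF dsum_inj_linear])
  then show ?thesis
    using assms(3,4) klinear_closed[OF F] by (simp add: dsum_inj_apply)
qed

end

lemma (in abelian_monoid) finsum_Times:
  assumes "finite A" "finite B" "f \<in> A \<times> B \<rightarrow> carrier G"
  shows "finsum G f (A \<times> B) = (\<Oplus>i\<in>A. \<Oplus>j\<in>B. f (i, j))"
  using assms(1,3)
proof (induction A rule: finite_induct)
  case (insert a A)
  have row: "finsum G f (Pair a ` B) = (\<Oplus>j\<in>B. f (a, j))"
    using insert.prems by (intro add.finprod_reindex) (auto simp: inj_on_def)
  have "finsum G f (insert a A \<times> B) = finsum G f (Pair a ` B \<union> A \<times> B)"
    by (rule arg_cong[where f = "finsum G f"]) auto
  also have "\<dots> = finsum G f (Pair a ` B) \<oplus> finsum G f (A \<times> B)"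
    using insert assms(2) by (intro add.finprod_Un_disjoint) auto
  also have "\<dots> = (\<Oplus>i\<in>insert a A. \<Oplus>j\<in>B. f (i, j))"
  proof -
    have "finsum G f (A \<times> B) = (\<Oplus>i\<in>A. \<Oplus>j\<in>B. f (i, j))"
      using insert.prems by (intro insert.IH) auto
    moreover have "(\<lambda>i. \<Oplus>j\<in>B. f (i, j)) \<in> insert a A \<rightarrow> carrier G"
      using insert.prems by (auto intro!: finsum_closed)
    ultimately show ?thesis using insert.hyps by (simp add: row Pi_iff)
  qed
  finally show ?case .
qed simp

lemma klinear_finsum_fun:
  assumes "module K V" "module K W" "\<And>i. i \<in> A \<Longrightarrow> klinear K V W (g i)"
  shows "klinear K V W (\<lambda>v. \<Oplus>\<^bsub>W\<^esub>i\<in>A. g i v)"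
proof -
  interpret W: module K W by fact
  show ?thesis
    using assms(3)
  proof (induction A rule: infinite_finite_induct)
    case (insert i A)
    have "klinear K V W (\<lambda>v. g i v \<oplus>\<^bsub>W\<^esub> (\<Oplus>\<^bsub>W\<^esub>i\<in>A. g i v))"
      using insert by (intro klinear_add_fun W.module_axioms) auto
    moreover have "g i v \<oplus>\<^bsub>W\<^esub> (\<Oplus>\<^bsub>W\<^esub>i\<in>A. g i v) = (\<Oplus>\<^bsub>W\<^esub>i\<in>insert i A. g i v)" if "v \<in> carrier V" for v
      using insert.hyps that klinear_closed[OF insert.prems]
      by (intro W.finsum_insert[symmetric]) auto
    ultimately show ?case by (rule klinear_cong[OF assms(1), rotated])
  qed (simp_all add: klinear_zero_fun W.module_axioms)
qed

text \<open>
  The double sum over the supports, which depend on the arguments, does not look bilinear. It is an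
  iterated linear extension from the summands, and this makes it so.
\<close>

locale component_pairing =
  L: module_family K I V + R: module_family K J V' + W: module K W
  for K :: "'k ring" and I :: "'i set" and V :: "'i \<Rightarrow> ('k, 'v) module"
    and J :: "'j set" and V' :: "'j \<Rightarrow> ('k, 'u) module" and W :: "('k, 'w) module" +
  fixes T :: "'i \<Rightarrow> 'j \<Rightarrow> 'v \<Rightarrow> 'u \<Rightarrow> 'w"
  assumes left_linear:
      "\<lbrakk>i \<in> I; j \<in> J; c \<in> carrier (V' j)\<rbrakk> \<Longrightarrow> klinear K (V i) W (\<lambda>d. T i j d c)"
    and right_linear:
      "\<lbrakk>i \<in> I; j \<in> J; d \<in> carrier (V i)\<rbrakk> \<Longrightarrow> klinear K (V' j) W (T i j d)"
begin

definition pairing :: "('i \<Rightarrow> 'v) \<Rightarrow> ('j \<Rightarrow> 'u) \<Rightarrow> 'w" where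
  "pairing g f = finsum W (\<lambda>(i, j). T i j (g i) (f j)) (dsum_supp I V g \<times> dsum_supp J V' f)"

lemma summand_closed:
  "\<lbrakk>g \<in> carrier (dsum I V); f \<in> carrier (dsum J V'); i \<in> I; j \<in> J\<rbrakk>
    \<Longrightarrow> T i j (g i) (f j) \<in> carrier W"
  by (rule klinear_closed[OF left_linear]) (auto intro: L.dsum_apply_closed R.dsum_apply_closed)

lemma pairing_as_lift:
  assumes g: "g \<in> carrier (dsum I V)" and f: "f \<in> carrier (dsum J V')"
  shows "pairing g f = dsum_lift I V W (\<lambda>i d. dsum_lift J V' W (\<lambda>j. T i j d) f) g"
proof -
  have "(\<lambda>(i, j). T i j (g i) (f j)) \<in> dsum_supp I V g \<times> dsum_supp J V' f \<rightarrow> carrier W"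
    using summand_closed[OF g f] by (auto simp: dsum_supp_def)
  then show ?thesis
    by (simp add: pairing_def dsum_lift_def
        W.finsum_Times[OF L.finite_dsum_supp[OF g] R.finite_dsum_supp[OF f]])
qed

lemma inner_lift_linear:
  assumes i: "i \<in> I" and f: "f \<in> carrier (dsum J V')"
  shows "klinear K (V i) W (\<lambda>d. dsum_lift J V' W (\<lambda>j. T i j d) f)"
  unfolding dsum_lift_def using i R.dsum_apply_closed[OF f]
  by (intro klinear_finsum_fun L.component_module W.module_axioms left_linear) (auto simp: dsum_supp_def)

lemma pairing_linear_left:
  assumes f: "f \<in> carrier (dsum J V')"
  shows "klinear K (dsum I V) W (\<lambda>g. pairing g f)"
  by (rule klinear_cong[OF L.dsum.module_axioms pairing_as_lift[OF _ f, symmetric]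
        L.dsum_lift_linear[OF W.module_axioms inner_lift_linear[OF _ f]]])

lemma pairing_linear_right:
  assumes g: "g \<in> carrier (dsum I V)"
  shows "klinear K (dsum J V') W (pairing g)"
proof -
  interpret flip: component_pairing K J V' I V W "\<lambda>j i c d. T i j d c"
    by unfold_locales (simp_all add: left_linear right_linear)
  have "flip.pairing f g = pairing g f" if f: "f \<in> carrier (dsum J V')" for f
  proof -
    have closed: "(\<lambda>(i, j). T i j (g i) (f j)) \<in> dsum_supp I V g \<times> dsum_supp J V' f \<rightarrow> carrier W"
      using summand_closed[OF g f] by (auto simp: dsum_supp_def)
    have "pairing g f = finsum W (\<lambda>(i, j). T i j (g i) (f j))
        (prod.swap ` (dsum_supp J V' f \<times> dsum_supp I V g))"
      by (simp add: pairing_def product_swap)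
    also have "\<dots> = finsum W (\<lambda>p. case prod.swap p of (i, j) \<Rightarrow> T i j (g i) (f j))
        (dsum_supp J V' f \<times> dsum_supp I V g)"
      using closed by (intro W.finsum_reindex) (auto simp: inj_on_def product_swap)
    finally show ?thesis
      by (simp add: flip.pairing_def case_prod_unfold)
  qed
  then show ?thesis
    by (rule klinear_cong[OF R.dsum.module_axioms _ flip.pairing_linear_left[OF g]])
qed

lemma pairing_inj:
  assumes "i \<in> I" "j \<in> J" "d \<in> carrier (V i)" "c \<in> carrier (V' j)"
  shows "pairing (dsum_inj I V i d) (dsum_inj J V' j c) = T i j d c"
proof -
  have f: "dsum_inj J V' j c \<in> carrier (dsum J V')"
    by (rule klinear_closed[OF R.dsum_inj_linear]) (use assms in auto)
  have "pairing (dsum_inj I V i d) (dsum_inj J V' j c) = dsum_lift J V' W (\<lambda>j. T i j d) (dsum_inj J V' j c)"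
    using assms klinear_closed[OF L.dsum_inj_linear]
    by (simp add: pairing_as_lift f L.dsum_lift_inj[OF W.module_axioms inner_lift_linear[OF _ f]])
  also have "\<dots> = T i j d c"
    using assms by (intro R.dsum_lift_inj W.module_axioms right_linear)
  finally show ?thesis .
qed

end

locale quotient_of_module = module K V for K :: "'k ring" and V :: "('k, 'v) module" +
  fixes U :: "'v set"
  assumes sub: "submodule U K V"
begin

sublocale abelian_subgroup U V
  by (intro abelian_subgroupI3 additive_subgroup.intro submodule.axioms(1)[OF sub] abelian_group_axioms)

lemma sub_carrier: "u \<in> U \<Longrightarrow> u \<in> carrier V"
  using a_subset by blast

lemma coset_self: "x \<in> carrier V \<Longrightarrow> x \<in> U +>\<^bsub>V\<^esub> x"
  using zero_closed by (force simp: a_r_coset_def')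

lemma coset_mem: "y \<in> U +>\<^bsub>V\<^esub> x \<longleftrightarrow> (\<exists>u\<in>U. y = u \<oplus>\<^bsub>V\<^esub> x)"
  by (auto simp: a_r_coset_def')

lemma coset_carrier: "\<lbrakk>y \<in> U +>\<^bsub>V\<^esub> x; x \<in> carrier V\<rbrakk> \<Longrightarrow> y \<in> carrier V"
  using sub_carrier by (auto simp: coset_mem)

lemma coset_of_mem: "\<lbrakk>y \<in> U +>\<^bsub>V\<^esub> x; x \<in> carrier V\<rbrakk> \<Longrightarrow> U +>\<^bsub>V\<^esub> y = U +>\<^bsub>V\<^esub> x"
  using a_repr_independence[OF _ _ a_subgroup] by simp

lemma coset_eq_iff:
  "\<lbrakk>x \<in> carrier V; y \<in> carrier V\<rbrakk> \<Longrightarrow> U +>\<^bsub>V\<^esub> x = U +>\<^bsub>V\<^esub> y \<longleftrightarrow> (\<exists>u\<in>U. x = u \<oplus>\<^bsub>V\<^esub> y)"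
  using coset_of_mem[of x y] coset_self[of x] by (auto simp: coset_mem[of x y])

lemma quot_carrier: "carrier (quot_module V U) = (\<lambda>x. U +>\<^bsub>V\<^esub> x) ` carrier V"
  by (auto simp: quot_module_def A_RCOSETS_def')

lemma quot_add:
  "\<lbrakk>x \<in> carrier V; y \<in> carrier V\<rbrakk>
    \<Longrightarrow> (U +>\<^bsub>V\<^esub> x) \<oplus>\<^bsub>quot_module V U\<^esub> (U +>\<^bsub>V\<^esub> y) = U +>\<^bsub>V\<^esub> (x \<oplus>\<^bsub>V\<^esub> y)"
  by (simp add: quot_module_def a_rcos_sum)

lemma quot_zero: "\<zero>\<^bsub>quot_module V U\<^esub> = U +>\<^bsub>V\<^esub> \<zero>\<^bsub>V\<^esub>"
  by (simp add: quot_module_def a_subset)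

lemma quot_smult:
  assumes a: "a \<in> carrier K" and x: "x \<in> carrier V"
  shows "a \<odot>\<^bsub>quot_module V U\<^esub> (U +>\<^bsub>V\<^esub> x) = U +>\<^bsub>V\<^esub> (a \<odot>\<^bsub>V\<^esub> x)"
proof -
  have "U +>\<^bsub>V\<^esub> (a \<odot>\<^bsub>V\<^esub> y) = U +>\<^bsub>V\<^esub> (a \<odot>\<^bsub>V\<^esub> x)" if y: "y \<in> U +>\<^bsub>V\<^esub> x" for y
  proof -
    obtain u where u: "u \<in> U" "y = u \<oplus>\<^bsub>V\<^esub> x" using y by (auto simp: coset_mem)
    then have "a \<odot>\<^bsub>V\<^esub> y = a \<odot>\<^bsub>V\<^esub> u \<oplus>\<^bsub>V\<^esub> a \<odot>\<^bsub>V\<^esub> x"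
      using a x sub_carrier by (simp add: smult_r_distr)
    moreover have "a \<odot>\<^bsub>V\<^esub> u \<in> U" using submoduleE(4)[OF sub] a u by blast
    ultimately show ?thesis
      using a x u sub_carrier by (subst coset_eq_iff) auto
  qed
  then have "(\<Union>y\<in>U +>\<^bsub>V\<^esub> x. U +>\<^bsub>V\<^esub> (a \<odot>\<^bsub>V\<^esub> y)) = U +>\<^bsub>V\<^esub> (a \<odot>\<^bsub>V\<^esub> x)"
    using coset_self[OF x] by (intro SUP_eq_const) blast+
  then show ?thesis by (simp add: quot_module_def)
qed

lemma quot_is_module: "module K (quot_module V U)"
proof (rule moduleI)
  show "abelian_group (quot_module V U)"
  proof (rule abelian_groupI)
    show "\<exists>Y\<in>carrier (quot_module V U). Y \<oplus>\<^bsub>quot_module V U\<^esub> X = \<zero>\<^bsub>quot_module V U\<^esub>"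
      if X: "X \<in> carrier (quot_module V U)" for X
    proof -
      obtain x where x: "x \<in> carrier V" "X = U +>\<^bsub>V\<^esub> x" using X by (auto simp: quot_carrier)
      then show ?thesis
        by (intro bexI[of _ "U +>\<^bsub>V\<^esub> (\<ominus>\<^bsub>V\<^esub> x)"]) (auto simp: quot_add quot_zero quot_carrier l_neg)
    qed
    show "X \<oplus>\<^bsub>quot_module V U\<^esub> Y = Y \<oplus>\<^bsub>quot_module V U\<^esub> X"
      if XY: "X \<in> carrier (quot_module V U)" "Y \<in> carrier (quot_module V U)" for X Y
    proof -
      obtain x y where "x \<in> carrier V" "X = U +>\<^bsub>V\<^esub> x" "y \<in> carrier V" "Y = U +>\<^bsub>V\<^esub> y"
        using XY by (auto simp: quot_carrier)
      then show ?thesis by (simp add: quot_add M.a_comm[of x y])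
    qed
  qed (auto simp: quot_carrier quot_add quot_zero M.a_assoc)
qed (auto simp: quot_carrier quot_add quot_smult smult_l_distr smult_r_distr smult_assoc1
    R.cring_axioms intro!: imageI)

lemma coset_linear: "klinear K V (quot_module V U) (\<lambda>x. U +>\<^bsub>V\<^esub> x)"
  by (rule klinearI) (auto simp: quot_carrier quot_add quot_smult)

lemma klinear_const_on_coset:
  assumes "module K W" "klinear K V W F" "\<And>u. u \<in> U \<Longrightarrow> F u = \<zero>\<^bsub>W\<^esub>"
    and "y \<in> U +>\<^bsub>V\<^esub> x" "x \<in> carrier V"
  shows "F y = F x"
proof -
  interpret W: module K W by fact
  obtain u where u: "u \<in> U" "y = u \<oplus>\<^bsub>V\<^esub> x" using assms(4) by (auto simp: coset_mem)
  then show ?thesis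
    using assms sub_carrier by (simp add: klinear_add[OF assms(2)] klinear_closed[OF assms(2)])
qed

end

section \<open>Coinvariants\<close>

locale linear_action = group G + module K V + field K
  for G :: "'g monoid" and K :: "'k ring" and V :: "('k, 'v) module" +
  fixes act :: "'g \<Rightarrow> 'v \<Rightarrow> 'v"
  assumes act_is_linear: "s \<in> carrier G \<Longrightarrow> klinear K V V (act s)"
    and act_one_apply: "v \<in> carrier V \<Longrightarrow> act \<one>\<^bsub>G\<^esub> v = v"
begin

lemma augmentation_sum_closed:
  assumes "a \<in> augmentation_kernel K G" "x \<in> carrier V"
  shows "(\<Oplus>\<^bsub>V\<^esub>s\<in>{s \<in> carrier G. a s \<noteq> \<zero>\<^bsub>K\<^esub>}. a s \<odot>\<^bsub>V\<^esub> act s x) \<in> carrier V"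
  using assms klinear_closed[OF act_is_linear]
  by (intro M.finsum_closed) (auto simp: augmentation_kernel_def PiE_iff)

sublocale coinv: quotient_of_module K V "aug_submodule K G V act"
  unfolding aug_submodule_def
  using augmentation_sum_closed
  by (intro quotient_of_module.intro quotient_of_module_axioms.intro module_axioms
      kspan_submodule) blast

text \<open>The element \<open>s - 1\<close> of the group algebra has augmentation zero.\<close>

lemma act_coset:
  assumes s: "s \<in> carrier G" and x: "x \<in> carrier V"
  shows "aug_submodule K G V act +>\<^bsub>V\<^esub> act s x = aug_submodule K G V act +>\<^bsub>V\<^esub> x"
proof (cases "s = \<one>\<^bsub>G\<^esub>")
  case True
  then show ?thesis using x by (simp add: act_one_apply)
next
  case False
  define a where "a = (\<lambda>t\<in>carrier G. if t = s then \<one>\<^bsub>K\<^esub> else if t = \<one>\<^bsub>G\<^esub> then \<ominus>\<^bsub>K\<^esub> \<one>\<^bsub>K\<^esub> else \<zero>\<^bsub>K\<^esub>)"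
  have neg: "\<ominus>\<^bsub>K\<^esub> \<one>\<^bsub>K\<^esub> \<noteq> \<zero>\<^bsub>K\<^esub>"
    using R.minus_minus[of "\<one>\<^bsub>K\<^esub>"] R.minus_zero one_not_zero by force
  have supp: "{t \<in> carrier G. a t \<noteq> \<zero>\<^bsub>K\<^esub>} = {s, \<one>\<^bsub>G\<^esub>}"
    using s neg False by (auto simp: a_def)
  have sx: "act s x \<in> carrier V" using klinear_closed[OF act_is_linear[OF s] x] .
  have a: "a \<in> augmentation_kernel K G"
  proof -
    have "(\<Oplus>\<^bsub>K\<^esub>t\<in>{t \<in> carrier G. a t \<noteq> \<zero>\<^bsub>K\<^esub>}. a t) = \<zero>\<^bsub>K\<^esub>"
      unfolding supp using s False by (simp add: a_def R.r_neg)
    moreover have "a \<in> carrier G \<rightarrow>\<^sub>E carrier K"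
      by (auto simp: a_def)
    moreover have "finite {t \<in> carrier G. a t \<noteq> \<zero>\<^bsub>K\<^esub>}"
      by (simp add: supp)
    ultimately show ?thesis by (simp add: augmentation_kernel_def)
  qed
  have "(\<Oplus>\<^bsub>V\<^esub>t\<in>{t \<in> carrier G. a t \<noteq> \<zero>\<^bsub>K\<^esub>}. a t \<odot>\<^bsub>V\<^esub> act t x) \<in> aug_submodule K G V act"
    unfolding aug_submodule_def using a x by (intro subsetD[OF kspan_superset]) blast
  also have "(\<Oplus>\<^bsub>V\<^esub>t\<in>{t \<in> carrier G. a t \<noteq> \<zero>\<^bsub>K\<^esub>}. a t \<odot>\<^bsub>V\<^esub> act t x) = act s x \<oplus>\<^bsub>V\<^esub> \<ominus>\<^bsub>V\<^esub> x"
    unfolding supp using s False x sx by (simp add: a_def act_one_apply smult_l_minus)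
  finally have "act s x \<oplus>\<^bsub>V\<^esub> \<ominus>\<^bsub>V\<^esub> x \<in> aug_submodule K G V act" .
  moreover have "act s x = (act s x \<oplus>\<^bsub>V\<^esub> \<ominus>\<^bsub>V\<^esub> x) \<oplus>\<^bsub>V\<^esub> x"
    using x sx by (simp add: M.a_assoc M.l_neg)
  ultimately show ?thesis
    using x sx by (subst coinv.coset_eq_iff) auto
qed

text \<open>
  If \<open>F (s x) = F x\<close> for all \<open>s\<close>, then \<open>F (a x)\<close> is the augmentation of \<open>a\<close> times \<open>F x\<close> for every
  element \<open>a\<close> of the group algebra. This is how linear maps out of the coinvariants arise.
\<close>

lemma invariant_kills_augmentation:
  assumes W: "module K W" and F: "klinear K V W F"
    and inv: "\<And>s x. \<lbrakk>s \<in> carrier G; x \<in> carrier V\<rbrakk> \<Longrightarrow> F (act s x) = F x"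
    and u: "u \<in> aug_submodule K G V act"
  shows "F u = \<zero>\<^bsub>W\<^esub>"
proof -
  interpret W: module K W by fact
  let ?ker = "{v \<in> carrier V. F v = \<zero>\<^bsub>W\<^esub>}"
  have "aug_submodule K G V act \<subseteq> ?ker"
    unfolding aug_submodule_def
  proof (rule kspan_minimal)
    show "submodule ?ker K V"
      by (rule klinear_kernel_submodule[OF module_axioms W F])
    have "F (\<Oplus>\<^bsub>V\<^esub>s\<in>{s \<in> carrier G. a s \<noteq> \<zero>\<^bsub>K\<^esub>}. a s \<odot>\<^bsub>V\<^esub> act s x) = \<zero>\<^bsub>W\<^esub>"
      if a: "a \<in> augmentation_kernel K G" and x: "x \<in> carrier V" for a x
    proof -
      let ?A = "{s \<in> carrier G. a s \<noteq> \<zero>\<^bsub>K\<^esub>}"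
      have aK: "a s \<in> carrier K" if "s \<in> carrier G" for s
        using a that by (auto simp: augmentation_kernel_def)
      have cl: "(\<lambda>s. a s \<odot>\<^bsub>V\<^esub> act s x) \<in> ?A \<rightarrow> carrier V"
        using aK x klinear_closed[OF act_is_linear] by auto
      have "F (\<Oplus>\<^bsub>V\<^esub>s\<in>?A. a s \<odot>\<^bsub>V\<^esub> act s x) = (\<Oplus>\<^bsub>W\<^esub>s\<in>?A. F (a s \<odot>\<^bsub>V\<^esub> act s x))"
        by (rule klinear_finsum[OF module_axioms W F cl])
      also have "\<dots> = (\<Oplus>\<^bsub>W\<^esub>s\<in>?A. a s \<odot>\<^bsub>W\<^esub> F x)"
        using aK x klinear_closed[OF act_is_linear] klinear_closed[OF F]
        by (intro W.finsum_cong') (auto simp: klinear_smult[OF F] inv)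
      also have "\<dots> = (\<Oplus>\<^bsub>K\<^esub>s\<in>?A. a s) \<odot>\<^bsub>W\<^esub> F x"
        using aK x klinear_closed[OF F] a
        by (intro W.finsum_smult_rdistr) (auto simp: augmentation_kernel_def)
      also have "\<dots> = \<zero>\<^bsub>W\<^esub>"
        using a x klinear_closed[OF F] by (simp add: augmentation_kernel_def)
      finally show ?thesis .
    qed
    then show "{(\<Oplus>\<^bsub>V\<^esub>s\<in>{s \<in> carrier G. a s \<noteq> \<zero>\<^bsub>K\<^esub>}. a s \<odot>\<^bsub>V\<^esub> act s x) | a x.
        a \<in> augmentation_kernel K G \<and> x \<in> carrier V} \<subseteq> ?ker"
      using augmentation_sum_closed by blast
  qed
  then show ?thesis using u by blast
qed

end

section \<open>Nilpotent elements of finite dimensional local algebras\<close>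

lemma kspan_insertE:
  assumes "module K V" "insert s S \<subseteq> carrier V" "x \<in> kspan K V (insert s S)"
  obtains a w where "a \<in> carrier K" "w \<in> kspan K V S" "x = a \<odot>\<^bsub>V\<^esub> s \<oplus>\<^bsub>V\<^esub> w"
proof -
  interpret V: module K V by fact
  let ?S = "kspan K V S"
  let ?U = "{a \<odot>\<^bsub>V\<^esub> s \<oplus>\<^bsub>V\<^esub> w | a w. a \<in> carrier K \<and> w \<in> ?S}"
  have s: "s \<in> carrier V" using assms(2) by simp
  have S: "submodule ?S K V" using assms(2) by (intro kspan_submodule assms(1)) simp
  note SC = subsetD[OF V.submoduleE(1)[OF S]]
  have "kspan K V (insert s S) \<subseteq> ?U"
  proof (rule kspan_minimal)
    show "submodule ?U K V"
    proof (rule V.submodule_criterion)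
      show "?U \<subseteq> carrier V" using s SC by auto
      have "\<zero>\<^bsub>V\<^esub> = \<zero>\<^bsub>K\<^esub> \<odot>\<^bsub>V\<^esub> s \<oplus>\<^bsub>V\<^esub> \<zero>\<^bsub>V\<^esub>" using s by simp
      then show "\<zero>\<^bsub>V\<^esub> \<in> ?U" using V.submodule_zero[OF S] by blast
      show "x \<oplus>\<^bsub>V\<^esub> y \<in> ?U" if xU: "x \<in> ?U" and yU: "y \<in> ?U" for x y
      proof -
        obtain a w b z where x: "x = a \<odot>\<^bsub>V\<^esub> s \<oplus>\<^bsub>V\<^esub> w" "a \<in> carrier K" "w \<in> ?S"
          and y: "y = b \<odot>\<^bsub>V\<^esub> s \<oplus>\<^bsub>V\<^esub> z" "b \<in> carrier K" "z \<in> ?S" using xU yU by blast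
        then have "x \<oplus>\<^bsub>V\<^esub> y = (a \<oplus>\<^bsub>K\<^esub> b) \<odot>\<^bsub>V\<^esub> s \<oplus>\<^bsub>V\<^esub> (w \<oplus>\<^bsub>V\<^esub> z)"
          using s SC by (simp add: V.smult_l_distr V.M.add.m_ac)
        then show ?thesis
          using V.R.a_closed[OF x(2) y(2)] V.submoduleE(5)[OF S x(3) y(3)] by blast
      qed
      show "b \<odot>\<^bsub>V\<^esub> x \<in> ?U" if b: "b \<in> carrier K" and xU: "x \<in> ?U" for b x
      proof -
        obtain a w where x: "x = a \<odot>\<^bsub>V\<^esub> s \<oplus>\<^bsub>V\<^esub> w" "a \<in> carrier K" "w \<in> ?S" using xU by blast
        then have "b \<odot>\<^bsub>V\<^esub> x = (b \<otimes>\<^bsub>K\<^esub> a) \<odot>\<^bsub>V\<^esub> s \<oplus>\<^bsub>V\<^esub> b \<odot>\<^bsub>V\<^esub> w"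
          using s SC b by (simp add: V.smult_r_distr V.smult_assoc1)
        then show ?thesis using V.R.m_closed[OF b x(2)] V.submoduleE(4)[OF S b x(3)] by blast
      qed
    qed
    have "s = \<one>\<^bsub>K\<^esub> \<odot>\<^bsub>V\<^esub> s \<oplus>\<^bsub>V\<^esub> \<zero>\<^bsub>V\<^esub>" using s by simp
    then have "s \<in> ?U" using V.submodule_zero[OF S] by blast
    moreover have "t \<in> ?U" if "t \<in> S" for t
    proof -
      have "t \<in> carrier V" using that assms(2) by blast
      then have "t = \<zero>\<^bsub>K\<^esub> \<odot>\<^bsub>V\<^esub> s \<oplus>\<^bsub>V\<^esub> t" using s by simp
      moreover have "t \<in> ?S" using that by (rule subsetD[OF kspan_superset])
      ultimately show ?thesis using V.R.zero_closed by blast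
    qed
    ultimately show "insert s S \<subseteq> ?U" by blast
  qed
  then have "x \<in> ?U" using assms(3) by (rule subsetD)
  then obtain a w where "x = a \<odot>\<^bsub>V\<^esub> s \<oplus>\<^bsub>V\<^esub> w" "a \<in> carrier K" "w \<in> ?S"
    by blast
  then show thesis by (intro that)
qed

text \<open>
  Let \<open>s\<close> be added to a finite set \<open>S\<close> for which the claim is known. If the chain eventually lies in
  the span of \<open>S\<close>, then the claim for \<open>S\<close> applies to its tail. Otherwise every member contains some
  \<open>s + w\<close> with \<open>w\<close> in the span of \<open>S\<close>, and two consecutive members are equal as soon as their
  intersections with that span are.
\<close>

lemma descending_chain_stationary:
  assumes "field K" "module K V" "finite S" "S \<subseteq> carrier V"
    and "\<And>n::nat. submodule (U n) K V" "\<And>n. U (Suc n) \<subseteq> U n" "\<And>n. U n \<subseteq> kspan K V S"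
  shows "\<exists>n. U n \<subseteq> U (Suc n)"
  using assms(3-)
proof (induction S arbitrary: U rule: finite_induct)
  case empty
  interpret V: module K V by fact
  have "submodule {\<zero>\<^bsub>V\<^esub>} K V" by (rule V.submoduleI) auto
  then have "kspan K V {} \<subseteq> {\<zero>\<^bsub>V\<^esub>}" by (rule kspan_minimal) simp
  then show ?case using V.submodule_zero[OF empty.prems(2)] empty.prems(4) by blast
next
  case (insert s S)
  interpret V: module K V by fact
  interpret K: field K by fact
  have s: "s \<in> carrier V" and SV: "S \<subseteq> carrier V" using insert.prems(1) by auto
  have S: "submodule (kspan K V S) K V" by (rule kspan_submodule[OF assms(2) SV])
  note UV = subsetD[OF V.submoduleE(1)[OF insert.prems(2)]]
  note SC = subsetD[OF V.submoduleE(1)[OF S]]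
  have mono: "U m \<subseteq> U n" if "n \<le> m" for m n
    using that insert.prems(3) by (rule lift_Suc_antimono_le[of U, rotated])
  show ?case
  proof (cases "\<exists>n0. U n0 \<subseteq> kspan K V S")
    case True
    then obtain n0 where n0: "U n0 \<subseteq> kspan K V S" by blast
    have "\<exists>n. U (n0 + n) \<subseteq> U (n0 + Suc n)"
    proof (rule insert.IH[OF SV, of "\<lambda>n. U (n0 + n)"])
      show "U (n0 + n) \<subseteq> kspan K V S" for n using n0 mono[of n0 "n0 + n"] by simp
    qed (use insert.prems in auto)
    then show ?thesis by auto
  next
    case False
    have pivot: "\<exists>w\<in>kspan K V S. s \<oplus>\<^bsub>V\<^esub> w \<in> U n" for n
    proof -
      obtain x where x: "x \<in> U n" "x \<notin> kspan K V S" using False by blast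
      then have "x \<in> kspan K V (insert s S)" using insert.prems(4) by blast
      then obtain a w where aw: "a \<in> carrier K" "w \<in> kspan K V S" "x = a \<odot>\<^bsub>V\<^esub> s \<oplus>\<^bsub>V\<^esub> w"
        using kspan_insertE[OF assms(2) insert.prems(1)] by blast
      have "a \<noteq> \<zero>\<^bsub>K\<^esub>" using x aw s SC by auto
      then have inv: "inv\<^bsub>K\<^esub> a \<in> carrier K" "inv\<^bsub>K\<^esub> a \<otimes>\<^bsub>K\<^esub> a = \<one>\<^bsub>K\<^esub>"
        using aw(1) K.field_Units by auto
      have "inv\<^bsub>K\<^esub> a \<odot>\<^bsub>V\<^esub> x = s \<oplus>\<^bsub>V\<^esub> inv\<^bsub>K\<^esub> a \<odot>\<^bsub>V\<^esub> w"
        using aw inv s SC by (simp add: V.smult_r_distr V.smult_assoc1[symmetric])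
      moreover have "inv\<^bsub>K\<^esub> a \<odot>\<^bsub>V\<^esub> x \<in> U n"
        using V.submoduleE(4)[OF insert.prems(2)] inv x by blast
      moreover have "inv\<^bsub>K\<^esub> a \<odot>\<^bsub>V\<^esub> w \<in> kspan K V S"
        using V.submoduleE(4)[OF S] inv aw by blast
      ultimately show ?thesis by auto
    qed
    have "\<exists>n. U n \<inter> kspan K V S \<subseteq> U (Suc n) \<inter> kspan K V S"
    proof (rule insert.IH[OF SV, of "\<lambda>n. U n \<inter> kspan K V S"])
      show "submodule (U n \<inter> kspan K V S) K V" for n
        using V.Inter_submodule[of "{U n, kspan K V S}"] S insert.prems(2) by auto
    qed (use insert.prems in auto)
    then obtain n where n: "U n \<inter> kspan K V S \<subseteq> U (Suc n)" by blast
    have "U n \<subseteq> U (Suc n)"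
    proof
      fix x assume x: "x \<in> U n"
      then have "x \<in> kspan K V (insert s S)" using insert.prems(4) by blast
      then obtain a w where aw: "a \<in> carrier K" "w \<in> kspan K V S" "x = a \<odot>\<^bsub>V\<^esub> s \<oplus>\<^bsub>V\<^esub> w"
        using kspan_insertE[OF assms(2) insert.prems(1)] by blast
      obtain z where z: "z \<in> kspan K V S" "s \<oplus>\<^bsub>V\<^esub> z \<in> U (Suc n)" using pivot by blast
      let ?y = "a \<odot>\<^bsub>V\<^esub> (s \<oplus>\<^bsub>V\<^esub> z)"
      have y: "?y \<in> U (Suc n)" using V.submoduleE(4)[OF insert.prems(2)] aw z by blast
      then have y': "?y \<in> U n" using insert.prems(3) by blast
      have d: "x \<oplus>\<^bsub>V\<^esub> \<ominus>\<^bsub>V\<^esub> ?y \<in> U n"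
        using V.submoduleE(5)[OF insert.prems(2) x] V.submoduleE(3)[OF insert.prems(2)] y' by blast
      have "x \<oplus>\<^bsub>V\<^esub> \<ominus>\<^bsub>V\<^esub> ?y = w \<oplus>\<^bsub>V\<^esub> \<ominus>\<^bsub>V\<^esub> (a \<odot>\<^bsub>V\<^esub> z)"
        using aw z s SC
        by (simp add: V.smult_r_distr V.M.minus_add V.M.add.m_ac V.M.r_neg1 V.M.r_neg2 V.M.r_neg)
      then have "x \<oplus>\<^bsub>V\<^esub> \<ominus>\<^bsub>V\<^esub> ?y \<in> kspan K V S"
        using V.submoduleE(3-5)[OF S] aw z by auto
      then have "x \<oplus>\<^bsub>V\<^esub> \<ominus>\<^bsub>V\<^esub> ?y \<in> U (Suc n)" using d n by blast
      then have "(x \<oplus>\<^bsub>V\<^esub> \<ominus>\<^bsub>V\<^esub> ?y) \<oplus>\<^bsub>V\<^esub> ?y \<in> U (Suc n)"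
        using V.submoduleE(5)[OF insert.prems(2)] y by blast
      moreover have "(x \<oplus>\<^bsub>V\<^esub> \<ominus>\<^bsub>V\<^esub> ?y) \<oplus>\<^bsub>V\<^esub> ?y = x"
        using UV[OF x] UV[OF y] by (simp add: V.M.a_assoc V.M.l_neg)
      ultimately show "x \<in> U (Suc n)" by simp
    qed
    then show ?thesis by blast
  qed
qed

lemma left_ideal_contained_in_maximal:
  fixes R :: "'a ring" (structure)
  assumes "ring R" and J: "left_ideal J R" and proper: "\<one> \<notin> J"
  shows "\<exists>I. maximal_left_ideal I R \<and> J \<subseteq> I"
proof -
  interpret ring R by fact
  define \<A> where "\<A> = {L. left_ideal L R \<and> J \<subseteq> L \<and> \<one> \<notin> L}"
  have sg: "additive_subgroup L R" and mult: "\<And>r a. \<lbrakk>r \<in> carrier R; a \<in> L\<rbrakk> \<Longrightarrow> r \<otimes> a \<in> L"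
    if "left_ideal L R" for L
    using that by (auto simp: left_ideal_def)
  have "\<exists>I\<in>\<A>. \<forall>L\<in>\<A>. I \<subseteq> L \<longrightarrow> L = I"
  proof (rule subset_Zorn_nonempty)
    show "\<A> \<noteq> {}" using J proper by (auto simp: \<A>_def)
    fix \<C> assume ne: "\<C> \<noteq> {}" and chain: "subset.chain \<A> \<C>"
    have mem: "L \<in> \<A>" if "L \<in> \<C>" for L using chain that by (auto simp: subset.chain_def)
    have LI: "left_ideal L R" "additive_subgroup L R" if "L \<in> \<C>" for L
      using mem[OF that] sg by (auto simp: \<A>_def)
    have two: "\<exists>L\<in>\<C>. a \<in> L \<and> b \<in> L" if ab: "a \<in> \<Union>\<C>" "b \<in> \<Union>\<C>" for a b
    proof -
      obtain L M where LM: "L \<in> \<C>" "a \<in> L" "M \<in> \<C>" "b \<in> M" using ab by blast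
      then have "L \<subseteq> M \<or> M \<subseteq> L" using chain by (auto simp: subset_chain_def)
      then show ?thesis using LM by blast
    qed
    have "subgroup (\<Union>\<C>) (add_monoid R)"
    proof (rule add.subgroupI)
      show "\<Union>\<C> \<subseteq> carrier R"
        using additive_subgroup.a_subset[OF LI(2)] by blast
      show "\<Union>\<C> \<noteq> {}"
        using ne additive_subgroup.zero_closed[OF LI(2)] by blast
      show "\<ominus> a \<in> \<Union>\<C>" if "a \<in> \<Union>\<C>" for a
        using that additive_subgroup.a_inv_closed[OF LI(2)] by blast
      show "a \<oplus> b \<in> \<Union>\<C>" if ab: "a \<in> \<Union>\<C>" "b \<in> \<Union>\<C>" for a b
        using two[OF ab] additive_subgroup.a_closed[OF LI(2)] by blast
    qed
    moreover have "r \<otimes> a \<in> \<Union>\<C>" if "r \<in> carrier R" "a \<in> \<Union>\<C>" for r a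
      using that mult[OF LI(1)] by blast
    ultimately have "left_ideal (\<Union>\<C>) R"
      unfolding left_ideal_def by (simp add: additive_subgroupI)
    moreover have "J \<subseteq> \<Union>\<C>" "\<one> \<notin> \<Union>\<C>"
      using ne mem by (auto simp: \<A>_def)
    ultimately show "\<Union>\<C> \<in> \<A>" by (simp add: \<A>_def)
  qed
  then obtain I where I: "I \<in> \<A>" "\<And>L. \<lbrakk>L \<in> \<A>; I \<subseteq> L\<rbrakk> \<Longrightarrow> L = I" by blast
  have "L = I \<or> L = carrier R" if L: "left_ideal L R" "I \<subseteq> L" for L
  proof (cases "\<one> \<in> L")
    case True
    have "L \<subseteq> carrier R" by (rule additive_subgroup.a_subset[OF sg[OF L(1)]])
    moreover have "r \<in> L" if "r \<in> carrier R" for r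
      using mult[OF L(1) that True] that by simp
    ultimately show ?thesis by blast
  next
    case False
    then show ?thesis using L I by (auto simp: \<A>_def)
  qed
  then have "maximal_left_ideal I R"
    using I(1) by (auto simp: maximal_left_ideal_def \<A>_def)
  then show ?thesis using I(1) by (auto simp: \<A>_def)
qed

lemma principal_left_ideal:
  fixes R :: "'a ring" (structure)
  assumes "ring R" and x: "x \<in> carrier R"
  shows "left_ideal ((\<lambda>r. r \<otimes> x) ` carrier R) R"
proof -
  interpret ring R by fact
  have "subgroup ((\<lambda>r. r \<otimes> x) ` carrier R) (add_monoid R)"
  proof (rule add.subgroupI)
    show "(\<lambda>r. r \<otimes> x) ` carrier R \<noteq> {}" by auto
    show "\<ominus> a \<in> (\<lambda>r. r \<otimes> x) ` carrier R" if "a \<in> (\<lambda>r. r \<otimes> x) ` carrier R" for a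
      using that x by (auto simp: l_minus[symmetric])
    show "a \<oplus> b \<in> (\<lambda>r. r \<otimes> x) ` carrier R"
      if "a \<in> (\<lambda>r. r \<otimes> x) ` carrier R" "b \<in> (\<lambda>r. r \<otimes> x) ` carrier R" for a b
      using that x by (auto simp: l_distr[symmetric])
  qed (use x in auto)
  then show ?thesis
    using x by (auto simp: left_ideal_def m_assoc[symmetric] intro: additive_subgroupI)
qed

text \<open>
  An element without left inverse generates a proper left ideal, which by Zorn's lemma lies in a
  maximal one, and in a local ring that is \<open>I\<close>.
\<close>

lemma left_invertible_outside_maximal:
  fixes R :: "'a ring" (structure)
  assumes "ring R" and local: "is_local_ring R" and I: "maximal_left_ideal I R"
    and x: "x \<in> carrier R" "x \<notin> I"
  shows "\<exists>t\<in>carrier R. t \<otimes> x = \<one>"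
proof (rule ccontr)
  interpret ring R by fact
  assume "\<not> ?thesis"
  then have "\<one> \<notin> (\<lambda>r. r \<otimes> x) ` carrier R" by force
  then obtain I' where I': "maximal_left_ideal I' R" "(\<lambda>r. r \<otimes> x) ` carrier R \<subseteq> I'"
    using left_ideal_contained_in_maximal[OF assms(1) principal_left_ideal[OF assms(1) x(1)]] by blast
  have "I' = I" using local I I'(1) by (auto simp: is_local_ring_def)
  moreover have "\<one> \<otimes> x \<in> I'" using I'(2) by blast
  ultimately show False using x by simp
qed

text \<open>
  If the left ideals \<open>R p\<^sup>n\<close> become stationary, then \<open>p\<^sup>n = r p\<^sup>n\<^sup>+\<^sup>1\<close>, that is
  \<open>(1 - r p) p\<^sup>n = 0\<close> for some \<open>r\<close>, and \<open>1 - r p\<close> is left invertible because it lies outside \<open>I\<close>.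
\<close>

lemma maximal_left_ideal_nilpotent:
  fixes R :: "'a ring" (structure)
  assumes "ring R" and local: "is_local_ring R" and I: "maximal_left_ideal I R" and p: "p \<in> I"
    and stat: "(\<lambda>r. r \<otimes> p [^] n) ` carrier R \<subseteq> (\<lambda>r. r \<otimes> p [^] Suc n) ` carrier R"
  shows "p [^] (n::nat) = \<zero>"
proof -
  interpret ring R by fact
  have LI: "left_ideal I R" "I \<noteq> carrier R" using I by (auto simp: maximal_left_ideal_def)
  interpret I: additive_subgroup I R using LI(1) by (simp add: left_ideal_def)
  have pc: "p \<in> carrier R" using p I.a_subset by blast
  have "\<one> \<otimes> p [^] n \<in> (\<lambda>r. r \<otimes> p [^] n) ` carrier R" by blast
  then have "p [^] n \<in> (\<lambda>r. r \<otimes> p [^] Suc n) ` carrier R" using stat pc by auto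
  then obtain r where r: "r \<in> carrier R" "p [^] n = r \<otimes> p [^] Suc n" by blast
  let ?q = "\<one> \<ominus> r \<otimes> p"
  have q: "?q \<in> carrier R" using r pc by simp
  have rp: "r \<otimes> p \<in> I" using LI(1) r p by (simp add: left_ideal_def)
  have "\<one> \<notin> I"
  proof
    assume "\<one> \<in> I"
    then have "a \<in> I" if "a \<in> carrier R" for a
      using LI(1) that by (force simp: left_ideal_def)
    then show False using LI(2) I.a_subset by blast
  qed
  then have "?q \<notin> I"
    using I.a_closed[OF _ rp, of ?q] r pc by (auto simp: minus_eq a_assoc l_neg)
  then obtain t where t: "t \<in> carrier R" "t \<otimes> ?q = \<one>"
    using left_invertible_outside_maximal[OF assms(1) local I q] by blast
  have "?q \<otimes> p [^] n = p [^] n \<ominus> r \<otimes> (p \<otimes> p [^] n)"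
    using r(1) pc by (simp add: minus_eq l_distr l_minus m_assoc)
  also have "p \<otimes> p [^] n = p [^] Suc n"
    using pc nat_pow_Suc2 by simp
  also have "p [^] n \<ominus> r \<otimes> p [^] Suc n = p [^] n \<ominus> p [^] n"
    by (simp only: r(2)[symmetric])
  also have "\<dots> = \<zero>"
    using pc by (simp add: minus_eq r_neg)
  finally have "t \<otimes> (?q \<otimes> p [^] n) = \<zero>" using t by simp
  then show ?thesis using t q pc by (simp add: m_assoc[symmetric])
qed

section \<open>Endomorphism algebras\<close>

lemma (in abelian_group) cancel_four:
  assumes "x \<in> carrier G" "y \<in> carrier G" "z \<in> carrier G" "w \<in> carrier G"
  shows "\<ominus> (x \<oplus> y) \<oplus> (z \<oplus> w) \<oplus> (x \<oplus> \<ominus> z) = \<ominus> y \<oplus> w"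
proof -
  have "\<ominus> (x \<oplus> y) \<oplus> (z \<oplus> w) \<oplus> (x \<oplus> \<ominus> z) = (x \<oplus> \<ominus> x) \<oplus> (z \<oplus> \<ominus> z) \<oplus> (\<ominus> y \<oplus> w)"
    using assms by (simp only: minus_add add.m_ac a_inv_closed a_closed)
  then show ?thesis using assms by (simp add: r_neg)
qed

context k_category
begin

lemma Comp_closed:
  assumes "x \<in> Obj C" "y \<in> Obj C" "z \<in> Obj C" "d \<in> carrier (Mor C z y)" "c \<in> carrier (Mor C y x)"
  shows "Comp C z y x d c \<in> carrier (Mor C z x)"
  by (rule klinear_closed[OF Comp_linear_right]) (use assms in auto)

lemma End_ring_is_ring:
  assumes x: "x \<in> Obj C"
  shows "ring (End_ring C x)"
proof (rule ringI)
  interpret V: module K "Mor C x x" by (rule Mor_module[OF x x])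
  have "\<exists>b\<in>carrier (End_ring C x). b \<oplus>\<^bsub>End_ring C x\<^esub> a = \<zero>\<^bsub>End_ring C x\<^esub>"
    if "a \<in> carrier (End_ring C x)" for a
    using that by (intro bexI[of _ "\<ominus>\<^bsub>Mor C x x\<^esub> a"]) (simp_all add: End_ring_def V.M.l_neg)
  then show "abelian_group (End_ring C x)"
    by (intro abelian_groupI) (simp_all add: End_ring_def V.M.add.m_ac)
  show "monoid (End_ring C x)"
    by (rule monoidI)
      (simp_all add: End_ring_def x Idn_closed Comp_closed Comp_assoc Comp_Idn_left Comp_Idn_right)
qed (simp_all add: End_ring_def klinear_add[OF Comp_linear_left] klinear_add[OF Comp_linear_right] x)

lemma End_ring_simps:
  "carrier (End_ring C x) = carrier (Mor C x x)"
  "mult (End_ring C x) = Comp C x x x"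
  "one (End_ring C x) = Idn C x"
  "zero (End_ring C x) = \<zero>\<^bsub>Mor C x x\<^esub>"
  by (simp_all add: End_ring_def)

text \<open>
  The decomposition \<open>k \<oplus> I\<close> of the endomorphism algebra \<open>R\<close> provides the scalar part. For the other
  part \<open>p \<in> I\<close>, the left ideals \<open>R p\<^sup>n\<close> form a descending chain of subspaces of \<open>R\<close>, which becomes
  stationary because \<open>R\<close> is finite dimensional; hence \<open>p\<close> is nilpotent.
\<close>

lemma scalar_plus_nilpotent:
  assumes x: "x \<in> Obj C" and fd: "finite_dimensional K (Mor C x x)"
    and local: "is_local_ring (End_ring C x)"
    and split: "\<And>I. maximal_left_ideal I (End_ring C x) \<Longrightarrow>
      carrier (Mor C x x) = set_add (Mor C x x) {a \<odot>\<^bsub>Mor C x x\<^esub> Idn C x | a. a \<in> carrier K} I"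
    and m: "m \<in> carrier (Mor C x x)"
  shows "\<exists>a\<in>carrier K. \<exists>p\<in>carrier (Mor C x x). \<exists>n::nat.
    m = a \<odot>\<^bsub>Mor C x x\<^esub> Idn C x \<oplus>\<^bsub>Mor C x x\<^esub> p \<and> p [^]\<^bsub>End_ring C x\<^esub> n = \<zero>\<^bsub>Mor C x x\<^esub>"
proof -
  interpret E: ring "End_ring C x" by (rule End_ring_is_ring[OF x])
  interpret V: module K "Mor C x x" by (rule Mor_module[OF x x])
  obtain I where I: "maximal_left_ideal I (End_ring C x)"
    using local by (auto simp: is_local_ring_def)
  then have "left_ideal I (End_ring C x)" by (simp add: maximal_left_ideal_def)
  then have "I \<subseteq> carrier (Mor C x x)"
    using additive_subgroup.a_subset[of I "End_ring C x"] by (simp add: left_ideal_def End_ring_simps)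
  moreover obtain a p where ap: "a \<in> carrier K" "p \<in> I"
      "m = a \<odot>\<^bsub>Mor C x x\<^esub> Idn C x \<oplus>\<^bsub>Mor C x x\<^esub> p"
    using m unfolding split[OF I] set_add_def' by blast
  ultimately have p: "p \<in> carrier (Mor C x x)" by blast
  let ?U = "\<lambda>n::nat. (\<lambda>r. r \<otimes>\<^bsub>End_ring C x\<^esub> p [^]\<^bsub>End_ring C x\<^esub> n) ` carrier (End_ring C x)"
  have pow: "p [^]\<^bsub>End_ring C x\<^esub> n \<in> carrier (Mor C x x)" for n :: nat
    using E.nat_pow_closed[of p n] p by (simp add: End_ring_simps)
  obtain S where S: "finite S" "S \<subseteq> carrier (Mor C x x)" "kspan K (Mor C x x) S = carrier (Mor C x x)"
    using fd by (auto simp: finite_dimensional_def)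
  have "\<exists>n. ?U n \<subseteq> ?U (Suc n)"
  proof (rule descending_chain_stationary[OF field_axioms V.module_axioms S(1,2)])
    fix n
    show sub: "submodule (?U n) K (Mor C x x)"
      unfolding End_ring_simps
      by (rule klinear_image_submodule[OF V.module_axioms V.module_axioms Comp_linear_left[OF x x x pow]])
    show "?U n \<subseteq> kspan K (Mor C x x) S"
      unfolding S(3) by (rule V.submoduleE(1)[OF sub])
    show "?U (Suc n) \<subseteq> ?U n"
    proof
      fix r assume "r \<in> ?U (Suc n)"
      then obtain s where s: "s \<in> carrier (End_ring C x)"
        "r = s \<otimes>\<^bsub>End_ring C x\<^esub> p [^]\<^bsub>End_ring C x\<^esub> Suc n" by blast
      have "r = (s \<otimes>\<^bsub>End_ring C x\<^esub> p) \<otimes>\<^bsub>End_ring C x\<^esub> p [^]\<^bsub>End_ring C x\<^esub> n"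
        using s p by (simp only: E.nat_pow_Suc2 E.m_assoc E.nat_pow_closed
            End_ring_simps(1)[symmetric])
      moreover have "s \<otimes>\<^bsub>End_ring C x\<^esub> p \<in> carrier (End_ring C x)"
        using s p by (intro E.m_closed) (simp_all add: End_ring_simps)
      ultimately show "r \<in> ?U n" by (intro image_eqI)
    qed
  qed
  then obtain n where "?U n \<subseteq> ?U (Suc n)" by blast
  then have "p [^]\<^bsub>End_ring C x\<^esub> n = \<zero>\<^bsub>End_ring C x\<^esub>"
    by (rule maximal_left_ideal_nilpotent[OF E.ring_axioms local I ap(2)])
  then show ?thesis using ap p by (auto simp: End_ring_simps)
qed

text \<open>
  Left multiplication by \<open>p\<close> and right multiplication by \<open>q\<close> are commuting nilpotent operators, so
  their difference has no eigenvalue other than zero: descending induction shows that all the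
  elements \<open>p\<^sup>i c q\<^sup>j\<close> vanish.
\<close>

lemma nilpotent_difference_no_eigenvalue:
  fixes n k :: nat
  assumes u: "u \<in> Obj C" and v: "v \<in> Obj C" and c: "c \<in> carrier (Mor C v u)"
    and p: "p \<in> carrier (Mor C v v)" "p [^]\<^bsub>End_ring C v\<^esub> n = \<zero>\<^bsub>Mor C v v\<^esub>"
    and q: "q \<in> carrier (Mor C u u)" "q [^]\<^bsub>End_ring C u\<^esub> k = \<zero>\<^bsub>Mor C u u\<^esub>"
    and b: "b \<in> carrier K" "b \<noteq> \<zero>\<^bsub>K\<^esub>"
    and eq: "Comp C v v u p c = Comp C v u u c q \<oplus>\<^bsub>Mor C v u\<^esub> b \<odot>\<^bsub>Mor C v u\<^esub> c"
  shows "c = \<zero>\<^bsub>Mor C v u\<^esub>"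
proof -
  interpret V: module K "Mor C v u" by (rule Mor_module[OF u v])
  interpret Ev: ring "End_ring C v" by (rule End_ring_is_ring[OF v])
  interpret Eu: ring "End_ring C u" by (rule End_ring_is_ring[OF u])
  define P where "P = (\<lambda>i::nat. p [^]\<^bsub>End_ring C v\<^esub> i)"
  define Q where "Q = (\<lambda>j::nat. q [^]\<^bsub>End_ring C u\<^esub> j)"
  have P: "P i \<in> carrier (Mor C v v)" for i
    using Ev.nat_pow_closed[of p i] p by (simp add: P_def End_ring_simps)
  have Q: "Q j \<in> carrier (Mor C u u)" for j
    using Eu.nat_pow_closed[of q j] q by (simp add: Q_def End_ring_simps)
  have PS: "P (Suc i) = Comp C v v v (P i) p" for i
    using Ev.nat_pow_Suc[of p i] by (simp add: P_def End_ring_simps)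
  have QS: "Q (Suc j) = Comp C u u u q (Q j)" for j
    using Eu.nat_pow_Suc2[of q j] q by (simp add: Q_def End_ring_simps)
  have P0: "P i = \<zero>\<^bsub>Mor C v v\<^esub>" if "n \<le> i" for i
    using that
  proof (induction i rule: dec_induct)
    case (step i)
    have "P (Suc i) = \<zero>\<^bsub>End_ring C v\<^esub> \<otimes>\<^bsub>End_ring C v\<^esub> p"
      using step by (simp add: PS End_ring_simps)
    also have "\<dots> = \<zero>\<^bsub>End_ring C v\<^esub>" using p by (intro Ev.l_null) (simp add: End_ring_simps)
    finally show ?case by (simp add: End_ring_simps)
  qed (simp add: P_def p)
  have Q0: "Q j = \<zero>\<^bsub>Mor C u u\<^esub>" if "k \<le> j" for j
    using that
  proof (induction j rule: dec_induct)
    case (step i)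
    have "Q (Suc i) = q \<otimes>\<^bsub>End_ring C u\<^esub> \<zero>\<^bsub>End_ring C u\<^esub>"
      using step by (simp add: QS End_ring_simps)
    also have "\<dots> = \<zero>\<^bsub>End_ring C u\<^esub>" using q by (intro Eu.r_null) (simp add: End_ring_simps)
    finally show ?case by (simp add: End_ring_simps)
  qed (simp add: Q_def q)
  define X where "X = (\<lambda>i j. Comp C v u u (Comp C v v u (P i) c) (Q j))"
  have Pc: "Comp C v v u (P i) c \<in> carrier (Mor C v u)" for i
    by (intro Comp_closed u v P c)
  have X: "X i j \<in> carrier (Mor C v u)" for i j
    unfolding X_def by (intro Comp_closed u v Pc Q)
  have cq: "Comp C v u u c q \<in> carrier (Mor C v u)" by (intro Comp_closed u v c q)
  have rec: "X (Suc i) j = X i (Suc j) \<oplus>\<^bsub>Mor C v u\<^esub> b \<odot>\<^bsub>Mor C v u\<^esub> X i j" for i j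
  proof -
    have "Comp C v v u (P (Suc i)) c
        = Comp C v v u (P i) (Comp C v u u c q \<oplus>\<^bsub>Mor C v u\<^esub> b \<odot>\<^bsub>Mor C v u\<^esub> c)"
      by (simp add: PS Comp_assoc[OF u v v v c p(1) P, symmetric] eq)
    also have "\<dots> = Comp C v u u (Comp C v v u (P i) c) q
        \<oplus>\<^bsub>Mor C v u\<^esub> b \<odot>\<^bsub>Mor C v u\<^esub> Comp C v v u (P i) c"
      by (simp add: klinear_add[OF Comp_linear_right[OF u v v P]]
          klinear_smult[OF Comp_linear_right[OF u v v P]] b c cq
          Comp_assoc[OF u u v v q(1) c P])
    finally have "X (Suc i) j = Comp C v u u (Comp C v u u (Comp C v v u (P i) c) q) (Q j)
        \<oplus>\<^bsub>Mor C v u\<^esub> b \<odot>\<^bsub>Mor C v u\<^esub> X i j"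
      using Pc[of i] b Comp_closed[OF u u v Pc q(1), of i]
      by (simp add: X_def klinear_add[OF Comp_linear_left[OF u u v Q]]
          klinear_smult[OF Comp_linear_left[OF u u v Q]])
    then show ?thesis
      by (simp add: X_def QS Comp_assoc[OF u u u v Q q(1) Pc])
  qed
  have "X i j = \<zero>\<^bsub>Mor C v u\<^esub>" for i j
  proof (induction "(n - i) + (k - j)" arbitrary: i j rule: less_induct)
    case less
    consider "n \<le> i" | "k \<le> j" | "i < n" "j < k" by linarith
    then show ?case
    proof cases
      case 1
      then show ?thesis
        using klinear_zero[OF Mor_module[OF v v] Mor_module[OF u v] Comp_linear_left[OF u v v c]]
          klinear_zero[OF Mor_module[OF u v] Mor_module[OF u v] Comp_linear_left[OF u u v Q]]
        by (simp add: X_def P0)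
    next
      case 2
      then show ?thesis
        using klinear_zero[OF Mor_module[OF u u] Mor_module[OF u v] Comp_linear_right[OF u u v Pc]]
        by (simp add: X_def Q0)
    next
      case 3
      have "X (Suc i) j = \<zero>\<^bsub>Mor C v u\<^esub>" "X i (Suc j) = \<zero>\<^bsub>Mor C v u\<^esub>"
        using 3 by (auto intro: less)
      then have "b \<odot>\<^bsub>Mor C v u\<^esub> X i j = \<zero>\<^bsub>Mor C v u\<^esub>"
        using rec[of i j] b X[of i j] by simp
      then have "inv\<^bsub>K\<^esub> b \<odot>\<^bsub>Mor C v u\<^esub> (b \<odot>\<^bsub>Mor C v u\<^esub> X i j) = \<zero>\<^bsub>Mor C v u\<^esub>"
        using b field_Units by simp
      then show ?thesis
        using b field_Units X[of i j] by (simp add: V.smult_assoc1[symmetric])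
    qed
  qed
  from this[of 0 0] show ?thesis
    by (simp add: X_def P_def Q_def End_ring_simps Comp_Idn_left Comp_Idn_right u v c)
qed

text \<open>
  After moving the scalar parts of the two endomorphisms to the other side, an eigenvector of the
  inner derivation is an eigenvector of a difference of nilpotent operators.
\<close>

lemma inner_derivation_eigenvalue:
  fixes n k :: nat
  assumes u: "u \<in> Obj C" and v: "v \<in> Obj C"
    and c: "c \<in> carrier (Mor C v u)" "c \<noteq> \<zero>\<^bsub>Mor C v u\<^esub>"
    and p: "p \<in> carrier (Mor C v v)" "p [^]\<^bsub>End_ring C v\<^esub> n = \<zero>\<^bsub>Mor C v v\<^esub>"
    and q: "q \<in> carrier (Mor C u u)" "q [^]\<^bsub>End_ring C u\<^esub> k = \<zero>\<^bsub>Mor C u u\<^esub>"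
    and scalars: "a \<in> carrier K" "lv \<in> carrier K" "lu \<in> carrier K"
    and eq: "a \<odot>\<^bsub>Mor C v u\<^esub> c =
      \<ominus>\<^bsub>Mor C v u\<^esub> Comp C v u u c (lu \<odot>\<^bsub>Mor C u u\<^esub> Idn C u \<oplus>\<^bsub>Mor C u u\<^esub> q)
      \<oplus>\<^bsub>Mor C v u\<^esub> Comp C v v u (lv \<odot>\<^bsub>Mor C v v\<^esub> Idn C v \<oplus>\<^bsub>Mor C v v\<^esub> p) c"
  shows "a = lv \<ominus>\<^bsub>K\<^esub> lu"
proof (rule ccontr)
  assume ne: "a \<noteq> lv \<ominus>\<^bsub>K\<^esub> lu"
  interpret V: module K "Mor C v u" by (rule Mor_module[OF u v])
  interpret Vu: module K "Mor C u u" by (rule Mor_module[OF u u])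
  interpret Vv: module K "Mor C v v" by (rule Mor_module[OF v v])
  let ?b = "a \<oplus>\<^bsub>K\<^esub> (lu \<ominus>\<^bsub>K\<^esub> lv)"
  have b: "?b \<in> carrier K" using scalars by simp
  have "?b \<noteq> \<zero>\<^bsub>K\<^esub>"
  proof
    assume "?b = \<zero>\<^bsub>K\<^esub>"
    then have "a = \<ominus>\<^bsub>K\<^esub> (lu \<ominus>\<^bsub>K\<^esub> lv)" using scalars by (intro minus_equality[symmetric]) auto
    then show False using ne scalars by (simp add: minus_eq minus_add a_comm)
  qed
  moreover have "Comp C v v u p c = Comp C v u u c q \<oplus>\<^bsub>Mor C v u\<^esub> ?b \<odot>\<^bsub>Mor C v u\<^esub> c"
  proof -
    have pc: "Comp C v v u p c \<in> carrier (Mor C v u)" by (intro Comp_closed u v p c)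
    have cq: "Comp C v u u c q \<in> carrier (Mor C v u)" by (intro Comp_closed u v q c)
    have 1: "Comp C v u u c (lu \<odot>\<^bsub>Mor C u u\<^esub> Idn C u \<oplus>\<^bsub>Mor C u u\<^esub> q)
        = lu \<odot>\<^bsub>Mor C v u\<^esub> c \<oplus>\<^bsub>Mor C v u\<^esub> Comp C v u u c q"
      using Idn_closed[OF u] scalars q
      by (simp add: klinear_add[OF Comp_linear_right[OF u u v c(1)]]
          klinear_smult[OF Comp_linear_right[OF u u v c(1)]] Comp_Idn_right u v c)
    have 2: "Comp C v v u (lv \<odot>\<^bsub>Mor C v v\<^esub> Idn C v \<oplus>\<^bsub>Mor C v v\<^esub> p) c
        = lv \<odot>\<^bsub>Mor C v u\<^esub> c \<oplus>\<^bsub>Mor C v u\<^esub> Comp C v v u p c"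
      using Idn_closed[OF v] scalars p
      by (simp add: klinear_add[OF Comp_linear_left[OF u v v c(1)]]
          klinear_smult[OF Comp_linear_left[OF u v v c(1)]] Comp_Idn_left u v c)
    have "?b \<odot>\<^bsub>Mor C v u\<^esub> c
        = a \<odot>\<^bsub>Mor C v u\<^esub> c \<oplus>\<^bsub>Mor C v u\<^esub> (lu \<odot>\<^bsub>Mor C v u\<^esub> c \<oplus>\<^bsub>Mor C v u\<^esub> \<ominus>\<^bsub>Mor C v u\<^esub> (lv \<odot>\<^bsub>Mor C v u\<^esub> c))"
      using scalars c by (simp add: V.smult_l_distr minus_eq V.smult_l_minus)
    also have "\<dots> = \<ominus>\<^bsub>Mor C v u\<^esub> Comp C v u u c q \<oplus>\<^bsub>Mor C v u\<^esub> Comp C v v u p c"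
      unfolding eq 1 2 using scalars c pc cq
      by (intro V.M.cancel_four) auto
    finally show ?thesis
      using pc cq by (simp add: V.M.r_neg2)
  qed
  ultimately show False
    using nilpotent_difference_no_eigenvalue[OF u v c(1) p q b] c(2) by blast
qed

end

section \<open>Hochschild-Mitchell cohomology in degree one\<close>

lemma klinear_a_inv_fun:
  assumes "module K W" "klinear K V W f"
  shows "klinear K V W (\<lambda>v. \<ominus>\<^bsub>W\<^esub> f v)"
proof -
  interpret W: module K W by fact
  show ?thesis using assms(2)
    by (intro klinearI)
      (simp_all add: klinear_closed klinear_add klinear_smult W.M.minus_add W.smult_r_minus)
qed

lemma chains_update:
  assumes "(xs, cs) \<in> chains C n" "i < n" "c \<in> carrier (Mor C (xs ! i) (xs ! Suc i))"
  shows "(xs, cs[i := c]) \<in> chains C n"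
  using assms by (auto simp: chains_def nth_list_update)

lemma chains_objects:
  assumes "(xs, cs) \<in> chains C n"
  shows "hd xs \<in> Obj C" "last xs \<in> Obj C" "i \<le> n \<Longrightarrow> xs ! i \<in> Obj C"
proof -
  have xs: "xs \<noteq> []" "set xs \<subseteq> Obj C" "length xs = Suc n" using assms by (auto simp: chains_def)
  then show "hd xs \<in> Obj C" "last xs \<in> Obj C" by auto
  show "xs ! i \<in> Obj C" if "i \<le> n" using xs that by (auto intro!: subsetD[OF xs(2)] nth_mem)
qed

lemma chains_0: "p \<in> chains C 0 \<longleftrightarrow> (\<exists>x\<in>Obj C. p = ([x], []))"
  by (cases p) (auto simp: chains_def length_Suc_conv)

lemma chains_1:
  "p \<in> chains C (Suc 0) \<longleftrightarrow>
    (\<exists>x\<in>Obj C. \<exists>y\<in>Obj C. \<exists>c\<in>carrier (Mor C y x). p = ([y, x], [c]))"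
  by (cases p) (auto simp: chains_def length_Suc_conv)

lemma chains_2:
  "p \<in> chains C (Suc (Suc 0)) \<longleftrightarrow>
    (\<exists>x\<in>Obj C. \<exists>y\<in>Obj C. \<exists>z\<in>Obj C. \<exists>c\<in>carrier (Mor C y x). \<exists>d\<in>carrier (Mor C z y).
      p = ([z, y, x], [d, c]))"
  by (cases p) (auto simp: chains_def length_Suc_conv numeral_2_eq_2 less_Suc_eq_0_disj)

context k_bimodule
begin

lemma cochains_is_module: "module K (cochains K C M n)"
proof -
  let ?V = "\<lambda>p. Bim M (hd (fst p)) (last (fst p))"
  let ?P = "prod_module (chains C n) ?V"
  let ?U = "{f \<in> carrier ?P. multilinear_on_chains K C M n f}"
  have V: "module K (?V p)" if "p \<in> chains C n" for p
    using that chains_objects[of "fst p" "snd p"] by (intro Bim_module) auto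
  interpret P: module K ?P
    by (rule prod_module_is_module) (simp_all add: V cring_axioms)
  have Mor: "module K (Mor C (xs ! i) (xs ! Suc i))" if "(xs, cs) \<in> chains C n" "i < n" for xs cs i
    using that chains_objects[OF that(1)] by (intro Mor_module) auto
  have Bim: "module K (Bim M (hd xs) (last xs))" if "(xs, cs) \<in> chains C n" for xs cs
    using chains_objects[OF that] by (intro Bim_module)
  have add: "f \<oplus>\<^bsub>?P\<^esub> g \<in> ?U" if "f \<in> ?U" "g \<in> ?U" for f g
  proof -
    have "klinear K (Mor C (xs ! i) (xs ! Suc i)) (Bim M (hd xs) (last xs))
        (\<lambda>c. (f \<oplus>\<^bsub>?P\<^esub> g) (xs, cs[i := c]))" if *: "(xs, cs) \<in> chains C n" "i < n" for xs cs i
      by (rule klinear_cong[OF Mor[OF *] _ klinear_add_fun[OF Bim[OF *(1)]]])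
        (use \<open>f \<in> ?U\<close> \<open>g \<in> ?U\<close> * chains_update[OF *] in
          \<open>auto simp: prod_module_def multilinear_on_chains_def\<close>)
    then show ?thesis
      using that P.a_closed[of f g] by (auto simp: multilinear_on_chains_def)
  qed
  have smult: "a \<odot>\<^bsub>?P\<^esub> f \<in> ?U" if "a \<in> carrier K" "f \<in> ?U" for a f
  proof -
    have "klinear K (Mor C (xs ! i) (xs ! Suc i)) (Bim M (hd xs) (last xs))
        (\<lambda>c. (a \<odot>\<^bsub>?P\<^esub> f) (xs, cs[i := c]))" if *: "(xs, cs) \<in> chains C n" "i < n" for xs cs i
      by (rule klinear_cong[OF Mor[OF *] _ klinear_smult_fun[OF Bim[OF *(1)] _ \<open>a \<in> carrier K\<close>]])
        (use \<open>f \<in> ?U\<close> * chains_update[OF *] in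
          \<open>auto simp: prod_module_def multilinear_on_chains_def\<close>)
    then show ?thesis
      using that P.smult_closed[of a f] by (auto simp: multilinear_on_chains_def)
  qed
  have "submodule ?U K ?P"
  proof (rule P.submodule_criterion)
    have "klinear K (Mor C (xs ! i) (xs ! Suc i)) (Bim M (hd xs) (last xs))
        (\<lambda>c. \<zero>\<^bsub>?P\<^esub> (xs, cs[i := c]))" if *: "(xs, cs) \<in> chains C n" "i < n" for xs cs i
      by (rule klinear_cong[OF Mor[OF *] _ klinear_zero_fun[OF Bim[OF *(1)]]])
        (use * chains_update[OF *] in \<open>auto simp: prod_module_def\<close>)
    then show "\<zero>\<^bsub>?P\<^esub> \<in> ?U" by (auto simp: multilinear_on_chains_def)
    show "f \<oplus>\<^bsub>?P\<^esub> g \<in> ?U" if "f \<in> ?U" "g \<in> ?U" for f g by (rule add[OF that])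
    show "a \<odot>\<^bsub>?P\<^esub> f \<in> ?U" if "a \<in> carrier K" "f \<in> ?U" for a f by (rule smult[OF that])
  qed blast
  then have "module K (?P\<lparr>carrier := ?U\<rparr>)"
    by (rule submodule.submodule_is_module) (rule P.module_axioms)
  also have "?P\<lparr>carrier := ?U\<rparr> = cochains K C M n"
    by (simp add: prod_module_def cochains_def case_prod_unfold)
  finally show ?thesis .
qed

lemma LAct_closed:
  assumes "x \<in> Obj C" "y \<in> Obj C" "z \<in> Obj C" "c \<in> carrier (Mor C z y)" "m \<in> carrier (Bim M y x)"
  shows "LAct M z y x c m \<in> carrier (Bim M z x)"
  by (rule klinear_closed[OF LAct_linear_right]) (use assms in auto)

lemma RAct_closed:
  assumes "u \<in> Obj C" "x \<in> Obj C" "y \<in> Obj C" "c \<in> carrier (Mor C x u)" "m \<in> carrier (Bim M y x)"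
  shows "RAct M y x u m c \<in> carrier (Bim M y u)"
  by (rule klinear_closed[OF RAct_linear_left]) (use assms in auto)

lemma cochain_0_closed:
  "\<lbrakk>f \<in> carrier (cochains K C M 0); x \<in> Obj C\<rbrakk> \<Longrightarrow> f ([x], []) \<in> carrier (Bim M x x)"
  by (auto simp: cochains_def PiE_iff chains_0 Ball_def)

lemma cochain_1_linear:
  assumes "f \<in> carrier (cochains K C M (Suc 0))" "x \<in> Obj C" "y \<in> Obj C"
  shows "klinear K (Mor C y x) (Bim M y x) (\<lambda>c. f ([y, x], [c]))"
proof -
  interpret V: module K "Mor C y x" by (rule Mor_module[OF assms(2,3)])
  have "([y, x], [\<zero>\<^bsub>Mor C y x\<^esub>]) \<in> chains C (Suc 0)" using assms by (auto simp: chains_1)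
  then show ?thesis
    using assms(1) by (fastforce simp: cochains_def multilinear_on_chains_def)
qed

lemma cochain_1_closed:
  "\<lbrakk>f \<in> carrier (cochains K C M (Suc 0)); x \<in> Obj C; y \<in> Obj C; c \<in> carrier (Mor C y x)\<rbrakk>
    \<Longrightarrow> f ([y, x], [c]) \<in> carrier (Bim M y x)"
  using klinear_closed[OF cochain_1_linear] .

lemma cochain_1I:
  assumes "f \<in> extensional (chains C (Suc 0))"
    and "\<And>x y. \<lbrakk>x \<in> Obj C; y \<in> Obj C\<rbrakk> \<Longrightarrow> klinear K (Mor C y x) (Bim M y x) (\<lambda>c. f ([y, x], [c]))"
  shows "f \<in> carrier (cochains K C M (Suc 0))"
  using assms(1) klinear_closed[OF assms(2)] assms(2)
  by (auto simp: cochains_def PiE_iff multilinear_on_chains_def chains_1)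

lemma cochain_1_eqI:
  assumes "f \<in> carrier (cochains K C M (Suc 0))" "g \<in> carrier (cochains K C M (Suc 0))"
    and "\<And>x y c. \<lbrakk>x \<in> Obj C; y \<in> Obj C; c \<in> carrier (Mor C y x)\<rbrakk> \<Longrightarrow> f ([y, x], [c]) = g ([y, x], [c])"
  shows "f = g"
proof (rule extensionalityI[of _ "chains C (Suc 0)"])
  show "f \<in> extensional (chains C (Suc 0))" "g \<in> extensional (chains C (Suc 0))"
    using assms(1,2) by (auto simp: cochains_def PiE_iff)
qed (use assms(3) in \<open>auto simp: chains_1\<close>)

lemma cochain_1_add:
  "\<lbrakk>x \<in> Obj C; y \<in> Obj C; c \<in> carrier (Mor C y x)\<rbrakk>
    \<Longrightarrow> (f \<oplus>\<^bsub>cochains K C M (Suc 0)\<^esub> g) ([y, x], [c]) = f ([y, x], [c]) \<oplus>\<^bsub>Bim M y x\<^esub> g ([y, x], [c])"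
  using chains_1[of "([y, x], [c])" C] by (auto simp: cochains_def)

lemma cochain_1_smult:
  "\<lbrakk>x \<in> Obj C; y \<in> Obj C; c \<in> carrier (Mor C y x)\<rbrakk>
    \<Longrightarrow> (a \<odot>\<^bsub>cochains K C M (Suc 0)\<^esub> f) ([y, x], [c]) = a \<odot>\<^bsub>Bim M y x\<^esub> f ([y, x], [c])"
  using chains_1[of "([y, x], [c])" C] by (auto simp: cochains_def)

lemma cochain_0_add:
  "x \<in> Obj C \<Longrightarrow> (f \<oplus>\<^bsub>cochains K C M 0\<^esub> g) ([x], []) = f ([x], []) \<oplus>\<^bsub>Bim M x x\<^esub> g ([x], [])"
  by (simp add: cochains_def chains_0)

lemma cochain_0_smult:
  "x \<in> Obj C \<Longrightarrow> (a \<odot>\<^bsub>cochains K C M 0\<^esub> f) ([x], []) = a \<odot>\<^bsub>Bim M x x\<^esub> f ([x], [])"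
  by (simp add: cochains_def chains_0)

lemma coboundary_0_apply:
  assumes f: "f \<in> carrier (cochains K C M 0)"
    and x: "x \<in> Obj C" and y: "y \<in> Obj C" and c: "c \<in> carrier (Mor C y x)"
  shows "coboundary K C M 0 f ([y, x], [c]) =
    \<ominus>\<^bsub>Bim M y x\<^esub> LAct M y x x c (f ([x], [])) \<oplus>\<^bsub>Bim M y x\<^esub> RAct M y y x (f ([y], [])) c"
proof -
  interpret V: module K "Bim M y x" by (rule Bim_module[OF x y])
  have "([y, x], [c]) \<in> chains C (Suc 0)" using x y c chains_1[of _ C] by auto
  moreover have "LAct M y x x c (f ([x], [])) \<in> carrier (Bim M y x)"
    by (intro LAct_closed x y c cochain_0_closed f)
  ultimately show ?thesis
    by (simp add: coboundary_def Let_def V.smult_l_minus)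
qed

lemma coboundary_1_apply:
  assumes f: "f \<in> carrier (cochains K C M (Suc 0))"
    and x: "x \<in> Obj C" and y: "y \<in> Obj C" and z: "z \<in> Obj C"
    and c: "c \<in> carrier (Mor C y x)" and d: "d \<in> carrier (Mor C z y)"
  shows "coboundary K C M (Suc 0) f ([z, y, x], [d, c]) =
    LAct M z y x d (f ([y, x], [c])) \<oplus>\<^bsub>Bim M z x\<^esub>
    \<ominus>\<^bsub>Bim M z x\<^esub> f ([z, x], [Comp C z y x d c]) \<oplus>\<^bsub>Bim M z x\<^esub>
    RAct M z y x (f ([z, y], [d])) c"
proof -
  interpret V: module K "Bim M z x" by (rule Bim_module[OF x z])
  have "([z, y, x], [d, c]) \<in> chains C (Suc (Suc 0))"
    using x y z c d chains_2[of _ C] by (auto simp: numeral_2_eq_2)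
  moreover have "f ([z, x], [Comp C z y x d c]) \<in> carrier (Bim M z x)"
    by (intro cochain_1_closed f x z Comp_closed y c d)
  moreover have "LAct M z y x d (f ([y, x], [c])) \<in> carrier (Bim M z x)"
    by (intro LAct_closed x y z d cochain_1_closed f c)
  ultimately show ?thesis
    by (simp add: coboundary_def Let_def merge_def V.smult_l_minus l_minus numeral_2_eq_2)
qed

lemma cocycle_1_iff:
  "f \<in> carrier (cocycles K C M (Suc 0)) \<longleftrightarrow> f \<in> carrier (cochains K C M (Suc 0)) \<and>
    (\<forall>x\<in>Obj C. \<forall>y\<in>Obj C. \<forall>z\<in>Obj C. \<forall>c\<in>carrier (Mor C y x). \<forall>d\<in>carrier (Mor C z y).
      f ([z, x], [Comp C z y x d c]) =
      LAct M z y x d (f ([y, x], [c])) \<oplus>\<^bsub>Bim M z x\<^esub> RAct M z y x (f ([z, y], [d])) c)"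
  (is "_ \<longleftrightarrow> _ \<and> ?der")
proof -
  have "coboundary K C M (Suc 0) f = \<zero>\<^bsub>cochains K C M (Suc (Suc 0))\<^esub> \<longleftrightarrow> ?der"
    if f: "f \<in> carrier (cochains K C M (Suc 0))"
  proof -
    have pt: "coboundary K C M (Suc 0) f ([z, y, x], [d, c]) = \<zero>\<^bsub>Bim M z x\<^esub> \<longleftrightarrow>
        f ([z, x], [Comp C z y x d c]) =
        LAct M z y x d (f ([y, x], [c])) \<oplus>\<^bsub>Bim M z x\<^esub> RAct M z y x (f ([z, y], [d])) c"
      if x: "x \<in> Obj C" and y: "y \<in> Obj C" and z: "z \<in> Obj C"
        and c: "c \<in> carrier (Mor C y x)" and d: "d \<in> carrier (Mor C z y)" for x y z c d
    proof -
      interpret V: module K "Bim M z x" by (rule Bim_module[OF x z])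
      let ?l = "LAct M z y x d (f ([y, x], [c]))" and ?r = "RAct M z y x (f ([z, y], [d])) c"
        and ?m = "f ([z, x], [Comp C z y x d c])"
      have cl: "?l \<in> carrier (Bim M z x)" "?r \<in> carrier (Bim M z x)" "?m \<in> carrier (Bim M z x)"
        by (intro LAct_closed RAct_closed cochain_1_closed Comp_closed f x y z c d)+
      have "?l \<oplus>\<^bsub>Bim M z x\<^esub> \<ominus>\<^bsub>Bim M z x\<^esub> ?m \<oplus>\<^bsub>Bim M z x\<^esub> ?r
          = \<ominus>\<^bsub>Bim M z x\<^esub> ?m \<oplus>\<^bsub>Bim M z x\<^esub> (?l \<oplus>\<^bsub>Bim M z x\<^esub> ?r)"
        using cl by (simp add: V.M.add.m_ac)
      moreover have "\<ominus>\<^bsub>Bim M z x\<^esub> ?m \<oplus>\<^bsub>Bim M z x\<^esub> w = \<zero>\<^bsub>Bim M z x\<^esub> \<longleftrightarrow> ?m = w"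
        if "w \<in> carrier (Bim M z x)" for w
        using cl(3) that by (metis V.M.a_inv_closed V.M.l_neg V.M.r_neg2 V.M.r_zero)
      ultimately show ?thesis
        using cl by (simp only: coboundary_1_apply[OF f x y z c d] V.M.a_closed)
    qed
    have "coboundary K C M (Suc 0) f = \<zero>\<^bsub>cochains K C M (Suc (Suc 0))\<^esub> \<longleftrightarrow>
        (\<forall>p\<in>chains C (Suc (Suc 0)). coboundary K C M (Suc 0) f p = \<zero>\<^bsub>cochains K C M (Suc (Suc 0))\<^esub> p)"
      by (auto simp: coboundary_def cochains_def numeral_2_eq_2 fun_eq_iff restrict_def)
    also have "\<dots> \<longleftrightarrow> ?der"
      using pt chains_2[of _ C] by (auto simp: cochains_def chains_2 numeral_2_eq_2[symmetric])
    finally show ?thesis .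
  qed
  then show ?thesis by (auto simp: cocycles_def)
qed

end

context k_bimodule
begin

lemma cocycle_1_derivation:
  assumes "f \<in> carrier (cocycles K C M (Suc 0))"
    and "x \<in> Obj C" "y \<in> Obj C" "z \<in> Obj C" "c \<in> carrier (Mor C y x)" "d \<in> carrier (Mor C z y)"
  shows "f ([z, x], [Comp C z y x d c]) =
      LAct M z y x d (f ([y, x], [c])) \<oplus>\<^bsub>Bim M z x\<^esub> RAct M z y x (f ([z, y], [d])) c"
  using assms unfolding cocycle_1_iff by blast

lemma cocycles_1_is_module: "module K (cocycles K C M (Suc 0))"
proof -
  let ?C1 = "cochains K C M (Suc 0)" and ?Z = "carrier (cocycles K C M (Suc 0))"
  interpret C1: module K ?C1 by (rule cochains_is_module)
  have add: "f \<oplus>\<^bsub>?C1\<^esub> g \<in> ?Z" if f: "f \<in> ?Z" and g: "g \<in> ?Z" for f g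
    unfolding cocycle_1_iff
  proof (intro conjI ballI)
    have fc: "f \<in> carrier ?C1" and gc: "g \<in> carrier ?C1" using f g by (auto simp: cocycle_1_iff)
    then show "f \<oplus>\<^bsub>?C1\<^esub> g \<in> carrier ?C1" by simp
    fix x y z c d assume x: "x \<in> Obj C" and y: "y \<in> Obj C" and z: "z \<in> Obj C"
      and c: "c \<in> carrier (Mor C y x)" and d: "d \<in> carrier (Mor C z y)"
    interpret V: module K "Bim M z x" by (rule Bim_module[OF x z])
    have cl: "LAct M z y x d (h ([y, x], [c])) \<in> carrier (Bim M z x)"
      "RAct M z y x (h ([z, y], [d])) c \<in> carrier (Bim M z x)" if "h \<in> carrier ?C1" for h
      by (intro LAct_closed RAct_closed cochain_1_closed that x y z c d)+
    show "(f \<oplus>\<^bsub>?C1\<^esub> g) ([z, x], [Comp C z y x d c]) =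
        LAct M z y x d ((f \<oplus>\<^bsub>?C1\<^esub> g) ([y, x], [c])) \<oplus>\<^bsub>Bim M z x\<^esub>
        RAct M z y x ((f \<oplus>\<^bsub>?C1\<^esub> g) ([z, y], [d])) c"
      using cl[OF fc] cl[OF gc]
      by (simp add: cochain_1_add x y z c d Comp_closed
          cocycle_1_derivation[OF f x y z c d] cocycle_1_derivation[OF g x y z c d]
          klinear_add[OF LAct_linear_right[OF x y z d]] klinear_add[OF RAct_linear_left[OF x y z c]]
          cochain_1_closed[OF fc] cochain_1_closed[OF gc] V.M.add.m_ac)
  qed
  have smult: "a \<odot>\<^bsub>?C1\<^esub> f \<in> ?Z" if a: "a \<in> carrier K" and f: "f \<in> ?Z" for a f
    unfolding cocycle_1_iff
  proof (intro conjI ballI)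
    have fc: "f \<in> carrier ?C1" using f by (auto simp: cocycle_1_iff)
    then show "a \<odot>\<^bsub>?C1\<^esub> f \<in> carrier ?C1" using a by simp
    fix x y z c d assume x: "x \<in> Obj C" and y: "y \<in> Obj C" and z: "z \<in> Obj C"
      and c: "c \<in> carrier (Mor C y x)" and d: "d \<in> carrier (Mor C z y)"
    interpret V: module K "Bim M z x" by (rule Bim_module[OF x z])
    have cl: "LAct M z y x d (f ([y, x], [c])) \<in> carrier (Bim M z x)"
      "RAct M z y x (f ([z, y], [d])) c \<in> carrier (Bim M z x)"
      by (intro LAct_closed RAct_closed cochain_1_closed fc x y z c d)+
    show "(a \<odot>\<^bsub>?C1\<^esub> f) ([z, x], [Comp C z y x d c]) =
        LAct M z y x d ((a \<odot>\<^bsub>?C1\<^esub> f) ([y, x], [c])) \<oplus>\<^bsub>Bim M z x\<^esub>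
        RAct M z y x ((a \<odot>\<^bsub>?C1\<^esub> f) ([z, y], [d])) c"
      using cl a
      by (simp add: cochain_1_smult x y z c d Comp_closed
          cocycle_1_derivation[OF f x y z c d] cochain_1_closed[OF fc]
          klinear_smult[OF LAct_linear_right[OF x y z d]]
          klinear_smult[OF RAct_linear_left[OF x y z c]] V.smult_r_distr)
  qed
  have "\<zero>\<^bsub>?C1\<^esub> \<in> ?Z"
    unfolding cocycle_1_iff
  proof (intro conjI ballI)
    fix x y z c d assume x: "x \<in> Obj C" and y: "y \<in> Obj C" and z: "z \<in> Obj C"
      and c: "c \<in> carrier (Mor C y x)" and d: "d \<in> carrier (Mor C z y)"
    interpret V: module K "Bim M z x" by (rule Bim_module[OF x z])
    have zero: "\<zero>\<^bsub>?C1\<^esub> ([b, a], [e]) = \<zero>\<^bsub>Bim M b a\<^esub>"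
      if "a \<in> Obj C" "b \<in> Obj C" "e \<in> carrier (Mor C b a)" for a b e
      using that chains_1[of "([b, a], [e])" C] by (auto simp: cochains_def)
    show "\<zero>\<^bsub>?C1\<^esub> ([z, x], [Comp C z y x d c]) =
        LAct M z y x d (\<zero>\<^bsub>?C1\<^esub> ([y, x], [c])) \<oplus>\<^bsub>Bim M z x\<^esub> RAct M z y x (\<zero>\<^bsub>?C1\<^esub> ([z, y], [d])) c"
      by (simp add: zero x y z c d Comp_closed
          klinear_zero[OF Bim_module[OF x y] Bim_module[OF x z] LAct_linear_right[OF x y z d]]
          klinear_zero[OF Bim_module[OF y z] Bim_module[OF x z] RAct_linear_left[OF x y z c]])
  qed simp
  then have "submodule ?Z K ?C1"
    by (intro C1.submodule_criterion add smult) (auto simp: cocycle_1_iff)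
  then have "module K (?C1\<lparr>carrier := ?Z\<rparr>)"
    by (rule submodule.submodule_is_module) (rule C1.module_axioms)
  also have "?C1\<lparr>carrier := ?Z\<rparr> = cocycles K C M (Suc 0)"
    by (simp add: cocycles_def)
  finally show ?thesis .
qed

text \<open>
  Inner derivations are derivations: in \<open>d (f\<^sub>y c - c f\<^sub>x) + (f\<^sub>z d - d f\<^sub>y) c\<close> the mixed terms
  \<open>d f\<^sub>y c\<close> cancel.
\<close>

lemma coboundary_0_closed:
  assumes f: "f \<in> carrier (cochains K C M 0)"
  shows "coboundary K C M 0 f \<in> carrier (cocycles K C M (Suc 0))"
  unfolding cocycle_1_iff
proof (intro conjI ballI)
  show "coboundary K C M 0 f \<in> carrier (cochains K C M (Suc 0))"
  proof (rule cochain_1I)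
    show "coboundary K C M 0 f \<in> extensional (chains C (Suc 0))"
      by (simp add: coboundary_def)
    fix x y assume x: "x \<in> Obj C" and y: "y \<in> Obj C"
    have "klinear K (Mor C y x) (Bim M y x)
        (\<lambda>c. \<ominus>\<^bsub>Bim M y x\<^esub> LAct M y x x c (f ([x], [])) \<oplus>\<^bsub>Bim M y x\<^esub> RAct M y y x (f ([y], [])) c)"
      by (intro klinear_add_fun klinear_a_inv_fun Bim_module LAct_linear_left RAct_linear_right
          cochain_0_closed x y f)
    then show "klinear K (Mor C y x) (Bim M y x) (\<lambda>c. coboundary K C M 0 f ([y, x], [c]))"
      by (rule klinear_cong[OF Mor_module[OF x y], rotated]) (simp add: coboundary_0_apply f x y)
  qed
  fix x y z c d assume x: "x \<in> Obj C" and y: "y \<in> Obj C" and z: "z \<in> Obj C"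
    and c: "c \<in> carrier (Mor C y x)" and d: "d \<in> carrier (Mor C z y)"
  interpret V: module K "Bim M z x" by (rule Bim_module[OF x z])
  note fx = cochain_0_closed[OF f x] and fy = cochain_0_closed[OF f y] and fz = cochain_0_closed[OF f z]
  let ?a = "LAct M z x x (Comp C z y x d c) (f ([x], []))"
    and ?b = "LAct M z y x d (RAct M y y x (f ([y], [])) c)"
    and ?e = "RAct M z z x (f ([z], [])) (Comp C z y x d c)"
  have cl: "?a \<in> carrier (Bim M z x)" "?b \<in> carrier (Bim M z x)" "?e \<in> carrier (Bim M z x)"
    by (intro LAct_closed RAct_closed Comp_closed fx fy fz x y z c d)+
  have l: "LAct M z y x d (coboundary K C M 0 f ([y, x], [c])) = \<ominus>\<^bsub>Bim M z x\<^esub> ?a \<oplus>\<^bsub>Bim M z x\<^esub> ?b"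
  proof -
    have cl': "LAct M y x x c (f ([x], [])) \<in> carrier (Bim M y x)"
      "RAct M y y x (f ([y], [])) c \<in> carrier (Bim M y x)"
      by (intro LAct_closed RAct_closed fx fy x y c)+
    interpret V': module K "Bim M y x" by (rule Bim_module[OF x y])
    show ?thesis
      using cl'
      by (simp add: coboundary_0_apply[OF f x y c] klinear_add[OF LAct_linear_right[OF x y z d]]
          klinear_a_inv[OF Bim_module[OF x y] Bim_module[OF x z] LAct_linear_right[OF x y z d]]
          LAct_assoc[OF x x y z fx c d])
  qed
  have r: "RAct M z y x (coboundary K C M 0 f ([z, y], [d])) c = \<ominus>\<^bsub>Bim M z x\<^esub> ?b \<oplus>\<^bsub>Bim M z x\<^esub> ?e"
  proof -
    have cl': "LAct M z y y d (f ([y], [])) \<in> carrier (Bim M z y)"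
      "RAct M z z y (f ([z], [])) d \<in> carrier (Bim M z y)"
      by (intro LAct_closed RAct_closed fz fy z y d)+
    interpret V': module K "Bim M z y" by (rule Bim_module[OF y z])
    show ?thesis
      using cl'
      by (simp add: coboundary_0_apply[OF f y z d] klinear_add[OF RAct_linear_left[OF x y z c]]
          klinear_a_inv[OF Bim_module[OF y z] Bim_module[OF x z] RAct_linear_left[OF x y z c]]
          LAct_RAct[OF x y y z d fy c] RAct_assoc[OF z z y x fz d c])
  qed
  show "coboundary K C M 0 f ([z, x], [Comp C z y x d c]) =
      LAct M z y x d (coboundary K C M 0 f ([y, x], [c])) \<oplus>\<^bsub>Bim M z x\<^esub>
      RAct M z y x (coboundary K C M 0 f ([z, y], [d])) c"
    unfolding l r coboundary_0_apply[OF f x z Comp_closed[OF x y z d c]]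
    using cl by (simp add: V.M.a_assoc V.M.r_neg2)
qed

lemma coboundary_0_linear:
  "klinear K (cochains K C M 0) (cocycles K C M (Suc 0)) (coboundary K C M 0)"
proof (rule klinearI)
  interpret C0: module K "cochains K C M 0" by (rule cochains_is_module)
  interpret Z: module K "cocycles K C M (Suc 0)" by (rule cocycles_1_is_module)
  have Z: "f \<in> carrier (cocycles K C M (Suc 0)) \<Longrightarrow> f \<in> carrier (cochains K C M (Suc 0))" for f
    by (simp add: cocycles_def)
  have ops: "add (cocycles K C M (Suc 0)) = add (cochains K C M (Suc 0))"
    "smult (cocycles K C M (Suc 0)) = smult (cochains K C M (Suc 0))"
    by (simp_all add: cocycles_def)
  fix f g a assume f: "f \<in> carrier (cochains K C M 0)"
  show "coboundary K C M 0 f \<in> carrier (cocycles K C M (Suc 0))"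
    by (rule coboundary_0_closed[OF f])
  show "coboundary K C M 0 (f \<oplus>\<^bsub>cochains K C M 0\<^esub> g) =
      coboundary K C M 0 f \<oplus>\<^bsub>cocycles K C M (Suc 0)\<^esub> coboundary K C M 0 g"
    if g: "g \<in> carrier (cochains K C M 0)"
  proof (rule cochain_1_eqI)
    fix x y c assume x: "x \<in> Obj C" and y: "y \<in> Obj C" and c: "c \<in> carrier (Mor C y x)"
    interpret V: module K "Bim M y x" by (rule Bim_module[OF x y])
    have cl: "LAct M y x x c (h ([x], [])) \<in> carrier (Bim M y x)"
      "RAct M y y x (h ([y], [])) c \<in> carrier (Bim M y x)"
      if "h \<in> carrier (cochains K C M 0)" for h
      by (intro LAct_closed RAct_closed cochain_0_closed that x y c)+
    show "coboundary K C M 0 (f \<oplus>\<^bsub>cochains K C M 0\<^esub> g) ([y, x], [c]) =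
        (coboundary K C M 0 f \<oplus>\<^bsub>cocycles K C M (Suc 0)\<^esub> coboundary K C M 0 g) ([y, x], [c])"
      using cl[OF f] cl[OF g]
      by (simp add: ops cochain_1_add x y c coboundary_0_apply f g cochain_0_add
          klinear_add[OF LAct_linear_right[OF x x y c]] klinear_add[OF RAct_linear_left[OF x y y c]]
          cochain_0_closed V.M.minus_add V.M.add.m_ac)
  qed (use f g in \<open>auto intro!: Z coboundary_0_closed\<close>)
  show "coboundary K C M 0 (a \<odot>\<^bsub>cochains K C M 0\<^esub> f) =
      a \<odot>\<^bsub>cocycles K C M (Suc 0)\<^esub> coboundary K C M 0 f" if a: "a \<in> carrier K"
  proof (rule cochain_1_eqI)
    fix x y c assume x: "x \<in> Obj C" and y: "y \<in> Obj C" and c: "c \<in> carrier (Mor C y x)"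
    interpret V: module K "Bim M y x" by (rule Bim_module[OF x y])
    have cl: "LAct M y x x c (f ([x], [])) \<in> carrier (Bim M y x)"
      "RAct M y y x (f ([y], [])) c \<in> carrier (Bim M y x)"
      by (intro LAct_closed RAct_closed cochain_0_closed f x y c)+
    show "coboundary K C M 0 (a \<odot>\<^bsub>cochains K C M 0\<^esub> f) ([y, x], [c]) =
        (a \<odot>\<^bsub>cocycles K C M (Suc 0)\<^esub> coboundary K C M 0 f) ([y, x], [c])"
      using cl a
      by (simp add: ops cochain_1_smult x y c coboundary_0_apply f cochain_0_smult
          klinear_smult[OF LAct_linear_right[OF x x y c]]
          klinear_smult[OF RAct_linear_left[OF x y y c]]
          cochain_0_closed V.smult_r_distr V.smult_r_minus)
  qed (use f a in \<open>auto intro!: Z coboundary_0_closed\<close>)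
qed

sublocale HH1: quotient_of_module K "cocycles K C M (Suc 0)" "coboundaries K C M (Suc 0)"
proof (intro quotient_of_module.intro quotient_of_module_axioms.intro)
  show "module K (cocycles K C M (Suc 0))" by (rule cocycles_1_is_module)
  show "submodule (coboundaries K C M (Suc 0)) K (cocycles K C M (Suc 0))"
    using klinear_image_submodule[OF cochains_is_module cocycles_1_is_module coboundary_0_linear]
    by (simp add: coboundaries_def)
qed

end

section \<open>Direct sums of morphism spaces over pairs of orbits\<close>

context free_action
begin

sublocale G: group G
  using group_hom by (rule group_hom.axioms)

lemma obj_act_closed: "\<lbrakk>s \<in> carrier G; x \<in> Obj C\<rbrakk> \<Longrightarrow> \<phi> s x \<in> Obj C"
  using element_image by blast

lemma obj_act_one: "x \<in> Obj C \<Longrightarrow> \<phi> \<one>\<^bsub>G\<^esub> x = x"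
  using id_eq_one by (metis restrict_apply')

lemma obj_act_inv:
  assumes "s \<in> carrier G" "x \<in> Obj C"
  shows "\<phi> (inv\<^bsub>G\<^esub> s) (\<phi> s x) = x" "\<phi> s (\<phi> (inv\<^bsub>G\<^esub> s) x) = x"
  using assms by (simp_all add: composition_rule[symmetric] obj_act_one)

lemma obj_act_cancel:
  assumes "s \<in> carrier G" "t \<in> carrier G" "x \<in> Obj C" "\<phi> s x = \<phi> t x"
  shows "s = t"
proof -
  have "\<phi> (inv\<^bsub>G\<^esub> t \<otimes>\<^bsub>G\<^esub> s) x = x"
    using assms by (simp add: composition_rule obj_act_inv)
  then have "inv\<^bsub>G\<^esub> t \<otimes>\<^bsub>G\<^esub> s = \<one>\<^bsub>G\<^esub>" using assms by (intro free) auto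
  then have "inv\<^bsub>G\<^esub> (inv\<^bsub>G\<^esub> t) = s" using assms by (intro G.inv_equality) (simp_all add: G.inv_comm)
  then show ?thesis using assms by simp
qed

lemma the_transporter:
  assumes "s \<in> carrier G" "x \<in> Obj C" "\<phi> s x = y"
  shows "(THE s. s \<in> carrier G \<and> \<phi> s x = y) = s"
  using assms obj_act_cancel by (intro the_equality) auto

lemma act_closed:
  assumes "s \<in> carrier G" "x \<in> Obj C" "y \<in> Obj C" "c \<in> carrier (Mor C y x)"
  shows "\<alpha> s y x c \<in> carrier (Mor C (\<phi> s y) (\<phi> s x))"
  using klinear_closed[OF act_linear] assms by blast

lemma act_inv:
  assumes "s \<in> carrier G" "x \<in> Obj C" "y \<in> Obj C" "c \<in> carrier (Mor C y x)"
  shows "\<alpha> (inv\<^bsub>G\<^esub> s) (\<phi> s y) (\<phi> s x) (\<alpha> s y x c) = c"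
  using assms by (simp add: act_mult act_one)

text \<open>
  The axioms of an action say that products are preserved, not identities. But \<open>1\<^bsub>s x\<^esub>\<close> is itself of
  the form \<open>s e\<close>, and \<open>s 1\<^sub>x\<close> is a left unit for elements of this form.
\<close>

lemma act_Idn:
  assumes s: "s \<in> carrier G" and x: "x \<in> Obj C"
  shows "\<alpha> s x x (Idn C x) = Idn C (\<phi> s x)"
proof -
  define y e where "y = \<phi> s x" and "e = \<alpha> (inv\<^bsub>G\<^esub> s) y y (Idn C y)"
  have y: "y \<in> Obj C" using s x by (simp add: y_def obj_act_closed)
  have yx: "\<phi> (inv\<^bsub>G\<^esub> s) y = x" using s x by (simp add: y_def obj_act_inv)
  have e: "e \<in> carrier (Mor C x x)"
    using act_closed[OF G.inv_closed[OF s] y y Idn_closed[OF y]] by (simp add: e_def yx)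
  have ae: "\<alpha> s x x e = Idn C y"
    using act_inv[OF G.inv_closed[OF s] y y Idn_closed[OF y]] s by (simp add: e_def yx)
  have "\<alpha> s x x (Idn C x) = Comp C y y y (\<alpha> s x x (Idn C x)) (Idn C y)"
    using act_closed[OF s x x Idn_closed[OF x]] y by (simp add: Comp_Idn_right y_def)
  also have "\<dots> = \<alpha> s x x (Comp C x x x (Idn C x) e)"
    using act_Comp[OF s x x x e Idn_closed[OF x]] by (simp add: ae y_def)
  also have "\<dots> = Idn C y" using e x by (simp add: Comp_Idn_left ae)
  finally show ?thesis by (simp add: y_def)
qed

lemma orbit_sub: "\<lbrakk>u \<in> orbits G (Obj C) \<phi>; x \<in> u\<rbrakk> \<Longrightarrow> x \<in> Obj C"
  using orbits_coverture by blast

lemma orbit_transport: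
  assumes "u \<in> orbits G (Obj C) \<phi>" "x \<in> u" "y \<in> u"
  shows "\<exists>s\<in>carrier G. \<phi> s x = y"
proof -
  obtain z where z: "z \<in> Obj C" "u = orbit G \<phi> z" using assms(1) by (auto simp: orbits_def)
  obtain s t where st: "s \<in> carrier G" "x = \<phi> s z" "t \<in> carrier G" "y = \<phi> t z"
    using assms z by (auto simp: orbit_def)
  have "\<phi> (t \<otimes>\<^bsub>G\<^esub> inv\<^bsub>G\<^esub> s) x = y"
    using st z by (simp add: composition_rule obj_act_closed obj_act_inv)
  then show ?thesis using st by blast
qed

lemma orbit_act_closed:
  assumes "u \<in> orbits G (Obj C) \<phi>" "x \<in> u" "s \<in> carrier G"
  shows "\<phi> s x \<in> u"
proof -
  obtain z where z: "z \<in> Obj C" "u = orbit G \<phi> z" using assms(1) by (auto simp: orbits_def)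
  obtain t where t: "t \<in> carrier G" "x = \<phi> t z" using assms z by (auto simp: orbit_def)
  have "\<phi> s x = \<phi> (s \<otimes>\<^bsub>G\<^esub> t) z" using assms z t by (simp add: composition_rule)
  then show ?thesis using assms z t by (auto simp: orbit_def)
qed

lemma orbit_nonempty: "u \<in> orbits G (Obj C) \<phi> \<Longrightarrow> \<exists>x. x \<in> u"
  using orbit_refl by (auto simp: orbits_def)

abbreviation single :: "'o set \<Rightarrow> 'o set \<Rightarrow> 'o \<Rightarrow> 'o \<Rightarrow> 'm \<Rightarrow> 'o \<times> 'o \<Rightarrow> 'm" where
  "single v u y x c \<equiv> dsum_inj (v \<times> u) (\<lambda>(y, x). Mor C y x) (y, x) c"

abbreviation quot_class :: "'o set \<Rightarrow> 'o set \<Rightarrow> ('o \<times> 'o \<Rightarrow> 'm) \<Rightarrow> ('o \<times> 'o \<Rightarrow> 'm) set" where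
  "quot_class \<equiv> orbit_class K C G \<phi> \<alpha>"

end

context free_action
begin

abbreviation quot_cat :: "('o set, ('o \<times> 'o \<Rightarrow> 'm) set, 'k) kcat" where
  "quot_cat \<equiv> quotient_category K C G \<phi> \<alpha>"

lemma quot_cat_simps:
  "Obj quot_cat = orbits G (Obj C) \<phi>"
  "Mor quot_cat v u = quot_module (orbit_sum C v u) (orbit_ker K C G \<phi> \<alpha> v u)"
  by (simp_all add: quotient_category_def)

end

locale orbit_pair = free_action K C G \<phi> \<alpha>
  for K :: "'k ring" and C :: "('o, 'm, 'k) kcat" and G :: "'g monoid" and \<phi> \<alpha> +
  fixes v u :: "'o set"
  assumes v: "v \<in> orbits G (Obj C) \<phi>" and u: "u \<in> orbits G (Obj C) \<phi>"
begin

lemma pair_objects: "y \<in> v \<Longrightarrow> y \<in> Obj C" "x \<in> u \<Longrightarrow> x \<in> Obj C"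
  using orbit_sub v u by auto

lemma pair_act_closed:
  "\<lbrakk>y \<in> v; s \<in> carrier G\<rbrakk> \<Longrightarrow> \<phi> s y \<in> v" "\<lbrakk>x \<in> u; s \<in> carrier G\<rbrakk> \<Longrightarrow> \<phi> s x \<in> u"
  using orbit_act_closed v u by auto

sublocale osum: module_family K "v \<times> u" "\<lambda>(y, x). Mor C y x"
  rewrites "dsum (v \<times> u) (\<lambda>(y, x). Mor C y x) = orbit_sum C v u"
  by (rule module_family.intro) (auto simp: orbit_sum_def cring_axioms pair_objects intro!: Mor_module)

lemma single_linear:
  "\<lbrakk>y \<in> v; x \<in> u\<rbrakk> \<Longrightarrow> klinear K (Mor C y x) (orbit_sum C v u) (single v u y x)"
  using osum.dsum_inj_linear[of "(y, x)"] by simp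

lemma single_closed:
  "\<lbrakk>y \<in> v; x \<in> u; c \<in> carrier (Mor C y x)\<rbrakk> \<Longrightarrow> single v u y x c \<in> carrier (orbit_sum C v u)"
  using klinear_closed[OF single_linear] .

lemma act_single:
  assumes s: "s \<in> carrier G" and y: "y \<in> v" and x: "x \<in> u" and c: "c \<in> carrier (Mor C y x)"
  shows "orbit_sum_act G \<phi> \<alpha> v u s (single v u y x c) = single v u (\<phi> s y) (\<phi> s x) (\<alpha> s y x c)"
proof (rule extensionalityI[of _ "v \<times> u"])
  show "orbit_sum_act G \<phi> \<alpha> v u s (single v u y x c) \<in> extensional (v \<times> u)"
    by (simp add: orbit_sum_act_def)
  show "single v u (\<phi> s y) (\<phi> s x) (\<alpha> s y x c) \<in> extensional (v \<times> u)"
    by (simp add: dsum_inj_def)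
  fix p assume "p \<in> v \<times> u"
  then obtain b a where p: "p = (b, a)" "b \<in> v" "a \<in> u" by blast
  have si: "inv\<^bsub>G\<^esub> s \<in> carrier G" using s by simp
  define b' a' where "b' = \<phi> (inv\<^bsub>G\<^esub> s) b" and "a' = \<phi> (inv\<^bsub>G\<^esub> s) a"
  have ba: "b' \<in> v" "a' \<in> u" "\<phi> s b' = b" "\<phi> s a' = a"
    using p pair_act_closed si pair_objects s by (auto simp: b'_def a'_def obj_act_inv)
  have iff: "(b' = y) = (b = \<phi> s y)" "(a' = x) = (a = \<phi> s x)"
    using s y x pair_objects ba by (auto simp: b'_def a'_def obj_act_inv)
  have "\<alpha> s b' a' \<zero>\<^bsub>Mor C b' a'\<^esub> = \<zero>\<^bsub>Mor C b a\<^esub>"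
    using klinear_zero[OF Mor_module Mor_module act_linear[OF s]] ba s pair_objects obj_act_closed
    by metis
  then show "orbit_sum_act G \<phi> \<alpha> v u s (single v u y x c) p
      = single v u (\<phi> s y) (\<phi> s x) (\<alpha> s y x c) p"
    using p ba iff
    by (auto simp: orbit_sum_act_def Let_def dsum_inj_def b'_def[symmetric] a'_def[symmetric])
qed

lemma orbit_sum_act_linear:
  assumes s: "s \<in> carrier G"
  shows "klinear K (orbit_sum C v u) (orbit_sum C v u) (orbit_sum_act G \<phi> \<alpha> v u s)"
proof -
  let ?t = "inv\<^bsub>G\<^esub> s"
  let ?\<sigma> = "\<lambda>(y, x). (\<phi> ?t y, \<phi> ?t x)" and ?F = "\<lambda>(y, x). \<alpha> s (\<phi> ?t y) (\<phi> ?t x)"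
  have t: "?t \<in> carrier G" using s by simp
  have "klinear K (orbit_sum C v u) (orbit_sum C v u) (\<lambda>f. \<lambda>i\<in>v \<times> u. ?F i (f (?\<sigma> i)))"
  proof (rule osum.dsum_reindex_map_linear)
    show "?\<sigma> \<in> v \<times> u \<rightarrow> v \<times> u" using t pair_act_closed by auto
    show "inj_on ?\<sigma> (v \<times> u)"
      using inj_prop[OF t] pair_objects by (auto simp: inj_on_def)
    show "klinear K (case ?\<sigma> i of (y, x) \<Rightarrow> Mor C y x) (case i of (y, x) \<Rightarrow> Mor C y x) (?F i)"
      if i: "i \<in> v \<times> u" for i
    proof -
      obtain y x where yx: "i = (y, x)" "y \<in> Obj C" "x \<in> Obj C" using i pair_objects by auto
      show ?thesis
        using act_linear[OF s obj_act_closed[OF t yx(3)] obj_act_closed[OF t yx(2)]]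
        by (simp add: yx obj_act_inv s)
    qed
  qed
  then show ?thesis by (simp add: orbit_sum_act_def[abs_def] Let_def case_prod_unfold)
qed

sublocale act: linear_action G K "orbit_sum C v u" "orbit_sum_act G \<phi> \<alpha> v u"
  rewrites "aug_submodule K G (orbit_sum C v u) (orbit_sum_act G \<phi> \<alpha> v u) = orbit_ker K C G \<phi> \<alpha> v u"
proof -
  show "linear_action G K (orbit_sum C v u) (orbit_sum_act G \<phi> \<alpha> v u)"
  proof (intro linear_action.intro linear_action_axioms.intro orbit_sum_act_linear)
    fix f assume f: "f \<in> carrier (orbit_sum C v u)"
    show "orbit_sum_act G \<phi> \<alpha> v u \<one>\<^bsub>G\<^esub> f = f"
    proof (rule osum.dsum_eqI)
      show "orbit_sum_act G \<phi> \<alpha> v u \<one>\<^bsub>G\<^esub> f \<in> carrier (orbit_sum C v u)"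
        by (rule klinear_closed[OF orbit_sum_act_linear f]) simp
      fix p assume "p \<in> v \<times> u"
      then show "orbit_sum_act G \<phi> \<alpha> v u \<one>\<^bsub>G\<^esub> f p = f p"
        using osum.dsum_apply_closed[OF f, of p]
        by (auto simp: orbit_sum_act_def obj_act_one pair_objects act_one)
    qed (rule f)
  qed (rule G.group_axioms osum.dsum.module_axioms field_axioms | assumption)+
qed (simp add: orbit_ker_def)

lemma quot_Mor_module: "module K (Mor quot_cat v u)"
  unfolding quot_cat_simps by (rule act.coinv.quot_is_module)

lemma quot_class_linear: "klinear K (orbit_sum C v u) (Mor quot_cat v u) (quot_class v u)"
  unfolding quot_cat_simps orbit_class_def by (rule act.coinv.coset_linear)

lemma quot_class_act:
  "\<lbrakk>s \<in> carrier G; f \<in> carrier (orbit_sum C v u)\<rbrakk>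
    \<Longrightarrow> quot_class v u (orbit_sum_act G \<phi> \<alpha> v u s f) = quot_class v u f"
  unfolding orbit_class_def by (rule act.act_coset)

lemma quot_MorE:
  assumes "D \<in> carrier (Mor quot_cat v u)"
  obtains f where "f \<in> carrier (orbit_sum C v u)" "D = quot_class v u f"
  using assms unfolding quot_cat_simps act.coinv.quot_carrier orbit_class_def by blast

text \<open>
  The structure of the quotient category is defined by unions over all members of a class. Such a
  union is a union of copies of one coset when all members of the class give the same coset, and
  this is how that is established.
\<close>

lemma invariant_const_on_class:
  assumes "module K W" "klinear K (orbit_sum C v u) W F"
    and "\<And>s f. \<lbrakk>s \<in> carrier G; f \<in> carrier (orbit_sum C v u)\<rbrakk>
      \<Longrightarrow> F (orbit_sum_act G \<phi> \<alpha> v u s f) = F f"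
    and "f \<in> carrier (orbit_sum C v u)" "g \<in> quot_class v u f"
  shows "F g = F f"
proof (rule act.coinv.klinear_const_on_coset[OF assms(1,2)])
  show "F n = \<zero>\<^bsub>W\<^esub>" if "n \<in> orbit_ker K C G \<phi> \<alpha> v u" for n
    by (rule act.invariant_kills_augmentation[OF assms(1-3) that])
qed (use assms(4,5) in \<open>simp_all add: orbit_class_def\<close>)

lemma klinear_from_class:
  assumes F: "klinear K (orbit_sum C v u) W F"
    and S: "\<And>f. f \<in> carrier (orbit_sum C v u) \<Longrightarrow> S (quot_class v u f) = F f"
  shows "klinear K (Mor quot_cat v u) W S"
proof (rule klinearI)
  fix D D' a assume "D \<in> carrier (Mor quot_cat v u)"
  then obtain f where f: "f \<in> carrier (orbit_sum C v u)" "D = quot_class v u f" by (rule quot_MorE)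
  show "S D \<in> carrier W" using klinear_closed[OF F f(1)] by (simp add: f S)
  show "S (D \<oplus>\<^bsub>Mor quot_cat v u\<^esub> D') = S D \<oplus>\<^bsub>W\<^esub> S D'" if D': "D' \<in> carrier (Mor quot_cat v u)"
  proof -
    obtain g where "g \<in> carrier (orbit_sum C v u)" "D' = quot_class v u g"
      using quot_MorE[OF D'] by blast
    then show ?thesis
      using f by (simp add: klinear_add[OF quot_class_linear, symmetric] S klinear_add[OF F])
  qed
  show "S (a \<odot>\<^bsub>Mor quot_cat v u\<^esub> D) = a \<odot>\<^bsub>W\<^esub> S D" if a: "a \<in> carrier K"
    using f a by (simp add: klinear_smult[OF quot_class_linear, symmetric] S klinear_smult[OF F])
qed

lemma class_self: "f \<in> carrier (orbit_sum C v u) \<Longrightarrow> f \<in> quot_class v u f"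
  unfolding orbit_class_def by (rule act.coinv.coset_self)

lemma class_sub: "\<lbrakk>f \<in> carrier (orbit_sum C v u); g \<in> quot_class v u f\<rbrakk> \<Longrightarrow> g \<in> carrier (orbit_sum C v u)"
  unfolding orbit_class_def by (rule act.coinv.coset_carrier)

text \<open>
  A morphism \<open>c : x \<rightarrow> y\<close> and all its translates have the same class in the quotient. Hence the
  classes of morphisms whose source is one fixed member of the orbit \<open>u\<close> already generate the
  morphism space from \<open>u\<close> to \<open>v\<close>. This is what makes two classes composable in \<open>C\<close>.
\<close>

definition mor_class :: "'o \<Rightarrow> 'o \<Rightarrow> 'm \<Rightarrow> ('o \<times> 'o \<Rightarrow> 'm) set" where
  "mor_class y x c = quot_class v u (single v u y x c)"

lemma mor_class_linear:
  "\<lbrakk>y \<in> v; x \<in> u\<rbrakk> \<Longrightarrow> klinear K (Mor C y x) (Mor quot_cat v u) (mor_class y x)"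
  unfolding mor_class_def by (rule klinear_compose[OF single_linear quot_class_linear])

lemma mor_class_closed:
  "\<lbrakk>y \<in> v; x \<in> u; c \<in> carrier (Mor C y x)\<rbrakk> \<Longrightarrow> mor_class y x c \<in> carrier (Mor quot_cat v u)"
  by (rule klinear_closed[OF mor_class_linear])

lemma mor_class_act:
  "\<lbrakk>s \<in> carrier G; y \<in> v; x \<in> u; c \<in> carrier (Mor C y x)\<rbrakk>
    \<Longrightarrow> mor_class (\<phi> s y) (\<phi> s x) (\<alpha> s y x c) = mor_class y x c"
  using quot_class_act[OF _ single_closed, of s y x c] by (simp add: mor_class_def act_single)

lemma klinear_eq_on_classes:
  assumes "module K W" "klinear K (Mor quot_cat v u) W S" "klinear K (Mor quot_cat v u) W T"
    and "\<And>y x c. \<lbrakk>y \<in> v; x \<in> u; c \<in> carrier (Mor C y x)\<rbrakk>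
      \<Longrightarrow> S (mor_class y x c) = T (mor_class y x c)"
    and "D \<in> carrier (Mor quot_cat v u)"
  shows "S D = T D"
proof -
  obtain f where f: "f \<in> carrier (orbit_sum C v u)" "D = quot_class v u f"
    using quot_MorE[OF assms(5)] by blast
  have "S (quot_class v u f) = T (quot_class v u f)"
    by (rule osum.klinear_eq_on_dsum[OF assms(1) klinear_compose[OF quot_class_linear assms(2)]
          klinear_compose[OF quot_class_linear assms(3)] _ f(1)])
      (use assms(4) in \<open>auto simp: mor_class_def\<close>)
  then show ?thesis by (simp only: f(2))
qed

lemma klinear_eq_on_classes_source:
  assumes "module K W" "klinear K (Mor quot_cat v u) W S" "klinear K (Mor quot_cat v u) W T"
    and x0: "x0 \<in> u"
    and eq: "\<And>y c. \<lbrakk>y \<in> v; c \<in> carrier (Mor C y x0)\<rbrakk> \<Longrightarrow> S (mor_class y x0 c) = T (mor_class y x0 c)"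
    and D: "D \<in> carrier (Mor quot_cat v u)"
  shows "S D = T D"
proof (rule klinear_eq_on_classes[OF assms(1-3) _ D])
  fix y x c assume y: "y \<in> v" and x: "x \<in> u" and c: "c \<in> carrier (Mor C y x)"
  obtain s where s: "s \<in> carrier G" "\<phi> s x = x0" using orbit_transport[OF u x x0] by blast
  have "\<alpha> s y x c \<in> carrier (Mor C (\<phi> s y) x0)"
    using act_closed[OF s(1) pair_objects(2)[OF x] pair_objects(1)[OF y] c] by (simp add: s(2))
  then have "S (mor_class (\<phi> s y) x0 (\<alpha> s y x c)) = T (mor_class (\<phi> s y) x0 (\<alpha> s y x c))"
    by (rule eq[OF pair_act_closed(1)[OF y s(1)]])
  then show "S (mor_class y x c) = T (mor_class y x c)"
    using mor_class_act[OF s(1) y x c] by (simp add: s(2))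
qed

text \<open>
  Since the action on objects is free, the coinvariants contain a copy of each \<open>Mor C y x\<close>: the
  sum of the components at the translates of \<open>(y, x)\<close>, moved back to \<open>(y, x)\<close>, is an invariant
  linear map that restricts to the identity.
\<close>

lemma mor_class_inj:
  assumes y0: "y0 \<in> v" and x0: "x0 \<in> u" and c0: "c0 \<in> carrier (Mor C y0 x0)"
    and zero: "mor_class y0 x0 c0 = \<zero>\<^bsub>Mor quot_cat v u\<^esub>"
  shows "c0 = \<zero>\<^bsub>Mor C y0 x0\<^esub>"
proof -
  define t where "t x = (THE s. s \<in> carrier G \<and> \<phi> s x0 = x)" for x
  have t: "t x \<in> carrier G" "\<phi> (t x) x0 = x" if x: "x \<in> u" for x
  proof -
    obtain s where s: "s \<in> carrier G" "\<phi> s x0 = x" using orbit_transport[OF u x0 x] by blast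
    then have "t x = s" unfolding t_def using pair_objects x0 by (intro the_transporter) auto
    then show "t x \<in> carrier G" "\<phi> (t x) x0 = x" using s by auto
  qed
  have t_act: "t (\<phi> s x) = s \<otimes>\<^bsub>G\<^esub> t x" if "s \<in> carrier G" "x \<in> u" for s x
    unfolding t_def[of "\<phi> s x"] using that t[OF that(2)] x0 pair_objects
    by (intro the_transporter) (auto simp: composition_rule)
  have t0: "t x0 = \<one>\<^bsub>G\<^esub>"
    unfolding t_def using x0 pair_objects by (intro the_transporter) (auto simp: obj_act_one)
  let ?W = "Mor C y0 x0"
  have Wm: "module K ?W" using x0 y0 pair_objects by (intro Mor_module) auto
  define F where "F = (\<lambda>(y, x) c. if \<phi> (t x) y0 = y then \<alpha> (inv\<^bsub>G\<^esub> (t x)) y x c else \<zero>\<^bsub>?W\<^esub>)"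
  have F: "klinear K (case p of (y, x) \<Rightarrow> Mor C y x) ?W (F p)" if "p \<in> v \<times> u" for p
  proof -
    obtain y x where p: "p = (y, x)" "y \<in> v" "x \<in> u" using \<open>p \<in> v \<times> u\<close> by blast
    show ?thesis
    proof (cases "\<phi> (t x) y0 = y")
      case True
      have "\<phi> (inv\<^bsub>G\<^esub> (t x)) x = x0" "\<phi> (inv\<^bsub>G\<^esub> (t x)) y = y0"
        using t[OF p(3)] True x0 y0 pair_objects obj_act_inv by metis+
      then have "klinear K (Mor C y x) ?W (\<alpha> (inv\<^bsub>G\<^esub> (t x)) y x)"
        using act_linear[of "inv\<^bsub>G\<^esub> (t x)" x y] t[OF p(3)] p pair_objects by simp
      then show ?thesis using True by (simp add: F_def p)
    next
      case False
      then show ?thesis using klinear_zero_fun[OF Wm] by (simp add: F_def p)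
    qed
  qed
  let ?L = "dsum_lift (v \<times> u) (\<lambda>(y, x). Mor C y x) ?W F"
  have L: "klinear K (orbit_sum C v u) ?W ?L" by (rule osum.dsum_lift_linear[OF Wm F])
  have L_single: "?L (single v u y x c) = F (y, x) c"
    if "y \<in> v" "x \<in> u" "c \<in> carrier (Mor C y x)" for y x c
    using osum.dsum_lift_inj[OF Wm F, of "(y, x)" c] that by simp
  have inv: "?L (orbit_sum_act G \<phi> \<alpha> v u s f) = ?L f"
    if s: "s \<in> carrier G" and f: "f \<in> carrier (orbit_sum C v u)" for s f
  proof (rule osum.klinear_eq_on_dsum[OF Wm klinear_compose[OF orbit_sum_act_linear[OF s] L] L _ f])
    fix p c assume "p \<in> v \<times> u" and c: "c \<in> carrier (case p of (y, x) \<Rightarrow> Mor C y x)"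
    then obtain y x where p: "p = (y, x)" "y \<in> v" "x \<in> u" by blast
    have yx: "y \<in> Obj C" "x \<in> Obj C" "y0 \<in> Obj C" using p y0 pair_objects by auto
    have c': "c \<in> carrier (Mor C y x)" using c p by simp
    have "(\<phi> (s \<otimes>\<^bsub>G\<^esub> t x) y0 = \<phi> s y) = (\<phi> (t x) y0 = y)"
      using s t[OF p(3)] yx obj_act_inv(1)[of s] obj_act_closed by (metis composition_rule)
    moreover have "\<alpha> (inv\<^bsub>G\<^esub> (s \<otimes>\<^bsub>G\<^esub> t x)) (\<phi> s y) (\<phi> s x) (\<alpha> s y x c) = \<alpha> (inv\<^bsub>G\<^esub> (t x)) y x c"
      using s t[OF p(3)] yx c' by (simp add: act_mult G.inv_mult_group G.m_assoc)
    ultimately have "F (\<phi> s y, \<phi> s x) (\<alpha> s y x c) = F (y, x) c"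
      using s p by (simp add: F_def t_act)
    then show "?L (orbit_sum_act G \<phi> \<alpha> v u s (dsum_inj (v \<times> u) (\<lambda>(y, x). Mor C y x) p c))
        = ?L (dsum_inj (v \<times> u) (\<lambda>(y, x). Mor C y x) p c)"
      using s p c' yx by (simp add: act_single L_single pair_act_closed act_closed)
  qed
  have zc: "\<zero>\<^bsub>orbit_sum C v u\<^esub> \<in> carrier (orbit_sum C v u)" by simp
  have mem: "single v u y0 x0 c0 \<in> quot_class v u \<zero>\<^bsub>orbit_sum C v u\<^esub>"
    using class_self[OF single_closed[OF y0 x0 c0]] zero
      klinear_zero[OF osum.dsum.module_axioms quot_Mor_module quot_class_linear]
    by (simp add: mor_class_def)
  have "?L (single v u y0 x0 c0) = ?L \<zero>\<^bsub>orbit_sum C v u\<^esub>"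
    by (rule invariant_const_on_class[OF Wm L _ zc mem]) (rule inv)
  also have "\<dots> = \<zero>\<^bsub>?W\<^esub>" by (rule klinear_zero[OF osum.dsum.module_axioms Wm L])
  finally have "F (y0, x0) c0 = \<zero>\<^bsub>?W\<^esub>"
    by (simp only: L_single[OF y0 x0 c0])
  then show ?thesis
    using y0 x0 c0 pair_objects by (simp add: F_def t0 obj_act_one act_one)
qed

end

section \<open>The quotient category\<close>

locale orbit_triple = free_action K C G \<phi> \<alpha>
  for K :: "'k ring" and C :: "('o, 'm, 'k) kcat" and G :: "'g monoid" and \<phi> \<alpha> +
  fixes w v u :: "'o set"
  assumes orbits: "w \<in> orbits G (Obj C) \<phi>" "v \<in> orbits G (Obj C) \<phi>" "u \<in> orbits G (Obj C) \<phi>"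
begin

sublocale wv: orbit_pair K C G \<phi> \<alpha> w v by unfold_locales (rule orbits)+
sublocale vu: orbit_pair K C G \<phi> \<alpha> v u by unfold_locales (rule orbits)+
sublocale wu: orbit_pair K C G \<phi> \<alpha> w u by unfold_locales (rule orbits)+

text \<open>
  The term that a component \<open>d\<close> at \<open>(z, y')\<close> and a component \<open>c\<close> at \<open>(y, x)\<close> contribute to the
  composite: \<open>d\<close> is moved by the group element \<open>s\<close> that makes the two composable.
\<close>

definition summand :: "'o \<times> 'o \<Rightarrow> 'o \<times> 'o \<Rightarrow> 'm \<Rightarrow> 'm \<Rightarrow> 'o \<times> 'o \<Rightarrow> 'm" where
  "summand = (\<lambda>(z, y') (y, x) d c.
     let s = (THE s. s \<in> carrier G \<and> \<phi> s y' = y) in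
       single w u (\<phi> s z) x (Comp C (\<phi> s z) y x (\<alpha> s z y' d) c))"

lemma summand_eq:
  assumes "y' \<in> v" "s \<in> carrier G" "\<phi> s y' = y"
  shows "summand (z, y') (y, x) d c = single w u (\<phi> s z) x (Comp C (\<phi> s z) y x (\<alpha> s z y' d) c)"
  using the_transporter[OF assms(2) vu.pair_objects(1)[OF assms(1)] assms(3)]
  by (simp add: summand_def)

sublocale comp: component_pairing K "w \<times> v" "\<lambda>(z, y'). Mor C z y'"
  "v \<times> u" "\<lambda>(y, x). Mor C y x" "orbit_sum C w u" summand
  rewrites "dsum (w \<times> v) (\<lambda>(z, y'). Mor C z y') = orbit_sum C w v"
    and "dsum (v \<times> u) (\<lambda>(y, x). Mor C y x) = orbit_sum C v u"
proof -
  show "component_pairing K (w \<times> v) (\<lambda>(z, y'). Mor C z y')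
      (v \<times> u) (\<lambda>(y, x). Mor C y x) (orbit_sum C w u) summand"
  proof (intro component_pairing.intro component_pairing_axioms.intro)
    fix p q c assume "p \<in> w \<times> v" "q \<in> v \<times> u" and c0: "c \<in> carrier (case q of (y, x) \<Rightarrow> Mor C y x)"
    then obtain z y' y x where p: "p = (z, y')" "z \<in> w" "y' \<in> v" and q: "q = (y, x)" "y \<in> v" "x \<in> u"
      by blast
    have c: "c \<in> carrier (Mor C y x)" using c0 q by simp
    note ob = wv.pair_objects(1)[OF p(2)] vu.pair_objects(1)[OF p(3)]
      vu.pair_objects(1)[OF q(2)] vu.pair_objects(2)[OF q(3)]
    obtain s where s: "s \<in> carrier G" "\<phi> s y' = y"
      using orbit_transport[OF orbits(2) p(3) q(2)] by blast
    have sz: "\<phi> s z \<in> w" "\<phi> s z \<in> Obj C" using wv.pair_act_closed p s ob obj_act_closed by auto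
    have "klinear K (Mor C z y') (orbit_sum C w u)
        (\<lambda>d. single w u (\<phi> s z) x (Comp C (\<phi> s z) y x (\<alpha> s z y' d) c))"
      using act_linear[OF s(1) ob(2) ob(1)] unfolding s(2)
      by (rule klinear_compose[OF klinear_compose[OF _ Comp_linear_left[OF ob(4,3) sz(2) c]]
            wu.single_linear[OF sz(1) q(3)]])
    then show "klinear K (case p of (z, y') \<Rightarrow> Mor C z y') (orbit_sum C w u) (\<lambda>d. summand p q d c)"
      using p q by (simp add: summand_eq[OF p(3) s])
  next
    fix p q d assume "p \<in> w \<times> v" "q \<in> v \<times> u" and d0: "d \<in> carrier (case p of (z, y') \<Rightarrow> Mor C z y')"
    then obtain z y' y x where p: "p = (z, y')" "z \<in> w" "y' \<in> v" and q: "q = (y, x)" "y \<in> v" "x \<in> u"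
      by blast
    have d: "d \<in> carrier (Mor C z y')" using d0 p by simp
    note ob = wv.pair_objects(1)[OF p(2)] vu.pair_objects(1)[OF p(3)]
      vu.pair_objects(1)[OF q(2)] vu.pair_objects(2)[OF q(3)]
    obtain s where s: "s \<in> carrier G" "\<phi> s y' = y"
      using orbit_transport[OF orbits(2) p(3) q(2)] by blast
    have sz: "\<phi> s z \<in> w" "\<phi> s z \<in> Obj C" using wv.pair_act_closed p s ob obj_act_closed by auto
    have sd: "\<alpha> s z y' d \<in> carrier (Mor C (\<phi> s z) y)"
      using act_closed[OF s(1) ob(2,1) d] by (simp add: s(2))
    have "klinear K (Mor C y x) (orbit_sum C w u)
        (\<lambda>c. single w u (\<phi> s z) x (Comp C (\<phi> s z) y x (\<alpha> s z y' d) c))"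
      by (rule klinear_compose[OF Comp_linear_right[OF ob(4,3) sz(2) sd] wu.single_linear[OF sz(1) q(3)]])
    moreover have "summand p q d = (\<lambda>c. single w u (\<phi> s z) x (Comp C (\<phi> s z) y x (\<alpha> s z y' d) c))"
      by (rule ext) (simp add: p(1) q(1) summand_eq[OF p(3) s])
    ultimately show "klinear K (case q of (y, x) \<Rightarrow> Mor C y x) (orbit_sum C w u) (summand p q d)"
      by (simp add: q(1))
  qed (rule wv.osum.module_family_axioms vu.osum.module_family_axioms wu.osum.dsum.module_axioms)+
qed (simp_all add: orbit_sum_def)

lemma orbit_comp_eq: "orbit_comp C G \<phi> \<alpha> w v u g f = comp.pairing g f"
  unfolding orbit_comp_def comp.pairing_def by (simp add: summand_def case_prod_unfold)

lemma pairing_single: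
  assumes "z \<in> w" "y' \<in> v" "x \<in> u" "s \<in> carrier G"
    and "d \<in> carrier (Mor C z y')" "c \<in> carrier (Mor C (\<phi> s y') x)"
  shows "comp.pairing (single w v z y' d) (single v u (\<phi> s y') x c)
    = single w u (\<phi> s z) x (Comp C (\<phi> s z) (\<phi> s y') x (\<alpha> s z y' d) c)"
  using comp.pairing_inj[of "(z, y')" "(\<phi> s y', x)" d c] assms
  by (simp add: summand_eq vu.pair_act_closed)

text \<open>
  Translating the left factor by \<open>t\<close> replaces the transporter \<open>s\<close> by \<open>s t\<inverse>\<close> and does not change
  the composite; translating the right factor translates the composite.
\<close>

lemma pairing_act_left:
  assumes t: "t \<in> carrier G" and g: "g \<in> carrier (orbit_sum C w v)" and f: "f \<in> carrier (orbit_sum C v u)"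
  shows "comp.pairing (orbit_sum_act G \<phi> \<alpha> w v t g) f = comp.pairing g f"
proof (rule wv.osum.klinear_eq_on_dsum[OF wu.osum.dsum.module_axioms
      klinear_compose[OF wv.orbit_sum_act_linear[OF t] comp.pairing_linear_left[OF f]]
      comp.pairing_linear_left[OF f] _ g])
  fix p d assume "p \<in> w \<times> v" and d0: "d \<in> carrier (case p of (z, y') \<Rightarrow> Mor C z y')"
  then obtain z y' where p: "p = (z, y')" "z \<in> w" "y' \<in> v" and d: "d \<in> carrier (Mor C z y')" by auto
  note ob = wv.pair_objects(1)[OF p(2)] wv.pair_objects(2)[OF p(3)]
  have td: "\<alpha> t z y' d \<in> carrier (Mor C (\<phi> t z) (\<phi> t y'))" by (rule act_closed[OF t ob(2,1) d])
  have tp: "\<phi> t z \<in> w" "\<phi> t y' \<in> v" using p t wv.pair_act_closed by auto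
  have "comp.pairing (single w v (\<phi> t z) (\<phi> t y') (\<alpha> t z y' d)) f = comp.pairing (single w v z y' d) f"
  proof (rule vu.osum.klinear_eq_on_dsum[OF wu.osum.dsum.module_axioms
        comp.pairing_linear_right[OF wv.single_closed[OF tp td]]
        comp.pairing_linear_right[OF wv.single_closed[OF p(2,3) d]] _ f])
    fix q c assume "q \<in> v \<times> u" and c0: "c \<in> carrier (case q of (y, x) \<Rightarrow> Mor C y x)"
    then obtain y x where q: "q = (y, x)" "y \<in> v" "x \<in> u" and c: "c \<in> carrier (Mor C y x)" by auto
    obtain s where s: "s \<in> carrier G" "\<phi> s y' = y"
      using orbit_transport[OF orbits(2) p(3) q(2)] by blast
    let ?r = "s \<otimes>\<^bsub>G\<^esub> inv\<^bsub>G\<^esub> t"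
    have r: "?r \<in> carrier G" "?r \<otimes>\<^bsub>G\<^esub> t = s" using s t by (simp_all add: G.m_assoc)
    have rt: "\<phi> ?r (\<phi> t y') = y" "\<phi> ?r (\<phi> t z) = \<phi> s z"
      using composition_rule[OF ob(2) r(1) t] composition_rule[OF ob(1) r(1) t] r s by auto
    have ra: "\<alpha> ?r (\<phi> t z) (\<phi> t y') (\<alpha> t z y' d) = \<alpha> s z y' d"
      using act_mult[OF r(1) t ob(2,1) d] r(2) by simp
    show "comp.pairing (single w v (\<phi> t z) (\<phi> t y') (\<alpha> t z y' d))
          (dsum_inj (v \<times> u) (\<lambda>(y, x). Mor C y x) q c)
        = comp.pairing (single w v z y' d) (dsum_inj (v \<times> u) (\<lambda>(y, x). Mor C y x) q c)"
      using pairing_single[OF tp q(3) r(1) td, of c] pairing_single[OF p(2,3) q(3) s(1) d, of c] c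
      by (simp add: q(1) rt ra s(2))
  qed
  then show "comp.pairing (orbit_sum_act G \<phi> \<alpha> w v t (dsum_inj (w \<times> v) (\<lambda>(z, y'). Mor C z y') p d)) f
      = comp.pairing (dsum_inj (w \<times> v) (\<lambda>(z, y'). Mor C z y') p d) f"
    by (simp add: p(1) wv.act_single[OF t p(2,3) d])
qed

lemma pairing_act_right:
  assumes t: "t \<in> carrier G" and g: "g \<in> carrier (orbit_sum C w v)" and f: "f \<in> carrier (orbit_sum C v u)"
  shows "comp.pairing g (orbit_sum_act G \<phi> \<alpha> v u t f) = orbit_sum_act G \<phi> \<alpha> w u t (comp.pairing g f)"
proof (rule vu.osum.klinear_eq_on_dsum[OF wu.osum.dsum.module_axioms
      klinear_compose[OF vu.orbit_sum_act_linear[OF t] comp.pairing_linear_right[OF g]]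
      klinear_compose[OF comp.pairing_linear_right[OF g] wu.orbit_sum_act_linear[OF t]] _ f])
  fix q c assume "q \<in> v \<times> u" and c0: "c \<in> carrier (case q of (y, x) \<Rightarrow> Mor C y x)"
  then obtain y x where q: "q = (y, x)" "y \<in> v" "x \<in> u" and c: "c \<in> carrier (Mor C y x)" by auto
  note obq = vu.pair_objects(1)[OF q(2)] vu.pair_objects(2)[OF q(3)]
  have tc: "\<alpha> t y x c \<in> carrier (Mor C (\<phi> t y) (\<phi> t x))" by (rule act_closed[OF t obq(2,1) c])
  have tq: "\<phi> t y \<in> v" "\<phi> t x \<in> u" using q t vu.pair_act_closed by auto
  have "comp.pairing g (single v u (\<phi> t y) (\<phi> t x) (\<alpha> t y x c))
      = orbit_sum_act G \<phi> \<alpha> w u t (comp.pairing g (single v u y x c))"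
  proof (rule wv.osum.klinear_eq_on_dsum[OF wu.osum.dsum.module_axioms
        comp.pairing_linear_left[OF vu.single_closed[OF tq tc]]
        klinear_compose[OF comp.pairing_linear_left[OF vu.single_closed[OF q(2,3) c]]
          wu.orbit_sum_act_linear[OF t]] _ g])
    fix p d assume "p \<in> w \<times> v" and d0: "d \<in> carrier (case p of (z, y') \<Rightarrow> Mor C z y')"
    then obtain z y' where p: "p = (z, y')" "z \<in> w" "y' \<in> v" and d: "d \<in> carrier (Mor C z y')" by auto
    note ob = wv.pair_objects(1)[OF p(2)] wv.pair_objects(2)[OF p(3)]
    obtain s where s: "s \<in> carrier G" "\<phi> s y' = y"
      using orbit_transport[OF orbits(2) p(3) q(2)] by blast
    have ts: "t \<otimes>\<^bsub>G\<^esub> s \<in> carrier G" "\<phi> (t \<otimes>\<^bsub>G\<^esub> s) y' = \<phi> t y" "\<phi> (t \<otimes>\<^bsub>G\<^esub> s) z = \<phi> t (\<phi> s z)"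
      using s t composition_rule[OF _ t s(1)] ob by auto
    have sd: "\<alpha> s z y' d \<in> carrier (Mor C (\<phi> s z) y)"
      using act_closed[OF s(1) ob(2,1) d] by (simp add: s(2))
    have sz: "\<phi> s z \<in> w" "\<phi> s z \<in> Obj C" using wv.pair_act_closed p s ob obj_act_closed by auto
    have tsd: "\<alpha> (t \<otimes>\<^bsub>G\<^esub> s) z y' d = \<alpha> t (\<phi> s z) y (\<alpha> s z y' d)"
      using act_mult[OF t s(1) ob(2,1) d] by (simp add: s(2))
    have "comp.pairing (single w v z y' d) (single v u (\<phi> t y) (\<phi> t x) (\<alpha> t y x c))
        = single w u (\<phi> t (\<phi> s z)) (\<phi> t x)
            (Comp C (\<phi> t (\<phi> s z)) (\<phi> t y) (\<phi> t x) (\<alpha> t (\<phi> s z) y (\<alpha> s z y' d)) (\<alpha> t y x c))"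
      using pairing_single[OF p(2,3) tq(2) ts(1) d, of "\<alpha> t y x c"] tc
      by (simp add: ts(2,3) tsd)
    also have "\<dots> = single w u (\<phi> t (\<phi> s z)) (\<phi> t x) (\<alpha> t (\<phi> s z) x (Comp C (\<phi> s z) y x (\<alpha> s z y' d) c))"
      by (simp only: act_Comp[OF t obq(2,1) sz(2) c sd])
    also have "\<dots> = orbit_sum_act G \<phi> \<alpha> w u t (single w u (\<phi> s z) x (Comp C (\<phi> s z) y x (\<alpha> s z y' d) c))"
      by (rule wu.act_single[symmetric, OF t sz(1) q(3) Comp_closed[OF obq(2,1) sz(2) sd c]])
    also have "\<dots> = orbit_sum_act G \<phi> \<alpha> w u t (comp.pairing (single w v z y' d) (single v u y x c))"
      using pairing_single[OF p(2,3) q(3) s(1) d, of c] c by (simp add: s(2))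
    finally show "comp.pairing (dsum_inj (w \<times> v) (\<lambda>(z, y'). Mor C z y') p d)
          (single v u (\<phi> t y) (\<phi> t x) (\<alpha> t y x c))
        = orbit_sum_act G \<phi> \<alpha> w u t (comp.pairing (dsum_inj (w \<times> v) (\<lambda>(z, y'). Mor C z y') p d)
            (single v u y x c))"
      by (simp add: p(1))
  qed
  then show "comp.pairing g (orbit_sum_act G \<phi> \<alpha> v u t (dsum_inj (v \<times> u) (\<lambda>(y, x). Mor C y x) q c))
      = orbit_sum_act G \<phi> \<alpha> w u t (comp.pairing g (dsum_inj (v \<times> u) (\<lambda>(y, x). Mor C y x) q c))"
    by (simp add: q(1) vu.act_single[OF t q(2,3) c])
qed

lemma quot_Comp_class:
  assumes g: "g \<in> carrier (orbit_sum C w v)" and f: "f \<in> carrier (orbit_sum C v u)"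
  shows "Comp quot_cat w v u (quot_class w v g) (quot_class v u f) = quot_class w u (comp.pairing g f)"
proof -
  have left: "quot_class w u (comp.pairing g' f') = quot_class w u (comp.pairing g f')"
    if "g' \<in> quot_class w v g" "f' \<in> carrier (orbit_sum C v u)" for g' f'
    by (rule wv.invariant_const_on_class[OF wu.quot_Mor_module
          klinear_compose[OF comp.pairing_linear_left[OF that(2)] wu.quot_class_linear] _ g that(1)])
      (simp add: pairing_act_left that(2))
  have right: "quot_class w u (comp.pairing g f') = quot_class w u (comp.pairing g f)"
    if "f' \<in> quot_class v u f" for f'
    by (rule vu.invariant_const_on_class[OF wu.quot_Mor_module
          klinear_compose[OF comp.pairing_linear_right[OF g] wu.quot_class_linear] _ f that])
      (simp add: pairing_act_right g wu.quot_class_act klinear_closed[OF comp.pairing_linear_right[OF g]])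
  have "Comp quot_cat w v u (quot_class w v g) (quot_class v u f)
      = (\<Union>g'\<in>quot_class w v g. \<Union>f'\<in>quot_class v u f. quot_class w u (comp.pairing g' f'))"
    by (simp add: quotient_category_def orbit_comp_eq)
  also have "\<dots> = quot_class w u (comp.pairing g f)"
  proof (intro SUP_eq_const)
    show "quot_class w v g \<noteq> {}" "quot_class v u f \<noteq> {}"
      using wv.class_self[OF g] vu.class_self[OF f] by blast+
    show "quot_class w u (comp.pairing g' f') = quot_class w u (comp.pairing g f)"
      if "g' \<in> quot_class w v g" "f' \<in> quot_class v u f" for g' f'
      using left[OF that(1) vu.class_sub[OF f that(2)]] right[OF that(2)] by simp
  qed
  finally show ?thesis .
qed

lemma quot_Comp_linear_left:
  assumes "E \<in> carrier (Mor quot_cat v u)"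
  shows "klinear K (Mor quot_cat w v) (Mor quot_cat w u) (\<lambda>D. Comp quot_cat w v u D E)"
proof -
  obtain f where f: "f \<in> carrier (orbit_sum C v u)" "E = quot_class v u f"
    using vu.quot_MorE[OF assms] by blast
  show ?thesis
    by (rule wv.klinear_from_class[OF klinear_compose[OF comp.pairing_linear_left[OF f(1)]
            wu.quot_class_linear]]) (simp add: f quot_Comp_class)
qed

lemma quot_Comp_linear_right:
  assumes "D \<in> carrier (Mor quot_cat w v)"
  shows "klinear K (Mor quot_cat v u) (Mor quot_cat w u) (Comp quot_cat w v u D)"
proof -
  obtain g where g: "g \<in> carrier (orbit_sum C w v)" "D = quot_class w v g"
    using wv.quot_MorE[OF assms] by blast
  show ?thesis
    by (rule vu.klinear_from_class[OF klinear_compose[OF comp.pairing_linear_right[OF g(1)]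
            wu.quot_class_linear]]) (simp add: g quot_Comp_class)
qed

lemma quot_Comp_mor_class:
  assumes z: "z \<in> w" and y: "y \<in> v" and x: "x \<in> u"
    and d: "d \<in> carrier (Mor C z y)" and c: "c \<in> carrier (Mor C y x)"
  shows "Comp quot_cat w v u (wv.mor_class z y d) (vu.mor_class y x c) = wu.mor_class z x (Comp C z y x d c)"
proof -
  have ob: "z \<in> Obj C" "y \<in> Obj C" using wv.pair_objects z y by auto
  have "comp.pairing (single w v z y d) (single v u y x c) = single w u z x (Comp C z y x d c)"
    using pairing_single[OF z y x G.one_closed d, of c] c ob d
    by (simp add: obj_act_one act_one)
  then show ?thesis
    using quot_Comp_class[OF wv.single_closed[OF z y d] vu.single_closed[OF y x c]]
    by (simp add: wv.mor_class_def vu.mor_class_def wu.mor_class_def)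
qed

end

context free_action
begin

lemma quot_Idn:
  assumes u: "u \<in> orbits G (Obj C) \<phi>" and x: "x \<in> u"
  shows "Idn quot_cat u = orbit_pair.mor_class K C G \<phi> \<alpha> u u x x (Idn C x)"
proof -
  interpret uu: orbit_pair K C G \<phi> \<alpha> u u by unfold_locales (rule u)+
  have "Idn quot_cat u = (\<Union>y\<in>u. uu.mor_class y y (Idn C y))"
    by (simp add: quotient_category_def uu.mor_class_def)
  also have "\<dots> = uu.mor_class x x (Idn C x)"
  proof (intro SUP_eq_const)
    show "u \<noteq> {}" using x by blast
    fix y assume "y \<in> u"
    then obtain s where s: "s \<in> carrier G" "\<phi> s x = y" using orbit_transport[OF u x] by blast
    have xo: "x \<in> Obj C" by (rule uu.pair_objects(1)[OF x])
    show "uu.mor_class y y (Idn C y) = uu.mor_class x x (Idn C x)"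
      using uu.mor_class_act[OF s(1) x x Idn_closed[OF xo]] by (simp add: act_Idn s xo)
  qed
  finally show ?thesis .
qed

text \<open>
  Every equation among the axioms is one between multilinear maps, so it suffices to check it on
  classes of composable morphisms of \<open>C\<close>, where it is the corresponding axiom for \<open>C\<close>.
\<close>

proposition quotient_is_k_category: "k_category K quot_cat"
proof (intro k_category.intro k_category_axioms.intro field_axioms)
  let ?O = "Obj quot_cat"
  show "module K (Mor quot_cat v u)" if "u \<in> ?O" "v \<in> ?O" for u v
  proof -
    interpret orbit_pair K C G \<phi> \<alpha> v u using that by unfold_locales (simp_all add: quot_cat_simps)
    show ?thesis by (rule quot_Mor_module)
  qed
  show "Idn quot_cat u \<in> carrier (Mor quot_cat u u)" if "u \<in> ?O" for u
  proof -
    have u: "u \<in> orbits G (Obj C) \<phi>" using that by (simp add: quot_cat_simps)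
    interpret orbit_pair K C G \<phi> \<alpha> u u by unfold_locales (rule u)+
    obtain x where x: "x \<in> u" using orbit_nonempty[OF u] by blast
    show ?thesis
      unfolding quot_Idn[OF u x] using x pair_objects(1) by (intro mor_class_closed Idn_closed)
  qed
  show "klinear K (Mor quot_cat w v) (Mor quot_cat w u) (\<lambda>D. Comp quot_cat w v u D E)"
    if "u \<in> ?O" "v \<in> ?O" "w \<in> ?O" "E \<in> carrier (Mor quot_cat v u)" for u v w E
  proof -
    interpret orbit_triple K C G \<phi> \<alpha> w v u using that by unfold_locales (simp_all add: quot_cat_simps)
    show ?thesis by (rule quot_Comp_linear_left[OF that(4)])
  qed
  show "klinear K (Mor quot_cat v u) (Mor quot_cat w u) (Comp quot_cat w v u D)"
    if "u \<in> ?O" "v \<in> ?O" "w \<in> ?O" "D \<in> carrier (Mor quot_cat w v)" for u v w D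
  proof -
    interpret orbit_triple K C G \<phi> \<alpha> w v u using that by unfold_locales (simp_all add: quot_cat_simps)
    show ?thesis by (rule quot_Comp_linear_right[OF that(4)])
  qed
  show "Comp quot_cat t w u E (Comp quot_cat w v u D b) = Comp quot_cat t v u (Comp quot_cat t w v E D) b"
    if "u \<in> ?O" "v \<in> ?O" "w \<in> ?O" "t \<in> ?O"
      and b: "b \<in> carrier (Mor quot_cat v u)" and D: "D \<in> carrier (Mor quot_cat w v)"
      and E: "E \<in> carrier (Mor quot_cat t w)" for u v w t b D E
  proof -
    interpret wvu: orbit_triple K C G \<phi> \<alpha> w v u using that by unfold_locales (simp_all add: quot_cat_simps)
    interpret twu: orbit_triple K C G \<phi> \<alpha> t w u using that by unfold_locales (simp_all add: quot_cat_simps)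
    interpret tvu: orbit_triple K C G \<phi> \<alpha> t v u using that by unfold_locales (simp_all add: quot_cat_simps)
    interpret twv: orbit_triple K C G \<phi> \<alpha> t w v using that by unfold_locales (simp_all add: quot_cat_simps)
    note modW = twu.wu.quot_Mor_module
    have ED: "Comp quot_cat t w v E D \<in> carrier (Mor quot_cat t v)"
      by (rule klinear_closed[OF twv.quot_Comp_linear_left[OF D] E])
    (* Reduce b to the class of some c : x \<rightarrow> y, then D to that of some d : y \<rightarrow> z with the
       source y just found, and then E to that of some e : z \<rightarrow> q. *)
    show ?thesis
    proof (rule wvu.vu.klinear_eq_on_classes[OF modW
          klinear_compose[OF wvu.quot_Comp_linear_right[OF D] twu.quot_Comp_linear_right[OF E]]
          tvu.quot_Comp_linear_right[OF ED] _ b])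
      fix y x c assume y: "y \<in> v" and x: "x \<in> u" and c: "c \<in> carrier (Mor C y x)"
      note cc = wvu.vu.mor_class_closed[OF y x c]
      show "Comp quot_cat t w u E (Comp quot_cat w v u D (wvu.vu.mor_class y x c)) =
          Comp quot_cat t v u (Comp quot_cat t w v E D) (wvu.vu.mor_class y x c)"
      proof (rule wvu.wv.klinear_eq_on_classes_source[OF modW
            klinear_compose[OF wvu.quot_Comp_linear_left[OF cc] twu.quot_Comp_linear_right[OF E]]
            klinear_compose[OF twv.quot_Comp_linear_right[OF E] tvu.quot_Comp_linear_left[OF cc]] y _ D])
        fix z d assume z: "z \<in> w" and d: "d \<in> carrier (Mor C z y)"
        note dd = wvu.wv.mor_class_closed[OF z y d]
        have dc: "Comp C z y x d c \<in> carrier (Mor C z x)"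
          using x y z c d wvu.vu.pair_objects wvu.wv.pair_objects by (intro Comp_closed) auto
        note dcc = wvu.wu.mor_class_closed[OF z x dc]
        have "Comp quot_cat t w u E (wvu.wu.mor_class z x (Comp C z y x d c)) =
            Comp quot_cat t v u (Comp quot_cat t w v E (wvu.wv.mor_class z y d)) (wvu.vu.mor_class y x c)"
        proof (rule twu.wv.klinear_eq_on_classes_source[OF modW twu.quot_Comp_linear_left[OF dcc]
              klinear_compose[OF twv.quot_Comp_linear_left[OF dd] tvu.quot_Comp_linear_left[OF cc]] z _ E])
          fix q e assume q: "q \<in> t" and e: "e \<in> carrier (Mor C q z)"
          note ob = wvu.vu.pair_objects(2)[OF x] wvu.vu.pair_objects(1)[OF y]
            wvu.wv.pair_objects(1)[OF z] twu.wv.pair_objects(1)[OF q]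
          show "Comp quot_cat t w u (twu.wv.mor_class q z e) (wvu.wu.mor_class z x (Comp C z y x d c)) =
              Comp quot_cat t v u (Comp quot_cat t w v (twu.wv.mor_class q z e) (wvu.wv.mor_class z y d))
                (wvu.vu.mor_class y x c)"
            by (simp add: twu.quot_Comp_mor_class[OF q z x e dc] twv.quot_Comp_mor_class[OF q z y e d]
                tvu.quot_Comp_mor_class[OF q y x Comp_closed[OF ob(2,3,4) e d] c]
                Comp_assoc[OF ob c d e])
        qed
        then show "Comp quot_cat t w u E (Comp quot_cat w v u (wvu.wv.mor_class z y d) (wvu.vu.mor_class y x c)) =
            Comp quot_cat t v u (Comp quot_cat t w v E (wvu.wv.mor_class z y d)) (wvu.vu.mor_class y x c)"
          by (simp add: wvu.quot_Comp_mor_class[OF z y x d c])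
      qed
    qed
  qed
  have id_linear: "klinear K V V (\<lambda>x. x)" for V :: "('k, 'z) module" by (simp add: klinear_def)
  show "Comp quot_cat v v u (Idn quot_cat v) b = b"
    if "u \<in> ?O" "v \<in> ?O" "b \<in> carrier (Mor quot_cat v u)" for u v b
  proof -
    interpret vvu: orbit_triple K C G \<phi> \<alpha> v v u using that by unfold_locales (simp_all add: quot_cat_simps)
    note v = vvu.vu.v
    obtain y0 where y0: "y0 \<in> v" using orbit_nonempty[OF v] by blast
    have I: "Idn quot_cat v \<in> carrier (Mor quot_cat v v)"
      unfolding quot_Idn[OF v y0] using y0 vvu.vu.pair_objects by (intro vvu.wv.mor_class_closed Idn_closed)
    show ?thesis
    proof (rule vvu.vu.klinear_eq_on_classes[OF vvu.vu.quot_Mor_module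
          vvu.quot_Comp_linear_right[OF I] id_linear _ that(3)])
      fix y x c assume y: "y \<in> v" and x: "x \<in> u" and c: "c \<in> carrier (Mor C y x)"
      note ob = vvu.vu.pair_objects(1)[OF y] vvu.vu.pair_objects(2)[OF x]
      show "Comp quot_cat v v u (Idn quot_cat v) (vvu.vu.mor_class y x c) = vvu.vu.mor_class y x c"
        using vvu.quot_Comp_mor_class[OF y y x Idn_closed[OF ob(1)] c]
        by (simp add: quot_Idn[OF v y] Comp_Idn_left ob c)
    qed
  qed
  show "Comp quot_cat v u u b (Idn quot_cat u) = b"
    if "u \<in> ?O" "v \<in> ?O" "b \<in> carrier (Mor quot_cat v u)" for u v b
  proof -
    interpret vuu: orbit_triple K C G \<phi> \<alpha> v u u using that by unfold_locales (simp_all add: quot_cat_simps)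
    note u = vuu.vu.u
    obtain x0 where x0: "x0 \<in> u" using orbit_nonempty[OF u] by blast
    have I: "Idn quot_cat u \<in> carrier (Mor quot_cat u u)"
      unfolding quot_Idn[OF u x0] using x0 vuu.vu.pair_objects by (intro vuu.vu.mor_class_closed Idn_closed)
    show ?thesis
    proof (rule vuu.wv.klinear_eq_on_classes[OF vuu.wv.quot_Mor_module
          vuu.quot_Comp_linear_left[OF I] id_linear _ that(3)])
      fix y x c assume y: "y \<in> v" and x: "x \<in> u" and c: "c \<in> carrier (Mor C y x)"
      note ob = vuu.wv.pair_objects(1)[OF y] vuu.wv.pair_objects(2)[OF x]
      show "Comp quot_cat v u u (vuu.wv.mor_class y x c) (Idn quot_cat u) = vuu.wv.mor_class y x c"
        using vuu.quot_Comp_mor_class[OF y x x c Idn_closed[OF ob(2)]]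
        by (simp add: quot_Idn[OF u x] Comp_Idn_right ob c)
    qed
  qed
qed

sublocale quot: k_category K quot_cat
  by (rule quotient_is_k_category)

sublocale quot_bimod: k_bimodule K quot_cat "standard_bimodule quot_cat"
  by (rule quot.standard_bimodule)

lemma quot_cochain_1_eqI:
  assumes f: "f \<in> carrier (cochains K quot_cat (standard_bimodule quot_cat) (Suc 0))"
    and g: "g \<in> carrier (cochains K quot_cat (standard_bimodule quot_cat) (Suc 0))"
    and eq: "\<And>v u y x c. \<lbrakk>v \<in> orbits G (Obj C) \<phi>; u \<in> orbits G (Obj C) \<phi>; y \<in> v; x \<in> u;
      c \<in> carrier (Mor C y x)\<rbrakk> \<Longrightarrow> f ([v, u], [orbit_pair.mor_class K C G \<phi> \<alpha> v u y x c]) =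
        g ([v, u], [orbit_pair.mor_class K C G \<phi> \<alpha> v u y x c])"
  shows "f = g"
proof (rule quot_bimod.cochain_1_eqI[OF f g])
  fix u v b assume uv: "u \<in> Obj quot_cat" "v \<in> Obj quot_cat" and b: "b \<in> carrier (Mor quot_cat v u)"
  then interpret orbit_pair K C G \<phi> \<alpha> v u by unfold_locales (simp_all add: quot_cat_simps)
  have lin: "klinear K (Mor quot_cat v u) (Mor quot_cat v u) (\<lambda>b. h ([v, u], [b]))"
    if "h \<in> carrier (cochains K quot_cat (standard_bimodule quot_cat) (Suc 0))" for h
    using quot_bimod.cochain_1_linear[OF that uv] by (simp add: standard_bimodule_def)
  show "f ([v, u], [b]) = g ([v, u], [b])"
    by (rule klinear_eq_on_classes[OF quot_Mor_module lin[OF f] lin[OF g] _ b]) (rule eq[OF v u])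
qed

end

section \<open>The derivation of a potential\<close>

text \<open>
  The cochain of a potential \<open>h\<close> involves only the differences \<open>h y - h x\<close>, and the homomorphism
  cancels from them: they are invariant under the group.
\<close>

locale invariant_potential = free_action K C G \<phi> \<alpha>
  for K :: "'k ring" and C :: "('o, 'm, 'k) kcat" and G :: "'g monoid" and \<phi> \<alpha> +
  fixes h :: "'o \<Rightarrow> 'k"
  assumes h_closed: "x \<in> Obj C \<Longrightarrow> h x \<in> carrier K"
    and h_difference: "\<lbrakk>s \<in> carrier G; x \<in> Obj C; y \<in> Obj C\<rbrakk>
      \<Longrightarrow> h (\<phi> s y) \<ominus>\<^bsub>K\<^esub> h (\<phi> s x) = h y \<ominus>\<^bsub>K\<^esub> h x"

locale potential_pair = invariant_potential K C G \<phi> \<alpha> h + orbit_pair K C G \<phi> \<alpha> v u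
  for K :: "'k ring" and C :: "('o, 'm, 'k) kcat" and G :: "'g monoid" and \<phi> \<alpha> h v u
begin

definition scale :: "('o \<times> 'o \<Rightarrow> 'm) \<Rightarrow> 'o \<times> 'o \<Rightarrow> 'm" where
  "scale f = (\<lambda>(y, x)\<in>v \<times> u. (h y \<ominus>\<^bsub>K\<^esub> h x) \<odot>\<^bsub>Mor C y x\<^esub> f (y, x))"

lemma weight_closed: "\<lbrakk>y \<in> v; x \<in> u\<rbrakk> \<Longrightarrow> h y \<ominus>\<^bsub>K\<^esub> h x \<in> carrier K"
  using h_closed pair_objects by simp

lemma scale_linear: "klinear K (orbit_sum C v u) (orbit_sum C v u) scale"
proof -
  have "klinear K (orbit_sum C v u) (orbit_sum C v u)
      (\<lambda>f. \<lambda>i\<in>v \<times> u. (\<lambda>(y, x) c. (h y \<ominus>\<^bsub>K\<^esub> h x) \<odot>\<^bsub>Mor C y x\<^esub> c) i (f i))"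
  proof (rule osum.dsum_reindex_map_linear)
    show "klinear K (case i of (y, x) \<Rightarrow> Mor C y x) (case i of (y, x) \<Rightarrow> Mor C y x)
        ((\<lambda>(y, x) c. (h y \<ominus>\<^bsub>K\<^esub> h x) \<odot>\<^bsub>Mor C y x\<^esub> c) i)" if i: "i \<in> v \<times> u" for i
    proof -
      obtain y x where yx: "i = (y, x)" "y \<in> v" "x \<in> u" using i by auto
      have "klinear K (Mor C y x) (Mor C y x) (\<lambda>c. c)" by (simp add: klinear_def)
      then show ?thesis
        using weight_closed[OF yx(2,3)] pair_objects yx
        by (auto intro!: klinear_smult_fun Mor_module)
    qed
  qed auto
  then show ?thesis by (simp add: scale_def[abs_def] case_prod_unfold)
qed

lemma scale_single:
  assumes "y \<in> v" "x \<in> u" "c \<in> carrier (Mor C y x)"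
  shows "scale (single v u y x c) = single v u y x ((h y \<ominus>\<^bsub>K\<^esub> h x) \<odot>\<^bsub>Mor C y x\<^esub> c)"
proof (rule extensionalityI[of _ "v \<times> u"])
  fix p assume "p \<in> v \<times> u"
  then obtain b a where p: "p = (b, a)" "b \<in> v" "a \<in> u" by blast
  interpret V: module K "Mor C b a" using p pair_objects by (intro Mor_module) auto
  show "scale (single v u y x c) p = single v u y x ((h y \<ominus>\<^bsub>K\<^esub> h x) \<odot>\<^bsub>Mor C y x\<^esub> c) p"
    using p weight_closed[OF p(2,3)] by (auto simp: scale_def dsum_inj_def)
qed (simp_all add: scale_def dsum_inj_def)

lemma scale_act:
  assumes s: "s \<in> carrier G" and f: "f \<in> carrier (orbit_sum C v u)"
  shows "scale (orbit_sum_act G \<phi> \<alpha> v u s f) = orbit_sum_act G \<phi> \<alpha> v u s (scale f)"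
proof (rule osum.klinear_eq_on_dsum[OF osum.dsum.module_axioms
      klinear_compose[OF orbit_sum_act_linear[OF s] scale_linear]
      klinear_compose[OF scale_linear orbit_sum_act_linear[OF s]] _ f])
  fix p c assume "p \<in> v \<times> u" and c0: "c \<in> carrier (case p of (y, x) \<Rightarrow> Mor C y x)"
  then obtain y x where p: "p = (y, x)" "y \<in> v" "x \<in> u" and c: "c \<in> carrier (Mor C y x)" by auto
  note ob = pair_objects(1)[OF p(2)] pair_objects(2)[OF p(3)]
  interpret V: module K "Mor C y x" by (rule Mor_module[OF ob(2,1)])
  have "scale (single v u (\<phi> s y) (\<phi> s x) (\<alpha> s y x c))
      = single v u (\<phi> s y) (\<phi> s x) ((h y \<ominus>\<^bsub>K\<^esub> h x) \<odot>\<^bsub>Mor C (\<phi> s y) (\<phi> s x)\<^esub> \<alpha> s y x c)"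
    using scale_single[OF pair_act_closed(1)[OF p(2) s] pair_act_closed(2)[OF p(3) s]
        act_closed[OF s ob(2,1) c]]
    by (simp add: h_difference[OF s ob(2,1)])
  then show "scale (orbit_sum_act G \<phi> \<alpha> v u s (dsum_inj (v \<times> u) (\<lambda>(y, x). Mor C y x) p c))
      = orbit_sum_act G \<phi> \<alpha> v u s (scale (dsum_inj (v \<times> u) (\<lambda>(y, x). Mor C y x) p c))"
    using weight_closed[OF p(2,3)] c
    by (simp add: p act_single[OF s p(2,3)] scale_single[OF p(2,3)]
        klinear_smult[OF act_linear[OF s ob(2,1)]])
qed

definition derivation :: "('o \<times> 'o \<Rightarrow> 'm) set \<Rightarrow> ('o \<times> 'o \<Rightarrow> 'm) set" where
  "derivation b = (\<Union>f\<in>b. quot_class v u (scale f))"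

lemma derivation_class:
  assumes f: "f \<in> carrier (orbit_sum C v u)"
  shows "derivation (quot_class v u f) = quot_class v u (scale f)"
  unfolding derivation_def
proof (intro SUP_eq_const)
  show "quot_class v u f \<noteq> {}" using class_self[OF f] by blast
  fix g assume g: "g \<in> quot_class v u f"
  show "quot_class v u (scale g) = quot_class v u (scale f)"
    by (rule invariant_const_on_class[OF quot_Mor_module
          klinear_compose[OF scale_linear quot_class_linear] _ f g])
      (simp add: scale_act quot_class_act klinear_closed[OF scale_linear])
qed

lemma derivation_linear: "klinear K (Mor quot_cat v u) (Mor quot_cat v u) derivation"
  by (rule klinear_from_class[OF klinear_compose[OF scale_linear quot_class_linear] derivation_class])

lemma derivation_mor_class:
  assumes "y \<in> v" "x \<in> u" "c \<in> carrier (Mor C y x)"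
  shows "derivation (mor_class y x c) = (h y \<ominus>\<^bsub>K\<^esub> h x) \<odot>\<^bsub>Mor quot_cat v u\<^esub> mor_class y x c"
  using derivation_class[OF single_closed[OF assms]] weight_closed[OF assms(1,2)] assms
  by (simp add: scale_single klinear_smult[OF mor_class_linear, symmetric]) (simp add: mor_class_def)

end

context invariant_potential
begin

lemma potential_cochain_apply:
  assumes "v \<in> orbits G (Obj C) \<phi>" "u \<in> orbits G (Obj C) \<phi>" "b \<in> carrier (Mor quot_cat v u)"
  shows "potential_cochain K C G \<phi> \<alpha> h ([v, u], [b]) = potential_pair.derivation K C G \<phi> \<alpha> h v u b"
proof -
  interpret potential_pair K C G \<phi> \<alpha> h v u by unfold_locales (rule assms)+
  have "([v, u], [b]) \<in> chains quot_cat (Suc 0)"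
    using assms by (auto simp: chains_1 quot_cat_simps(1))
  then show ?thesis by (simp add: potential_cochain_def derivation_def scale_def)
qed

lemma potential_cochain_mor_class:
  assumes "v \<in> orbits G (Obj C) \<phi>" "u \<in> orbits G (Obj C) \<phi>" "y \<in> v" "x \<in> u" "c \<in> carrier (Mor C y x)"
  shows "potential_cochain K C G \<phi> \<alpha> h ([v, u], [orbit_pair.mor_class K C G \<phi> \<alpha> v u y x c]) =
    (h y \<ominus>\<^bsub>K\<^esub> h x) \<odot>\<^bsub>Mor quot_cat v u\<^esub> orbit_pair.mor_class K C G \<phi> \<alpha> v u y x c"
proof -
  interpret potential_pair K C G \<phi> \<alpha> h v u by unfold_locales (rule assms)+
  show ?thesis
    by (simp add: potential_cochain_apply[OF v u mor_class_closed[OF assms(3-5)]]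
        derivation_mor_class[OF assms(3-5)])
qed

text \<open>
  On a composite of \<open>c : x \<rightarrow> y\<close> and \<open>d : y \<rightarrow> z\<close> the derivation rule is
  \<open>h z - h x = (h y - h x) + (h z - h y)\<close>.
\<close>

lemma potential_cochain_cocycle:
  "potential_cochain K C G \<phi> \<alpha> h
    \<in> carrier (cocycles K quot_cat (standard_bimodule quot_cat) (Suc 0))"
  unfolding quot_bimod.cocycle_1_iff
proof (intro conjI ballI)
  let ?p = "potential_cochain K C G \<phi> \<alpha> h"
  show "?p \<in> carrier (cochains K quot_cat (standard_bimodule quot_cat) (Suc 0))"
  proof (rule quot_bimod.cochain_1I)
    show "?p \<in> extensional (chains quot_cat (Suc 0))"
      by (simp add: potential_cochain_def)
    fix u v assume "u \<in> Obj quot_cat" "v \<in> Obj quot_cat"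
    then interpret potential_pair K C G \<phi> \<alpha> h v u by unfold_locales (simp_all add: quot_cat_simps)
    have "klinear K (Mor quot_cat v u) (Mor quot_cat v u) (\<lambda>b. ?p ([v, u], [b]))"
      by (rule klinear_cong[OF quot_Mor_module _ derivation_linear]) (simp add: potential_cochain_apply v u)
    then show "klinear K (Mor quot_cat v u) (Bim (standard_bimodule quot_cat) v u) (\<lambda>b. ?p ([v, u], [b]))"
      by (simp add: standard_bimodule_def)
  qed
  fix u v w b D assume "u \<in> Obj quot_cat" "v \<in> Obj quot_cat" "w \<in> Obj quot_cat"
    and b: "b \<in> carrier (Mor quot_cat v u)" and D: "D \<in> carrier (Mor quot_cat w v)"
  then interpret orbit_triple K C G \<phi> \<alpha> w v u by unfold_locales (simp_all add: quot_cat_simps)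
  interpret pwv: potential_pair K C G \<phi> \<alpha> h w v by unfold_locales
  interpret pvu: potential_pair K C G \<phi> \<alpha> h v u by unfold_locales
  interpret pwu: potential_pair K C G \<phi> \<alpha> h w u by unfold_locales
  interpret W: module K "Mor quot_cat w u" by (rule wu.quot_Mor_module)
  let ?B = "quot_cat"
  have Db: "Comp ?B w v u D b \<in> carrier (Mor ?B w u)"
    by (rule klinear_closed[OF quot_Comp_linear_right[OF D] b])
  have "pwu.derivation (Comp ?B w v u D b)
      = Comp ?B w v u D (pvu.derivation b) \<oplus>\<^bsub>Mor ?B w u\<^esub> Comp ?B w v u (pwv.derivation D) b"
  proof (rule vu.klinear_eq_on_classes[OF W.module_axioms
        klinear_compose[OF quot_Comp_linear_right[OF D] pwu.derivation_linear]
        klinear_add_fun[OF W.module_axioms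
          klinear_compose[OF pvu.derivation_linear quot_Comp_linear_right[OF D]]
          quot_Comp_linear_right[OF klinear_closed[OF pwv.derivation_linear D]]] _ b])
    fix y x c assume y: "y \<in> v" and x: "x \<in> u" and c: "c \<in> carrier (Mor C y x)"
    let ?c = "vu.mor_class y x c"
    note cc = vu.mor_class_closed[OF y x c]
    show "pwu.derivation (Comp ?B w v u D ?c)
        = Comp ?B w v u D (pvu.derivation ?c) \<oplus>\<^bsub>Mor ?B w u\<^esub> Comp ?B w v u (pwv.derivation D) ?c"
    proof (rule wv.klinear_eq_on_classes_source[OF W.module_axioms
          klinear_compose[OF quot_Comp_linear_left[OF cc] pwu.derivation_linear]
          klinear_add_fun[OF W.module_axioms
            quot_Comp_linear_left[OF klinear_closed[OF pvu.derivation_linear cc]]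
            klinear_compose[OF pwv.derivation_linear quot_Comp_linear_left[OF cc]]] y _ D])
      fix z d assume z: "z \<in> w" and d: "d \<in> carrier (Mor C z y)"
      let ?d = "wv.mor_class z y d"
      note dd = wv.mor_class_closed[OF z y d]
      have hh: "h x \<in> carrier K" "h y \<in> carrier K" "h z \<in> carrier K"
        using h_closed x y z vu.pair_objects wv.pair_objects by auto
      have dc: "Comp C z y x d c \<in> carrier (Mor C z x)"
        using x y z c d vu.pair_objects wv.pair_objects by (intro Comp_closed) auto
      note dcc = wu.mor_class_closed[OF z x dc]
      have "(h y \<ominus>\<^bsub>K\<^esub> h x) \<oplus>\<^bsub>K\<^esub> (h z \<ominus>\<^bsub>K\<^esub> h y) = (h z \<ominus>\<^bsub>K\<^esub> h x) \<oplus>\<^bsub>K\<^esub> (h y \<ominus>\<^bsub>K\<^esub> h y)"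
        using hh by (simp add: minus_eq a_ac del: r_neg)
      then have sum: "(h y \<ominus>\<^bsub>K\<^esub> h x) \<oplus>\<^bsub>K\<^esub> (h z \<ominus>\<^bsub>K\<^esub> h y) = h z \<ominus>\<^bsub>K\<^esub> h x"
        using hh by (simp add: minus_eq r_neg)
      show "pwu.derivation (Comp ?B w v u ?d ?c)
          = Comp ?B w v u ?d (pvu.derivation ?c) \<oplus>\<^bsub>Mor ?B w u\<^esub> Comp ?B w v u (pwv.derivation ?d) ?c"
        using hh dcc
        by (simp add: quot_Comp_mor_class[OF z y x d c] pwu.derivation_mor_class[OF z x dc]
            pvu.derivation_mor_class[OF y x c] pwv.derivation_mor_class[OF z y d]
            klinear_smult[OF quot_Comp_linear_right[OF dd] _ cc]
            klinear_smult[OF quot_Comp_linear_left[OF cc] _ dd]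
            W.smult_l_distr[symmetric] sum)
    qed
  qed
  then show "?p ([w, u], [Comp ?B w v u D b]) =
      LAct (standard_bimodule ?B) w v u D (?p ([v, u], [b])) \<oplus>\<^bsub>Bim (standard_bimodule ?B) w u\<^esub>
      RAct (standard_bimodule ?B) w v u (?p ([w, v], [D])) b"
    using potential_cochain_apply[OF orbits(1,3) Db] potential_cochain_apply[OF orbits(2,3) b]
      potential_cochain_apply[OF orbits(1,2) D]
    by (simp add: standard_bimodule_def)
qed

end

section \<open>The canonical map\<close>

lemma Hom_module_carrier:
  "\<chi> \<in> carrier (Hom_module G K) \<longleftrightarrow> \<chi> \<in> extensional (carrier G) \<and>
    (\<forall>s\<in>carrier G. \<chi> s \<in> carrier K) \<and>
    (\<forall>s\<in>carrier G. \<forall>t\<in>carrier G. \<chi> (s \<otimes>\<^bsub>G\<^esub> t) = \<chi> s \<oplus>\<^bsub>K\<^esub> \<chi> t)"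
  by (auto simp: Hom_module_def hom_def)

lemma Hom_module_is_module:
  assumes "group G" "cring K"
  shows "module K (Hom_module G K)"
proof -
  interpret G: group G by fact
  interpret K: cring K by fact
  let ?V = "\<lambda>s. \<lparr>carrier = carrier K, mult = mult K, one = one K, zero = zero K, add = add K, smult = mult K\<rparr>"
  let ?P = "prod_module (carrier G) ?V" and ?H = "carrier (Hom_module G K)"
  have "\<exists>b\<in>carrier K. b \<oplus>\<^bsub>K\<^esub> a = \<zero>\<^bsub>K\<^esub>" if "a \<in> carrier K" for a
    using that K.l_neg[OF that] by blast
  then have "abelian_group (?V s)" for s
    by (intro abelian_groupI) (simp_all add: K.add.m_ac)
  then have "module K (?V s)" for s
    by (intro moduleI) (auto simp: K.is_cring K.l_distr K.r_distr K.m_assoc)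
  then interpret P: module K ?P by (intro prod_module_is_module K.is_cring)
  have "submodule ?H K ?P"
    by (rule P.submodule_criterion)
      (auto simp: Hom_module_carrier prod_module_def K.add.m_ac K.r_distr PiE_iff extensional_def)
  then have "module K (?P\<lparr>carrier := ?H\<rparr>)"
    by (rule submodule.submodule_is_module) (rule P.module_axioms)
  also have "?P\<lparr>carrier := ?H\<rparr> = Hom_module G K"
    by (simp add: prod_module_def Hom_module_def)
  finally show ?thesis .
qed

lemma (in abelian_group) difference_of_sums:
  assumes "a \<in> carrier G" "b \<in> carrier G" "c \<in> carrier G" "d \<in> carrier G"
  shows "(a \<oplus> b) \<ominus> (c \<oplus> d) = (a \<ominus> c) \<oplus> (b \<ominus> d)"
  using assms by (simp add: minus_eq minus_add add.m_ac)

lemma (in abelian_group) difference_of_differences: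
  assumes "a \<in> carrier G" "b \<in> carrier G" "c \<in> carrier G" "d \<in> carrier G"
  shows "(a \<ominus> b) \<ominus> (c \<ominus> d) = (a \<ominus> c) \<ominus> (b \<ominus> d)"
  using assms by (simp add: minus_eq minus_add add.m_ac)

lemma (in abelian_group) add_minus_cancel:
  assumes "a \<in> carrier G" "b \<in> carrier G"
  shows "a \<ominus> b \<oplus> b = a"
  using assms by (simp add: minus_eq add.m_assoc l_neg)

lemma (in abelian_group) eq_if_minus_zero:
  assumes "a \<in> carrier G" "b \<in> carrier G" "a \<ominus> b = \<zero>"
  shows "a = b"
  using add_minus_cancel[OF assms(1,2)] assms by simp

context free_action
begin

lemma potential_invariant:
  assumes \<chi>: "\<chi> \<in> carrier (Hom_module G K)" and h: "potential K C G \<phi> \<chi> h"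
  shows "invariant_potential K C G \<phi> \<alpha> h"
proof (intro invariant_potential.intro invariant_potential_axioms.intro free_action_axioms)
  show hc: "h x \<in> carrier K" if "x \<in> Obj C" for x using h that by (auto simp: potential_def)
  fix s x y assume s: "s \<in> carrier G" and xy: "x \<in> Obj C" "y \<in> Obj C"
  have \<chi>s: "\<chi> s \<in> carrier K" using \<chi> s by (simp add: Hom_module_carrier)
  then have "\<chi> s \<ominus>\<^bsub>K\<^esub> \<chi> s = \<zero>\<^bsub>K\<^esub>" by (simp add: minus_eq r_neg)
  then show "h (\<phi> s y) \<ominus>\<^bsub>K\<^esub> h (\<phi> s x) = h y \<ominus>\<^bsub>K\<^esub> h x"
    using h s xy hc \<chi>s by (simp add: potential_def difference_of_sums)
qed

lemma orbit_in_orbits: "x \<in> Obj C \<Longrightarrow> orbit G \<phi> x \<in> orbits G (Obj C) \<phi>"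
  by (auto simp: orbits_def)

lemma orbit_of_translate:
  assumes "s \<in> carrier G" "x \<in> Obj C"
  shows "orbit G \<phi> (\<phi> s x) = orbit G \<phi> x"
proof -
  have "\<phi> s x \<in> orbit G \<phi> (\<phi> s x)"
    by (rule orbit_refl[OF obj_act_closed[OF assms]])
  moreover have "\<phi> s x \<in> orbit G \<phi> x"
    using assms by (auto simp: orbit_def)
  ultimately show ?thesis
    using disjoint_union[OF orbit_in_orbits orbit_in_orbits] assms obj_act_closed by blast
qed

text \<open>
  Choose a member of each orbit; every object is a translate of the chosen member of its orbit by a
  unique group element, on which the homomorphism is evaluated.
\<close>

lemma potential_exists:
  assumes \<chi>: "\<chi> \<in> carrier (Hom_module G K)"
  shows "\<exists>h. potential K C G \<phi> \<chi> h"
proof -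
  define rep where "rep x = (SOME z. z \<in> orbit G \<phi> x)" for x
  define t where "t x = (THE s. s \<in> carrier G \<and> \<phi> s (rep x) = x)" for x
  have rep: "rep x \<in> orbit G \<phi> x" if "x \<in> Obj C" for x
    unfolding rep_def using orbit_refl[OF that] by (rule someI)
  have rep_obj: "rep x \<in> Obj C" if "x \<in> Obj C" for x
    using orbit_sub[OF orbit_in_orbits[OF that] rep[OF that]] .
  have t: "t x \<in> carrier G" "\<phi> (t x) (rep x) = x" if x: "x \<in> Obj C" for x
  proof -
    obtain s where s: "s \<in> carrier G" "\<phi> s (rep x) = x"
      using orbit_transport[OF orbit_in_orbits[OF x] rep[OF x] orbit_refl[OF x]] by blast
    then have "t x = s" unfolding t_def by (intro the_transporter rep_obj x)
    then show "t x \<in> carrier G" "\<phi> (t x) (rep x) = x" using s by auto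
  qed
  have t_act: "t (\<phi> s x) = s \<otimes>\<^bsub>G\<^esub> t x" if s: "s \<in> carrier G" and x: "x \<in> Obj C" for s x
  proof -
    have "rep (\<phi> s x) = rep x" by (simp add: rep_def orbit_of_translate s x)
    then show ?thesis
      unfolding t_def[of "\<phi> s x"] using s x t[OF x] rep_obj[OF x]
      by (intro the_transporter) (auto simp: composition_rule)
  qed
  have "potential K C G \<phi> \<chi> (\<lambda>x. \<chi> (t x))"
    using \<chi> t by (auto simp: potential_def Hom_module_carrier t_act)
  then show ?thesis by blast
qed

abbreviation quot_HH :: "('k, ('o set list \<times> ('o \<times> 'o \<Rightarrow> 'm) set list \<Rightarrow> ('o \<times> 'o \<Rightarrow> 'm) set) set) module"
  where "quot_HH \<equiv> HH K quot_cat (standard_bimodule quot_cat) (Suc 0)"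

abbreviation quot_Z :: "('k, 'o set list \<times> ('o \<times> 'o \<Rightarrow> 'm) set list \<Rightarrow> ('o \<times> 'o \<Rightarrow> 'm) set) module"
  where "quot_Z \<equiv> cocycles K quot_cat (standard_bimodule quot_cat) (Suc 0)"

abbreviation coh_class where
  "coh_class \<equiv> cohomology_class K quot_cat (standard_bimodule quot_cat) (Suc 0)"

lemma quot_HH_is_module: "module K quot_HH"
  unfolding HH_def by (rule quot_bimod.HH1.quot_is_module)

lemma coh_class_linear: "klinear K quot_Z quot_HH coh_class"
  using quot_bimod.HH1.coset_linear by (simp add: HH_def cohomology_class_def[abs_def])

lemma quot_Z_apply:
  assumes "v \<in> orbits G (Obj C) \<phi>" "u \<in> orbits G (Obj C) \<phi>" "b \<in> carrier (Mor quot_cat v u)"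
  shows "(f \<oplus>\<^bsub>quot_Z\<^esub> g) ([v, u], [b]) = f ([v, u], [b]) \<oplus>\<^bsub>Mor quot_cat v u\<^esub> g ([v, u], [b])"
    and "(a \<odot>\<^bsub>quot_Z\<^esub> f) ([v, u], [b]) = a \<odot>\<^bsub>Mor quot_cat v u\<^esub> f ([v, u], [b])"
  using quot_bimod.cochain_1_add[of u v b f g] quot_bimod.cochain_1_smult[of u v b a f] assms
  by (simp_all add: quot_cat_simps(1) cocycles_def standard_bimodule_def)

lemma quot_Z_eqI:
  assumes "f \<in> carrier quot_Z" "g \<in> carrier quot_Z"
    and "\<And>v u y x c. \<lbrakk>v \<in> orbits G (Obj C) \<phi>; u \<in> orbits G (Obj C) \<phi>; y \<in> v; x \<in> u;
      c \<in> carrier (Mor C y x)\<rbrakk> \<Longrightarrow> f ([v, u], [orbit_pair.mor_class K C G \<phi> \<alpha> v u y x c]) =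
        g ([v, u], [orbit_pair.mor_class K C G \<phi> \<alpha> v u y x c])"
  shows "f = g"
  using assms(1,2) by (intro quot_cochain_1_eqI assms(3)) (auto simp: quot_bimod.cocycle_1_iff)

lemma potential_cochain_add:
  assumes "invariant_potential K C G \<phi> \<alpha> h" "invariant_potential K C G \<phi> \<alpha> h'"
    and "invariant_potential K C G \<phi> \<alpha> (\<lambda>x. h x \<oplus>\<^bsub>K\<^esub> h' x)"
  shows "potential_cochain K C G \<phi> \<alpha> (\<lambda>x. h x \<oplus>\<^bsub>K\<^esub> h' x)
    = potential_cochain K C G \<phi> \<alpha> h \<oplus>\<^bsub>quot_Z\<^esub> potential_cochain K C G \<phi> \<alpha> h'"
proof (rule quot_Z_eqI)
  interpret h: invariant_potential K C G \<phi> \<alpha> h by fact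
  interpret h': invariant_potential K C G \<phi> \<alpha> h' by fact
  interpret hh: invariant_potential K C G \<phi> \<alpha> "\<lambda>x. h x \<oplus>\<^bsub>K\<^esub> h' x" by fact
  show "potential_cochain K C G \<phi> \<alpha> (\<lambda>x. h x \<oplus>\<^bsub>K\<^esub> h' x) \<in> carrier quot_Z"
    "potential_cochain K C G \<phi> \<alpha> h \<oplus>\<^bsub>quot_Z\<^esub> potential_cochain K C G \<phi> \<alpha> h' \<in> carrier quot_Z"
    by (intro quot_bimod.HH1.M.a_closed h.potential_cochain_cocycle h'.potential_cochain_cocycle
        hh.potential_cochain_cocycle)+
  fix v u y x c assume v: "v \<in> orbits G (Obj C) \<phi>" and u: "u \<in> orbits G (Obj C) \<phi>"
    and y: "y \<in> v" and x: "x \<in> u" and c: "c \<in> carrier (Mor C y x)"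
  interpret orbit_pair K C G \<phi> \<alpha> v u by unfold_locales (rule v u)+
  interpret V: module K "Mor quot_cat v u" by (rule quot_Mor_module)
  note cc = mor_class_closed[OF y x c]
  have hc: "h x \<in> carrier K" "h y \<in> carrier K" "h' x \<in> carrier K" "h' y \<in> carrier K"
    using h.h_closed h'.h_closed pair_objects x y by auto
  show "potential_cochain K C G \<phi> \<alpha> (\<lambda>x. h x \<oplus>\<^bsub>K\<^esub> h' x) ([v, u], [mor_class y x c]) =
    (potential_cochain K C G \<phi> \<alpha> h \<oplus>\<^bsub>quot_Z\<^esub> potential_cochain K C G \<phi> \<alpha> h') ([v, u], [mor_class y x c])"
    using hc cc
    by (simp add: quot_Z_apply[OF v u cc] h.potential_cochain_mor_class[OF v u y x c]
        h'.potential_cochain_mor_class[OF v u y x c] hh.potential_cochain_mor_class[OF v u y x c]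
        difference_of_sums V.smult_l_distr)
qed

lemma potential_cochain_smult:
  assumes "invariant_potential K C G \<phi> \<alpha> h" and a: "a \<in> carrier K"
    and "invariant_potential K C G \<phi> \<alpha> (\<lambda>x. a \<otimes>\<^bsub>K\<^esub> h x)"
  shows "potential_cochain K C G \<phi> \<alpha> (\<lambda>x. a \<otimes>\<^bsub>K\<^esub> h x) = a \<odot>\<^bsub>quot_Z\<^esub> potential_cochain K C G \<phi> \<alpha> h"
proof (rule quot_Z_eqI)
  interpret h: invariant_potential K C G \<phi> \<alpha> h by fact
  interpret ah: invariant_potential K C G \<phi> \<alpha> "\<lambda>x. a \<otimes>\<^bsub>K\<^esub> h x" by fact
  show "potential_cochain K C G \<phi> \<alpha> (\<lambda>x. a \<otimes>\<^bsub>K\<^esub> h x) \<in> carrier quot_Z"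
    "a \<odot>\<^bsub>quot_Z\<^esub> potential_cochain K C G \<phi> \<alpha> h \<in> carrier quot_Z"
    by (intro quot_bimod.HH1.smult_closed h.potential_cochain_cocycle ah.potential_cochain_cocycle a)+
  fix v u y x c assume v: "v \<in> orbits G (Obj C) \<phi>" and u: "u \<in> orbits G (Obj C) \<phi>"
    and y: "y \<in> v" and x: "x \<in> u" and c: "c \<in> carrier (Mor C y x)"
  interpret orbit_pair K C G \<phi> \<alpha> v u by unfold_locales (rule v u)+
  interpret V: module K "Mor quot_cat v u" by (rule quot_Mor_module)
  note cc = mor_class_closed[OF y x c]
  have hc: "h x \<in> carrier K" "h y \<in> carrier K"
    using h.h_closed pair_objects x y by auto
  then have "(a \<otimes>\<^bsub>K\<^esub> h y) \<ominus>\<^bsub>K\<^esub> (a \<otimes>\<^bsub>K\<^esub> h x) = a \<otimes>\<^bsub>K\<^esub> (h y \<ominus>\<^bsub>K\<^esub> h x)"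
    using a by (simp add: minus_eq r_distr r_minus)
  then show "potential_cochain K C G \<phi> \<alpha> (\<lambda>x. a \<otimes>\<^bsub>K\<^esub> h x) ([v, u], [mor_class y x c]) =
    (a \<odot>\<^bsub>quot_Z\<^esub> potential_cochain K C G \<phi> \<alpha> h) ([v, u], [mor_class y x c])"
    using hc cc a
    by (simp add: quot_Z_apply[OF v u cc] h.potential_cochain_mor_class[OF v u y x c]
        ah.potential_cochain_mor_class[OF v u y x c] V.smult_assoc1)
qed

text \<open>
  The difference \<open>g\<close> of two potentials of one homomorphism is constant on orbits, and the difference
  of their cochains is the coboundary of the family of scalars \<open>g\<close>, one for each orbit.
\<close>

lemma potential_cochain_independent:
  assumes \<chi>: "\<chi> \<in> carrier (Hom_module G K)"
    and h: "potential K C G \<phi> \<chi> h" and h': "potential K C G \<phi> \<chi> h'"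
  shows "coh_class (potential_cochain K C G \<phi> \<alpha> h) = coh_class (potential_cochain K C G \<phi> \<alpha> h')"
proof -
  interpret h: invariant_potential K C G \<phi> \<alpha> h by (rule potential_invariant[OF \<chi> h])
  interpret h': invariant_potential K C G \<phi> \<alpha> h' by (rule potential_invariant[OF \<chi> h'])
  let ?S = "standard_bimodule quot_cat"
  let ?p = "potential_cochain K C G \<phi> \<alpha> h" and ?p' = "potential_cochain K C G \<phi> \<alpha> h'"
  define g where "g x = h x \<ominus>\<^bsub>K\<^esub> h' x" for x
  have gc: "g x \<in> carrier K" if "x \<in> Obj C" for x
    using that by (simp add: g_def h.h_closed h'.h_closed)
  have g_act: "g (\<phi> s x) = g x" if s: "s \<in> carrier G" and x: "x \<in> Obj C" for s x
  proof -
    have "\<chi> s \<in> carrier K" using \<chi> s by (simp add: Hom_module_carrier)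
    then have "\<chi> s \<ominus>\<^bsub>K\<^esub> \<chi> s = \<zero>\<^bsub>K\<^esub>" "\<chi> s \<in> carrier K" by (simp_all add: minus_eq r_neg)
    then show ?thesis
      using h h' s x by (simp add: g_def potential_def difference_of_sums h.h_closed h'.h_closed)
  qed
  define r where "r u = g (SOME x. x \<in> u)" for u
  have r: "r u = g x" if u: "u \<in> orbits G (Obj C) \<phi>" and x: "x \<in> u" for u x
  proof -
    have "(SOME x. x \<in> u) \<in> u" using x by (rule someI)
    then obtain s where "s \<in> carrier G" "\<phi> s x = (SOME x. x \<in> u)"
      using orbit_transport[OF u x] by blast
    then show ?thesis using g_act[OF _ orbit_sub[OF u x], of s] by (simp add: r_def)
  qed
  have rc: "r u \<in> carrier K" if "u \<in> orbits G (Obj C) \<phi>" for u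
    using orbit_nonempty[OF that] r[OF that] gc orbit_sub[OF that] by metis
  define m where "m = (\<lambda>(us, bs)\<in>chains quot_cat 0. r (hd us) \<odot>\<^bsub>Mor quot_cat (hd us) (hd us)\<^esub> Idn quot_cat (hd us))"
  have m_apply: "m ([u], []) = r u \<odot>\<^bsub>Mor quot_cat u u\<^esub> Idn quot_cat u" if "u \<in> orbits G (Obj C) \<phi>" for u
    using that by (simp add: m_def chains_0 quot_cat_simps(1))
  have m: "m \<in> carrier (cochains K quot_cat ?S 0)"
    using module.smult_closed[OF quot.Mor_module rc quot.Idn_closed]
    by (auto simp: cochains_def m_def chains_0 multilinear_on_chains_def standard_bimodule_def
        quot_cat_simps(1))
  have cob: "coboundary K quot_cat ?S 0 m \<in> carrier quot_Z"
    by (rule quot_bimod.coboundary_0_closed[OF m])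
  have "?p = coboundary K quot_cat ?S 0 m \<oplus>\<^bsub>quot_Z\<^esub> ?p'"
  proof (rule quot_Z_eqI)
    show "?p \<in> carrier quot_Z" by (rule h.potential_cochain_cocycle)
    show "coboundary K quot_cat ?S 0 m \<oplus>\<^bsub>quot_Z\<^esub> ?p' \<in> carrier quot_Z"
      by (intro quot_bimod.HH1.M.a_closed cob h'.potential_cochain_cocycle)
    fix v u y x c assume v: "v \<in> orbits G (Obj C) \<phi>" and u: "u \<in> orbits G (Obj C) \<phi>"
      and y: "y \<in> v" and x: "x \<in> u" and c: "c \<in> carrier (Mor C y x)"
    interpret orbit_pair K C G \<phi> \<alpha> v u by unfold_locales (rule v u)+
    interpret V: module K "Mor quot_cat v u" by (rule quot_Mor_module)
    note cc = mor_class_closed[OF y x c]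
    have ob: "x \<in> Obj C" "y \<in> Obj C" using x y pair_objects by auto
    have uv: "u \<in> Obj quot_cat" "v \<in> Obj quot_cat" using u v by (simp_all add: quot_cat_simps)
    have hc: "h x \<in> carrier K" "h y \<in> carrier K" "h' x \<in> carrier K" "h' y \<in> carrier K"
      using h.h_closed h'.h_closed ob by auto
    have "coboundary K quot_cat ?S 0 m ([v, u], [mor_class y x c])
        = \<ominus>\<^bsub>Mor quot_cat v u\<^esub> (g x \<odot>\<^bsub>Mor quot_cat v u\<^esub> mor_class y x c)
          \<oplus>\<^bsub>Mor quot_cat v u\<^esub> g y \<odot>\<^bsub>Mor quot_cat v u\<^esub> mor_class y x c"
      using quot_bimod.coboundary_0_apply[OF m uv cc] gc[OF ob(1)] gc[OF ob(2)]
      by (simp add: m_apply u v r[OF u x] r[OF v y] standard_bimodule_def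
          klinear_smult[OF quot.Comp_linear_right[OF uv(1,1,2) cc] _ quot.Idn_closed[OF uv(1)]]
          klinear_smult[OF quot.Comp_linear_left[OF uv(1,2,2) cc] _ quot.Idn_closed[OF uv(2)]]
          quot.Comp_Idn_left[OF uv cc] quot.Comp_Idn_right[OF uv cc])
    also have "\<dots> = (g y \<ominus>\<^bsub>K\<^esub> g x) \<odot>\<^bsub>Mor quot_cat v u\<^esub> mor_class y x c"
      using gc[OF ob(1)] gc[OF ob(2)] cc
      by (simp add: minus_eq V.smult_l_distr V.smult_l_minus V.M.a_comm)
    also have "g y \<ominus>\<^bsub>K\<^esub> g x = (h y \<ominus>\<^bsub>K\<^esub> h x) \<ominus>\<^bsub>K\<^esub> (h' y \<ominus>\<^bsub>K\<^esub> h' x)"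
      unfolding g_def by (rule difference_of_differences[OF hc(2,4,1,3)])
    finally show "?p ([v, u], [mor_class y x c])
        = (coboundary K quot_cat ?S 0 m \<oplus>\<^bsub>quot_Z\<^esub> ?p') ([v, u], [mor_class y x c])"
      using hc cc
      by (simp add: quot_Z_apply[OF v u cc] h.potential_cochain_mor_class[OF v u y x c]
          h'.potential_cochain_mor_class[OF v u y x c] V.smult_l_distr[symmetric] add_minus_cancel)
  qed
  moreover have "coboundary K quot_cat ?S 0 m \<in> coboundaries K quot_cat ?S (Suc 0)"
    using m by (simp add: coboundaries_def)
  ultimately show ?thesis
    unfolding cohomology_class_def
    using quot_bimod.HH1.coset_eq_iff[OF h.potential_cochain_cocycle h'.potential_cochain_cocycle]
    by blast
qed

text \<open>
  If the cochains of \<open>h\<close> and \<open>h'\<close> differ by the coboundary of a family \<open>m\<close>, then each class of a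
  nonzero morphism \<open>c : x \<rightarrow> y\<close> is an eigenvector, with eigenvalue \<open>g y - g x\<close> for \<open>g = h - h'\<close>, of
  the inner derivation of \<open>m\<close>. The only possible eigenvalue is the difference of the scalar parts
  \<open>l\<close> of \<open>m\<close> at the two orbits. So \<open>g - l\<close> takes the same value at the two ends of every nonzero
  morphism, hence is constant because \<open>C\<close> is connected; comparing \<open>x\<close> with \<open>s x\<close> gives \<open>\<chi> s = \<chi>' s\<close>.
\<close>

lemma cohomologous_potentials:
  assumes conn: "connected_category C" and fin: "hom_finite K quot_cat" and split: "totally_split K quot_cat"
    and \<chi>: "\<chi> \<in> carrier (Hom_module G K)" and h: "potential K C G \<phi> \<chi> h"
    and \<chi>': "\<chi>' \<in> carrier (Hom_module G K)" and h': "potential K C G \<phi> \<chi>' h'"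
    and eq: "coh_class (potential_cochain K C G \<phi> \<alpha> h) = coh_class (potential_cochain K C G \<phi> \<alpha> h')"
  shows "\<chi> = \<chi>'"
proof -
  interpret h: invariant_potential K C G \<phi> \<alpha> h by (rule potential_invariant[OF \<chi> h])
  interpret h': invariant_potential K C G \<phi> \<alpha> h' by (rule potential_invariant[OF \<chi>' h'])
  let ?S = "standard_bimodule quot_cat"
  let ?p = "potential_cochain K C G \<phi> \<alpha> h" and ?p' = "potential_cochain K C G \<phi> \<alpha> h'"
  obtain n where n: "n \<in> coboundaries K quot_cat ?S (Suc 0)" "?p = n \<oplus>\<^bsub>quot_Z\<^esub> ?p'"
    using eq quot_bimod.HH1.coset_eq_iff[OF h.potential_cochain_cocycle h'.potential_cochain_cocycle]
    unfolding cohomology_class_def by blast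
  then obtain m where m: "m \<in> carrier (cochains K quot_cat ?S 0)" "n = coboundary K quot_cat ?S 0 m"
    by (auto simp: coboundaries_def)
  have mc: "m ([u], []) \<in> carrier (Mor quot_cat u u)" if "u \<in> Obj quot_cat" for u
    using quot_bimod.cochain_0_closed[OF m(1) that] by (simp add: standard_bimodule_def)
  have "\<exists>a\<in>carrier K. \<exists>p\<in>carrier (Mor quot_cat u u). \<exists>n::nat.
      m ([u], []) = a \<odot>\<^bsub>Mor quot_cat u u\<^esub> Idn quot_cat u \<oplus>\<^bsub>Mor quot_cat u u\<^esub> p \<and>
      p [^]\<^bsub>End_ring quot_cat u\<^esub> n = \<zero>\<^bsub>Mor quot_cat u u\<^esub>" if u: "u \<in> Obj quot_cat" for u
  proof (rule quot.scalar_plus_nilpotent[OF u _ _ _ mc[OF u]])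
    show "finite_dimensional K (Mor quot_cat u u)" using fin u by (simp add: hom_finite_def)
    show "is_local_ring (End_ring quot_cat u)"
      using split u by (simp add: totally_split_def split_category_def)
    show "carrier (Mor quot_cat u u) =
        set_add (Mor quot_cat u u) {a \<odot>\<^bsub>Mor quot_cat u u\<^esub> Idn quot_cat u | a. a \<in> carrier K} I"
      if "maximal_left_ideal I (End_ring quot_cat u)" for I
      using split u that by (simp add: totally_split_def Let_def)
  qed
  then obtain l p k where l: "\<And>u. u \<in> Obj quot_cat \<Longrightarrow> l u \<in> carrier K"
    and p: "\<And>u. u \<in> Obj quot_cat \<Longrightarrow> p u \<in> carrier (Mor quot_cat u u)"
    and m_eq: "\<And>u. u \<in> Obj quot_cat \<Longrightarrow>
      m ([u], []) = l u \<odot>\<^bsub>Mor quot_cat u u\<^esub> Idn quot_cat u \<oplus>\<^bsub>Mor quot_cat u u\<^esub> p u"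
    and nil: "\<And>u. u \<in> Obj quot_cat \<Longrightarrow> p u [^]\<^bsub>End_ring quot_cat u\<^esub> (k u :: nat) = \<zero>\<^bsub>Mor quot_cat u u\<^esub>"
    by metis
  define g where "g x = h x \<ominus>\<^bsub>K\<^esub> h' x" for x
  define q where "q x = g x \<ominus>\<^bsub>K\<^esub> l (orbit G \<phi> x)" for x
  have gc: "g x \<in> carrier K" if "x \<in> Obj C" for x
    using that by (simp add: g_def h.h_closed h'.h_closed)
  have q_eq: "q y = q x" if x: "x \<in> Obj C" and y: "y \<in> Obj C"
    and ne: "carrier (Mor C y x) \<noteq> {\<zero>\<^bsub>Mor C y x\<^esub>}" for x y
  proof -
    interpret M: module K "Mor C y x" by (rule Mor_module[OF x y])
    obtain c where c: "c \<in> carrier (Mor C y x)" "c \<noteq> \<zero>\<^bsub>Mor C y x\<^esub>" using ne by blast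
    define v u where "v = orbit G \<phi> y" and "u = orbit G \<phi> x"
    have vu: "v \<in> orbits G (Obj C) \<phi>" "u \<in> orbits G (Obj C) \<phi>" "y \<in> v" "x \<in> u"
      using x y by (auto simp: v_def u_def orbit_in_orbits intro: orbit_refl)
    then have uvq: "u \<in> Obj quot_cat" "v \<in> Obj quot_cat" by (simp_all add: quot_cat_simps)
    interpret orbit_pair K C G \<phi> \<alpha> v u by unfold_locales (rule vu)+
    interpret V: module K "Mor quot_cat v u" by (rule quot_Mor_module)
    let ?c = "mor_class y x c"
    note cc = mor_class_closed[OF vu(3,4) c(1)]
    have cne: "?c \<noteq> \<zero>\<^bsub>Mor quot_cat v u\<^esub>" using mor_class_inj[OF vu(3,4) c(1)] c(2) by blast
    let ?I = "\<ominus>\<^bsub>Mor quot_cat v u\<^esub> Comp quot_cat v u u ?c (m ([u], []))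
      \<oplus>\<^bsub>Mor quot_cat v u\<^esub> Comp quot_cat v v u (m ([v], [])) ?c"
    have Ic: "?I \<in> carrier (Mor quot_cat v u)"
      by (intro V.M.a_closed V.M.a_inv_closed quot.Comp_closed uvq mc cc)
    have hc: "h x \<in> carrier K" "h y \<in> carrier K" "h' x \<in> carrier K" "h' y \<in> carrier K"
      using h.h_closed h'.h_closed x y by auto
    let ?a = "(h y \<ominus>\<^bsub>K\<^esub> h x) \<ominus>\<^bsub>K\<^esub> (h' y \<ominus>\<^bsub>K\<^esub> h' x)"
    have cob: "coboundary K quot_cat ?S 0 m ([v, u], [?c]) = ?I"
      using quot_bimod.coboundary_0_apply[OF m(1) uvq cc] by (simp add: standard_bimodule_def)
    have "(h y \<ominus>\<^bsub>K\<^esub> h x) \<odot>\<^bsub>Mor quot_cat v u\<^esub> ?c = ?p ([v, u], [?c])"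
      by (rule h.potential_cochain_mor_class[OF vu c(1), symmetric])
    also have "\<dots> = ?I \<oplus>\<^bsub>Mor quot_cat v u\<^esub> (h' y \<ominus>\<^bsub>K\<^esub> h' x) \<odot>\<^bsub>Mor quot_cat v u\<^esub> ?c"
      by (simp only: n(2) m(2) quot_Z_apply[OF vu(1,2) cc] cob h'.potential_cochain_mor_class[OF vu c(1)])
    finally have "(h y \<ominus>\<^bsub>K\<^esub> h x) \<odot>\<^bsub>Mor quot_cat v u\<^esub> ?c
        = ?I \<oplus>\<^bsub>Mor quot_cat v u\<^esub> (h' y \<ominus>\<^bsub>K\<^esub> h' x) \<odot>\<^bsub>Mor quot_cat v u\<^esub> ?c" .
    moreover have "?a \<odot>\<^bsub>Mor quot_cat v u\<^esub> ?c = (h y \<ominus>\<^bsub>K\<^esub> h x) \<odot>\<^bsub>Mor quot_cat v u\<^esub> ?c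
        \<oplus>\<^bsub>Mor quot_cat v u\<^esub> \<ominus>\<^bsub>Mor quot_cat v u\<^esub> ((h' y \<ominus>\<^bsub>K\<^esub> h' x) \<odot>\<^bsub>Mor quot_cat v u\<^esub> ?c)"
      using hc cc minus_eq[of "h y \<ominus>\<^bsub>K\<^esub> h x" "h' y \<ominus>\<^bsub>K\<^esub> h' x"]
      by (simp add: V.smult_l_distr V.smult_l_minus)
    ultimately have "?a \<odot>\<^bsub>Mor quot_cat v u\<^esub> ?c = ?I"
      using Ic cc hc by (simp add: V.M.a_assoc V.M.r_neg)
    then have "?a = l v \<ominus>\<^bsub>K\<^esub> l u"
      using hc unfolding m_eq[OF uvq(1)] m_eq[OF uvq(2)]
      by (intro quot.inner_derivation_eigenvalue[OF uvq cc cne p[OF uvq(2)] nil[OF uvq(2)]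
            p[OF uvq(1)] nil[OF uvq(1)] _ l[OF uvq(2)] l[OF uvq(1)]]) auto
    moreover have "?a = g y \<ominus>\<^bsub>K\<^esub> g x"
      unfolding g_def by (rule difference_of_differences[OF hc(2,1,4,3)])
    ultimately have "(g y \<ominus>\<^bsub>K\<^esub> l v) \<ominus>\<^bsub>K\<^esub> (g x \<ominus>\<^bsub>K\<^esub> l u) = (l v \<ominus>\<^bsub>K\<^esub> l u) \<ominus>\<^bsub>K\<^esub> (l v \<ominus>\<^bsub>K\<^esub> l u)"
      using difference_of_differences[OF gc[OF y] l[OF uvq(2)] gc[OF x] l[OF uvq(1)]] by simp
    then have "(g y \<ominus>\<^bsub>K\<^esub> l v) \<ominus>\<^bsub>K\<^esub> (g x \<ominus>\<^bsub>K\<^esub> l u) = \<zero>\<^bsub>K\<^esub>"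
      using l uvq by (simp add: minus_eq[of "l v \<ominus>\<^bsub>K\<^esub> l u" "l v \<ominus>\<^bsub>K\<^esub> l u"] r_neg)
    moreover have "g y \<ominus>\<^bsub>K\<^esub> l v \<in> carrier K" "g x \<ominus>\<^bsub>K\<^esub> l u \<in> carrier K"
      using gc[OF x] gc[OF y] l[OF uvq(1)] l[OF uvq(2)] by simp_all
    ultimately have "g y \<ominus>\<^bsub>K\<^esub> l v = g x \<ominus>\<^bsub>K\<^esub> l u" by (rule eq_if_minus_zero[rotated 2])
    then show ?thesis by (simp add: q_def v_def[symmetric] u_def[symmetric])
  qed
  let ?R = "{(x, y). x \<in> Obj C \<and> y \<in> Obj C \<and> equivclp (linked C) x y}"
  have q_link: "q x = q y" if "equivclp (linked C) x y" for x y
    using that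
  proof (induction rule: equivclp_induct)
    case (step y z)
    have "q y = q z"
      using step.hyps(2) q_eq unfolding linked_def by metis
    then show ?case using step.IH by simp
  qed simp
  have "card (Obj C // ?R) = 1" using conn by (simp add: connected_category_def)
  then obtain A where A: "Obj C // ?R = {A}" by (rule card_1_singletonE)
  have q_const: "q x = q y" if x: "x \<in> Obj C" and y: "y \<in> Obj C" for x y
  proof -
    have "?R `` {x} = A" "?R `` {y} = A" using A quotientI[OF x, of ?R] quotientI[OF y, of ?R] by auto
    moreover have "y \<in> ?R `` {y}" using y by auto
    ultimately have "(x, y) \<in> ?R" by blast
    then show ?thesis by (intro q_link) simp
  qed
  obtain x where x: "x \<in> Obj C" using A by (fastforce simp: quotient_def)
  show ?thesis
  proof (rule extensionalityI[of _ "carrier G"])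
    show "\<chi> \<in> extensional (carrier G)" "\<chi>' \<in> extensional (carrier G)"
      using \<chi> \<chi>' by (simp_all add: Hom_module_carrier)
    fix s assume s: "s \<in> carrier G"
    have \<chi>s: "\<chi> s \<in> carrier K" "\<chi>' s \<in> carrier K" using \<chi> \<chi>' s by (simp_all add: Hom_module_carrier)
    have ou: "orbit G \<phi> x \<in> Obj quot_cat" using orbit_in_orbits[OF x] by (simp add: quot_cat_simps)
    have "g (\<phi> s x) = (\<chi> s \<ominus>\<^bsub>K\<^esub> \<chi>' s) \<oplus>\<^bsub>K\<^esub> g x"
      using h h' s x \<chi>s by (simp add: g_def potential_def difference_of_sums h.h_closed h'.h_closed)
    moreover have "q (\<phi> s x) = q x" by (rule q_const[OF obj_act_closed[OF s x] x])
    ultimately have "((\<chi> s \<ominus>\<^bsub>K\<^esub> \<chi>' s) \<oplus>\<^bsub>K\<^esub> g x) \<ominus>\<^bsub>K\<^esub> l (orbit G \<phi> x) = g x \<ominus>\<^bsub>K\<^esub> l (orbit G \<phi> x)"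
      by (simp add: q_def orbit_of_translate s x)
    then have "(\<chi> s \<ominus>\<^bsub>K\<^esub> \<chi>' s) \<oplus>\<^bsub>K\<^esub> g x = g x"
      using \<chi>s gc[OF x] l[OF ou] by (simp add: minus_eq)
    then have "\<chi> s \<ominus>\<^bsub>K\<^esub> \<chi>' s = \<zero>\<^bsub>K\<^esub>" using \<chi>s gc[OF x] by simp
    then show "\<chi> s = \<chi>' s" by (rule eq_if_minus_zero[OF \<chi>s])
  qed
qed

end

theorem theorem4p1:
  fixes K :: "'k ring"
    and C :: "('o, 'm, 'k) kcat"
    and G :: "'g monoid"
    and \<phi> :: "'g \<Rightarrow> 'o \<Rightarrow> 'o"
    and \<alpha> :: "'g \<Rightarrow> 'o \<Rightarrow> 'o \<Rightarrow> 'm \<Rightarrow> 'm"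
    and B :: "('o set, ('o \<times> 'o \<Rightarrow> 'm) set, 'k) kcat"
  assumes "free_action K C G \<phi> \<alpha>"
    and "B = quotient_category K C G \<phi> \<alpha>"
    and "connected_category C"
    and "hom_finite K B"
    and "basic_category B"
    and "totally_split K B"
  shows "\<exists>\<Phi>. kmonomorphism K (Hom_module G K) (HH K B (standard_bimodule B) 1) \<Phi> \<and>
           (\<forall>\<chi>\<in>carrier (Hom_module G K). \<forall>h. potential K C G \<phi> \<chi> h \<longrightarrow>
              \<Phi> \<chi> = cohomology_class K B (standard_bimodule B) 1
                      (potential_cochain K C G \<phi> \<alpha> h))"
proof -
  interpret free_action K C G \<phi> \<alpha> by fact
  interpret H: module K "Hom_module G K"
    by (rule Hom_module_is_module[OF G.group_axioms cring_axioms])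
  let ?p = "potential_cochain K C G \<phi> \<alpha>"
  obtain h where h: "\<And>\<chi>. \<chi> \<in> carrier (Hom_module G K) \<Longrightarrow> potential K C G \<phi> \<chi> (h \<chi>)"
    using potential_exists by metis
  note inv = potential_invariant[OF _ h]
  note cocycle = invariant_potential.potential_cochain_cocycle[OF inv]
  define \<Phi> where "\<Phi> \<chi> = coh_class (?p (h \<chi>))" for \<chi>
  have \<Phi>: "\<Phi> \<chi> = coh_class (?p h')"
    if "\<chi> \<in> carrier (Hom_module G K)" "potential K C G \<phi> \<chi> h'" for \<chi> h'
    unfolding \<Phi>_def by (rule potential_cochain_independent[OF that(1) h[OF that(1)] that(2)])
  have "klinear K (Hom_module G K) quot_HH \<Phi>"
  proof (rule klinearI)
    fix \<chi> \<psi> a assume \<chi>: "\<chi> \<in> carrier (Hom_module G K)"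
    have \<chi>_cl: "\<chi> s \<in> carrier K" if "s \<in> carrier G" for s using \<chi> that by (simp add: Hom_module_carrier)
    have h_cl: "h \<chi> x \<in> carrier K" if "x \<in> Obj C" for x using h[OF \<chi>] that by (auto simp: potential_def)
    show "\<Phi> \<chi> \<in> carrier quot_HH"
      unfolding \<Phi>_def by (rule klinear_closed[OF coh_class_linear cocycle[OF \<chi> \<chi>]])
    show "\<Phi> (\<chi> \<oplus>\<^bsub>Hom_module G K\<^esub> \<psi>) = \<Phi> \<chi> \<oplus>\<^bsub>quot_HH\<^esub> \<Phi> \<psi>" if \<psi>: "\<psi> \<in> carrier (Hom_module G K)"
    proof -
      have sum: "potential K C G \<phi> (\<chi> \<oplus>\<^bsub>Hom_module G K\<^esub> \<psi>) (\<lambda>x. h \<chi> x \<oplus>\<^bsub>K\<^esub> h \<psi> x)"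
        using h[OF \<chi>] h[OF \<psi>] \<chi> \<psi>
        by (auto simp: potential_def Hom_module_def[of G K] hom_def Pi_iff a_ac)
      have sum_mem: "\<chi> \<oplus>\<^bsub>Hom_module G K\<^esub> \<psi> \<in> carrier (Hom_module G K)" using \<chi> \<psi> by simp
      show ?thesis
        unfolding \<Phi>[OF sum_mem sum]
          potential_cochain_add[OF inv[OF \<chi> \<chi>] inv[OF \<psi> \<psi>] potential_invariant[OF sum_mem sum]]
          klinear_add[OF coh_class_linear cocycle[OF \<chi> \<chi>] cocycle[OF \<psi> \<psi>]]
        by (simp add: \<Phi>_def)
    qed
    show "\<Phi> (a \<odot>\<^bsub>Hom_module G K\<^esub> \<chi>) = a \<odot>\<^bsub>quot_HH\<^esub> \<Phi> \<chi>" if a: "a \<in> carrier K"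
    proof -
      have prod: "potential K C G \<phi> (a \<odot>\<^bsub>Hom_module G K\<^esub> \<chi>) (\<lambda>x. a \<otimes>\<^bsub>K\<^esub> h \<chi> x)"
        using h[OF \<chi>] \<chi> a h_cl \<chi>_cl
        by (auto simp: potential_def Hom_module_def r_distr)
      have prod_mem: "a \<odot>\<^bsub>Hom_module G K\<^esub> \<chi> \<in> carrier (Hom_module G K)" using \<chi> a by simp
      show ?thesis
        unfolding \<Phi>[OF prod_mem prod]
          potential_cochain_smult[OF inv[OF \<chi> \<chi>] a potential_invariant[OF prod_mem prod]]
          klinear_smult[OF coh_class_linear a cocycle[OF \<chi> \<chi>]]
        by (simp add: \<Phi>_def)
    qed
  qed
  moreover have "inj_on \<Phi> (carrier (Hom_module G K))"
  proof (rule inj_onI)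
    fix \<chi> \<psi> assume \<chi>: "\<chi> \<in> carrier (Hom_module G K)" and \<psi>: "\<psi> \<in> carrier (Hom_module G K)"
      and "\<Phi> \<chi> = \<Phi> \<psi>"
    then show "\<chi> = \<psi>"
      using assms(3,4,6) unfolding \<Phi>_def assms(2)
      by (intro cohomologous_potentials[OF _ _ _ \<chi> h[OF \<chi>] \<psi> h[OF \<psi>]])
  qed
  ultimately have "kmonomorphism K (Hom_module G K) quot_HH \<Phi>"
    unfolding kmonomorphism_def using H.module_axioms quot_HH_is_module by blast
  then show ?thesis
    using \<Phi> unfolding assms(2) One_nat_def by blast
qed

end
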